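(* Let $\chi$ be a positive integer and $c_\ell=\frac\chi{192\pi}$. Let $g_{\overline N}$ be the instanton corrected q-map metric associated to the prepotential $\mathfrak F=-\frac16\frac{(Z^1)^3}{Z^0}+\chi\frac{(Z^0)^2\zeta(3)}{2(2\pi\mathrm i)^3}$ and the BPS indices $\Omega(q_0\gamma^0)=-\chi$ for $q_0\neq0$, $\Omega(\gamma)=0$ otherwise, and let $\widetilde N$ be the domain (on which $g_{\overline N}$ is defined and positive definite) $$\widetilde N=\{(\tau_2,b+\mathrm it,\tau_1,\zeta^1,\tilde\zeta_0,\tilde\zeta_1,\sigma)\in\mathbb R_{>0}\times(\mathbb R+\mathrm i\mathbb R_{>0})\times\mathbb R^4\times\mathbb R:\ R_1(t,\tau)>0,\ R_2(t,\tau)>0\}.$$ Then the positive definite quaternionic-Kähler manifold $(\widetilde N,g_{\overline N})$ has an effective action by isometries of the group $\mathrm{SL}(2,\mathbb Z)\ltimes(\mathbb R\ltimes H_4)$, where $\mathrm{SL}(2,\mathbb Z)$ acts by the S-duality action and $\mathbb R$ and $H_4$ act as described in the context.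
   Context: Repeated indices $i,j\in\{0,1\}$ are summed; $\tau=\tau_1+\mathrm i\tau_2$. **Domain functions.** $R_1(t,\tau)=\frac{t^3}3-\frac{\chi}{4(2\pi)^3}\sum_{(m,n)\ne(0,0)}|m\tau+n|^{-3}$ and $R_2(t,\tau)=\frac{t^3}3-\frac{3\chi}{4(2\pi)^3}\sum_{(m,n)\ne(0,0)}|m\tau+n|^{-3}-\frac{(3\chi)^2}{(4\pi)^6}\big(\sum_{(m,n)\ne(0,0)}|m\tau+n|^{-3}\big)^2R_1(t,\tau)^{-1}$, sums over $(m,n)\in\mathbb Z^2$. **The metric.** Let $M^{\mathrm{cl}}=\{(Z^0,Z^1)\in\mathbb C^2:Z^0\ne0,\ \mathrm{Im}(Z^1/Z^0)>0\}$, $z^0=1$, $z^1=Z^1/Z^0=b+\mathrm it$, $\tau_{ij}=\partial^2\mathfrak F/\partial Z^i\partial Z^j$. On $M^{\mathrm{cl}}\times\mathbb R^4\times\mathbb R$ use coordinates $(Z^0,Z^1,\zeta^0,\zeta^1,\tilde\zeta_0,\tilde\zeta_1,\sigma)$. With $K_\nu$ the modified Bessel functions of the second kind, for $q\in\mathbb Z\setminus\{0\}$ let $$V_q=\tfrac1{2\pi}\sum_{k>0}e^{-2\pi\mathrm ikq\zeta^0}K_0(2\pi k|qZ^0|),\quad A_q=-\tfrac1{4\pi}\sum_{k>0}e^{-2\pi\mathrm ikq\zeta^0}|qZ^0|K_1(2\pi k|qZ^0|)\Big(\tfrac{dZ^0}{Z^0}-\tfrac{d\overline Z^0}{\overline Z^0}\Big),$$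 $$\eta_q=\tfrac{\mathrm i}{8\pi^2}\sum_{k>0}\tfrac{e^{-2\pi\mathrm ikq\zeta^0}}k|qZ^0|K_1(2\pi k|qZ^0|)\Big(\tfrac{dZ^0}{Z^0}-\tfrac{d\overline Z^0}{\overline Z^0}\Big).$$ Let $T_{ij}=-\mathrm{Im}\,\tau_{ij}+\chi\,\delta_{i0}\delta_{j0}\sum_{q\ne0}q^2V_q$ with inverse $T^{ij}$; $W_i=d\tilde\zeta_i-\tau_{ij}d\zeta^j$; $W_0^{\mathrm{inst}}=\chi\sum_{q\ne0}q(A_q+\mathrm iqV_qd\zeta^0)$, $W_1^{\mathrm{inst}}=0$; $$g_N=2\pi\big(T_{ij}dZ^id\overline Z^j+(W_i+W_i^{\mathrm{inst}})T^{ij}(\overline W_j+\overline W_j^{\mathrm{inst}})\big),\qquad\omega_1+\mathrm i\omega_2=2\pi dZ^i\wedge(W_i+W_i^{\mathrm{inst}}).$$ Let $V=2\mathrm i(Z^i\partial_{Z^i}-\overline Z^i\partial_{\overline Z^i})$, $r^2=-\mathrm{Im}(\tau_{ij})Z^i\overline Z^j$, $f=2\pi\big(r^2-8c_\ell+\chi\sum_{q\ne0}\eta_q(V)\big)$, $f_3=f-\frac12g_N(V,V)$, $d^c=\mathrm i(\overline\partial-\partial)$, $\theta_0=-\frac12df$, $\theta_1=\frac12\iota_V\omega_2$, $\theta_2=-\frac12\iota_V\omega_1$, $\theta_3=\pi(d\sigma+\tilde\zeta_id\zeta^i-\zeta^id\tilde\zeta_i)+\frac\pi2d^cr^2+2\pi\chi\sum_{q\ne0}\eta_q$,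 $\eta=\theta_3-\frac12\iota_Vg_N$. The instanton corrected q-map metric is $$g_{\overline N}=-\frac1f\Big(\frac2{f_3}\eta^2+g_N-\frac2f\sum_{k=0}^3\theta_k^2\Big)\Big|_{\{\mathrm{Arg}Z^0=0\}},$$ where $\{\mathrm{Arg}Z^0=0\}$ carries the coordinates $(\tau_2,b+\mathrm it,\tau_1,\zeta^1,\tilde\zeta_0,\tilde\zeta_1,\sigma)$ with $\tau_2=|Z^0|$, $\tau_1=\zeta^0$. **Type IIB coordinates and actions.** Coordinates $(\tau,b+\mathrm it,c^1,c_1,c_0,\psi)$ are defined by $\zeta^0=\tau_1$, $\zeta^1=-(c^1-\tau_1b)$, $\tilde\zeta_1=c_1+\frac12b(c^1-\tau_1b)$, $\tilde\zeta_0=c_0-\frac16b^2(c^1-\tau_1b)$, $\sigma=-2(\psi+\frac12\tau_1c_0)+c_1(c^1-\tau_1b)-\frac16bc^1(c^1-\tau_1b)$. The S-duality action of $\begin{pmatrix}\alpha&\beta\\\gamma&\delta\end{pmatrix}\in\mathrm{SL}(2,\mathbb Z)$ is $\tau\mapsto\frac{\alpha\tau+\beta}{\gamma\tau+\delta}$, $t\mapsto|\gamma\tau+\delta|t$, $c_1\mapsto c_1$, $(c^1,b)\mapsto(\alpha c^1+\beta b,\gamma c^1+\delta b)$, $(c_0,\psi)\mapsto(\delta c_0-\gamma\psi,-\beta c_0+\alpha\psi)$. The element $v\in\mathbb R$ fixes $\tau_2,\zeta^0,\sigma$ and maps $z^1\mapsto z^1+v$, $\zeta^1\mapsto\zeta^1+\zeta^0v$,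 $\tilde\zeta_0\mapsto\tilde\zeta_0+\frac16v^3\zeta^0+\frac12v^2\zeta^1-\tilde\zeta_1v$, $\tilde\zeta_1\mapsto\tilde\zeta_1-\frac12\zeta^0v^2-v\zeta^1$. $H_4=\{(\eta^i,\tilde\eta_i,\kappa)\in\mathrm{Heis}_5(\mathbb R):\eta^0=0\}$ fixes $\tau_2,z^1$ and maps $(\zeta^i,\tilde\zeta_i,\sigma)\mapsto(\zeta^i+\eta^i,\tilde\zeta_i+\tilde\eta_i,\sigma+\kappa+\tilde\zeta_i\eta^i-\zeta^i\tilde\eta_i)$; the group law of $\mathrm{Heis}_5(\mathbb R)$ is $(\eta,\tilde\eta,\kappa)(\eta',\tilde\eta',\kappa')=(\eta+\eta',\tilde\eta+\tilde\eta',\kappa+\kappa'+\eta^i\tilde\eta'_i-\tilde\eta_i\eta'^i)$. The semidirect products are those determined by these actions. *)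

theory Defs
  imports "HOL-Analysis.Analysis" "HOL-Algebra.Group_Action"
begin

text \<open>
  The indices \<open>i, j \<in> {0, 1}\<close> are the elements \<open>0\<close> and \<open>1\<close> of the numeral type \<open>2\<close>.
  A tangent vector at a point of an open subset of a Euclidean space is an element of that space.
  Differential one-forms are functions of a point and a tangent vector; a symmetric bilinear form
  is a function of a point and two tangent vectors.
\<close>

type_synonym nspace = "(complex^2) \<times> (real^2) \<times> (real^2) \<times> real"
  \<comment> \<open>\<open>((Z\<^sup>0, Z\<^sup>1), (\<zeta>\<^sup>0, \<zeta>\<^sup>1), (\<zeta>~\<^sub>0, \<zeta>~\<^sub>1), \<sigma>)\<close>\<close>

type_synonym iia = "real \<times> complex \<times> (real^2) \<times> (real^2) \<times> real"
  \<comment> \<open>\<open>(\<tau>\<^sub>2, b + i t, (\<zeta>\<^sup>0 = \<tau>\<^sub>1, \<zeta>\<^sup>1), (\<zeta>~\<^sub>0, \<zeta>~\<^sub>1), \<sigma>)\<close>\<close>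

type_synonym iib = "complex \<times> complex \<times> real \<times> real \<times> real \<times> real"
  \<comment> \<open>\<open>(\<tau>, b + i t, c\<^sup>1, c\<^sub>1, c\<^sub>0, \<psi>)\<close>\<close>

definition pair :: "'a \<Rightarrow> 'a \<Rightarrow> 'a^2" where
  "pair x y = (\<chi> i. if i = 0 then x else y)"

abbreviation Z_of :: "nspace \<Rightarrow> complex^2" where "Z_of P \<equiv> fst P"
abbreviation zeta_of :: "nspace \<Rightarrow> real^2" where "zeta_of P \<equiv> fst (snd P)"
abbreviation tzeta_of :: "nspace \<Rightarrow> real^2" where "tzeta_of P \<equiv> fst (snd (snd P))"
abbreviation sigma_of :: "nspace \<Rightarrow> real" where "sigma_of P \<equiv> snd (snd (snd P))"


section \<open>Special functions\<close>

definition bessel_K :: "real \<Rightarrow> real \<Rightarrow> real" where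
  "bessel_K \<nu> x = integral {0..} (\<lambda>s. exp (- x * cosh s) * cosh (\<nu> * s))"
  \<comment> \<open>modified Bessel function of the second kind, for \<open>x > 0\<close>\<close>

definition zeta3 :: real where
  "zeta3 = (\<Sum>n. 1 / real (Suc n) ^ 3)"

definition eisenstein :: "complex \<Rightarrow> real" where
  "eisenstein \<tau> =
    (\<Sum>\<^sub>\<infinity>(m, n)\<in>(UNIV :: (int \<times> int) set) - {(0, 0)}. 1 / cmod (of_int m * \<tau> + of_int n) ^ 3)"


section \<open>The domain\<close>

definition R1 :: "nat \<Rightarrow> real \<Rightarrow> complex \<Rightarrow> real" where
  "R1 chi t \<tau> = t ^ 3 / 3 - real chi / (4 * (2 * pi) ^ 3) * eisenstein \<tau>"

definition R2 :: "nat \<Rightarrow> real \<Rightarrow> complex \<Rightarrow> real" where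
  "R2 chi t \<tau> = t ^ 3 / 3 - 3 * real chi / (4 * (2 * pi) ^ 3) * eisenstein \<tau>
     - (3 * real chi)\<^sup>2 / (4 * pi) ^ 6 * (eisenstein \<tau>)\<^sup>2 * inverse (R1 chi t \<tau>)"

definition iia_space :: "iia set" where
  "iia_space = {(\<tau>2, z, \<zeta>, \<zeta>t, \<sigma>). \<tau>2 > 0 \<and> Im z > 0}"

definition N_tilde :: "nat \<Rightarrow> iia set" where
  "N_tilde chi = {(\<tau>2, z, \<zeta>, \<zeta>t, \<sigma>). \<tau>2 > 0 \<and> Im z > 0 \<and>
     R1 chi (Im z) (Complex (\<zeta> $ 0) \<tau>2) > 0 \<and> R2 chi (Im z) (Complex (\<zeta> $ 0) \<tau>2) > 0}"


section \<open>The instanton corrected q-map metric\<close>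

definition prepotential :: "nat \<Rightarrow> complex^2 \<Rightarrow> complex" where
  "prepotential chi Z = - (1 / 6) * (Z $ 1) ^ 3 / Z $ 0
     + of_nat chi * ((Z $ 0)\<^sup>2 * of_real zeta3) / (2 * (2 * of_real pi * \<i>) ^ 3)"

definition holo_partial :: "2 \<Rightarrow> (complex^2 \<Rightarrow> complex) \<Rightarrow> complex^2 \<Rightarrow> complex" where
  "holo_partial i G Z = deriv (\<lambda>w. G (\<chi> k. if k = i then w else Z $ k)) (Z $ i)"

definition tau :: "(complex^2 \<Rightarrow> complex) \<Rightarrow> complex^2 \<Rightarrow> 2 \<Rightarrow> 2 \<Rightarrow> complex" where
  "tau \<FF> Z i j = holo_partial i (holo_partial j \<FF>) Z"

definition dlog_Z0 :: "nspace \<Rightarrow> nspace \<Rightarrow> complex" where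
  "dlog_Z0 P X = Z_of X $ 0 / Z_of P $ 0 - cnj (Z_of X $ 0) / cnj (Z_of P $ 0)"

definition inst_V :: "int \<Rightarrow> nspace \<Rightarrow> complex" where
  "inst_V q P = 1 / (2 * of_real pi) *
     (\<Sum>\<^sub>\<infinity>k\<in>{1::nat..}. exp (- 2 * of_real pi * \<i> * of_nat k * of_int q * of_real (zeta_of P $ 0)) *
        of_real (bessel_K 0 (2 * pi * real k * cmod (of_int q * Z_of P $ 0))))"

definition inst_A :: "int \<Rightarrow> nspace \<Rightarrow> nspace \<Rightarrow> complex" where
  "inst_A q P X = - (1 / (4 * of_real pi)) *
     (\<Sum>\<^sub>\<infinity>k\<in>{1::nat..}. exp (- 2 * of_real pi * \<i> * of_nat k * of_int q * of_real (zeta_of P $ 0)) *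
        of_real (cmod (of_int q * Z_of P $ 0) *
          bessel_K 1 (2 * pi * real k * cmod (of_int q * Z_of P $ 0)))) *
     dlog_Z0 P X"

definition inst_eta :: "int \<Rightarrow> nspace \<Rightarrow> nspace \<Rightarrow> complex" where
  "inst_eta q P X = \<i> / (8 * (of_real pi)\<^sup>2) *
     (\<Sum>\<^sub>\<infinity>k\<in>{1::nat..}. exp (- 2 * of_real pi * \<i> * of_nat k * of_int q * of_real (zeta_of P $ 0)) / of_nat k *
        of_real (cmod (of_int q * Z_of P $ 0) *
          bessel_K 1 (2 * pi * real k * cmod (of_int q * Z_of P $ 0)))) *
     dlog_Z0 P X"

text \<open>
  The sums over \<open>q \<noteq> 0\<close> of \<open>q\<^sup>2 V\<^sub>q\<close> and of \<open>\<eta>\<^sub>q\<close> are real, because the terms for \<open>q\<close> and \<open>-q\<close>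
  are complex conjugate; \<open>Re\<close> below only changes the type.
\<close>

definition T_mat :: "(complex^2 \<Rightarrow> complex) \<Rightarrow> nat \<Rightarrow> nspace \<Rightarrow> real^2^2" where
  "T_mat \<FF> chi P = (\<chi> i j. - Im (tau \<FF> (Z_of P) i j)
     + (if i = 0 \<and> j = 0
        then real chi * Re (\<Sum>\<^sub>\<infinity>q\<in>UNIV - {0}. (of_int q)\<^sup>2 * inst_V q P) else 0))"

definition W_form :: "(complex^2 \<Rightarrow> complex) \<Rightarrow> nspace \<Rightarrow> 2 \<Rightarrow> nspace \<Rightarrow> complex" where
  "W_form \<FF> P i X = of_real (tzeta_of X $ i)
     - (\<Sum>j\<in>UNIV. tau \<FF> (Z_of P) i j * of_real (zeta_of X $ j))"

definition W_inst :: "nat \<Rightarrow> nspace \<Rightarrow> 2 \<Rightarrow> nspace \<Rightarrow> complex" where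
  "W_inst chi P i X =
     (if i = 0
      then of_nat chi * (\<Sum>\<^sub>\<infinity>q\<in>UNIV - {0}. of_int q *
             (inst_A q P X + \<i> * of_int q * inst_V q P * of_real (zeta_of X $ 0)))
      else 0)"

definition W_tot :: "(complex^2 \<Rightarrow> complex) \<Rightarrow> nat \<Rightarrow> nspace \<Rightarrow> 2 \<Rightarrow> nspace \<Rightarrow> complex" where
  "W_tot \<FF> chi P i X = W_form \<FF> P i X + W_inst chi P i X"

text \<open>
  A product \<open>\<alpha> \<beta>\<close> of one-forms in a metric is the symmetrised tensor product, so that
  \<open>h\<^sub>i\<^sub>j \<alpha>\<^sup>i cnj \<alpha>\<^sup>j\<close>, with \<open>h\<close> real symmetric, is the real part of a Hermitian form.
\<close>

definition g_N :: "(complex^2 \<Rightarrow> complex) \<Rightarrow> nat \<Rightarrow> nspace \<Rightarrow> nspace \<Rightarrow> nspace \<Rightarrow> real" where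
  "g_N \<FF> chi P X Y = 2 * pi * Re (\<Sum>i\<in>UNIV. \<Sum>j\<in>UNIV.
       of_real (T_mat \<FF> chi P $ i $ j) * Z_of X $ i * cnj (Z_of Y $ j)
     + W_tot \<FF> chi P i X * of_real (matrix_inv (T_mat \<FF> chi P) $ i $ j) * cnj (W_tot \<FF> chi P j Y))"

definition omega12 :: "(complex^2 \<Rightarrow> complex) \<Rightarrow> nat \<Rightarrow> nspace \<Rightarrow> nspace \<Rightarrow> nspace \<Rightarrow> complex" where
  "omega12 \<FF> chi P X Y = 2 * of_real pi * (\<Sum>i\<in>UNIV.
       Z_of X $ i * W_tot \<FF> chi P i Y - Z_of Y $ i * W_tot \<FF> chi P i X)"
  \<comment> \<open>\<open>\<omega>\<^sub>1 + i \<omega>\<^sub>2\<close>\<close>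

definition V_field :: "nspace \<Rightarrow> nspace" where
  "V_field P = ((\<chi> i. 2 * \<i> * Z_of P $ i), 0, 0, 0)"
  \<comment> \<open>a real vector field is given by its \<open>\<partial>/\<partial>Z\<^sup>i\<close> components; those along \<open>\<partial>/\<partial>cnj Z\<^sup>i\<close> are conjugate\<close>

definition r_squared :: "(complex^2 \<Rightarrow> complex) \<Rightarrow> complex^2 \<Rightarrow> real" where
  "r_squared \<FF> Z = - Re (\<Sum>i\<in>UNIV. \<Sum>j\<in>UNIV. of_real (Im (tau \<FF> Z i j)) * Z $ i * cnj (Z $ j))"

definition f_fun :: "(complex^2 \<Rightarrow> complex) \<Rightarrow> nat \<Rightarrow> real \<Rightarrow> nspace \<Rightarrow> real" where
  "f_fun \<FF> chi c P = 2 * pi * (r_squared \<FF> (Z_of P) - 8 * c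
     + real chi * Re (\<Sum>\<^sub>\<infinity>q\<in>UNIV - {0}. inst_eta q P (V_field P)))"

definition f3_fun :: "(complex^2 \<Rightarrow> complex) \<Rightarrow> nat \<Rightarrow> real \<Rightarrow> nspace \<Rightarrow> real" where
  "f3_fun \<FF> chi c P = f_fun \<FF> chi c P - 1 / 2 * g_N \<FF> chi P (V_field P) (V_field P)"

definition del :: "(complex^2 \<Rightarrow> real) \<Rightarrow> complex^2 \<Rightarrow> complex^2 \<Rightarrow> complex" where
  "del h Z X = (of_real (frechet_derivative h (at Z) X)
     - \<i> * of_real (frechet_derivative h (at Z) (\<i> *s X))) / 2"

definition delbar :: "(complex^2 \<Rightarrow> real) \<Rightarrow> complex^2 \<Rightarrow> complex^2 \<Rightarrow> complex" where
  "delbar h Z X = (of_real (frechet_derivative h (at Z) X)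
     + \<i> * of_real (frechet_derivative h (at Z) (\<i> *s X))) / 2"

definition d_c :: "(complex^2 \<Rightarrow> real) \<Rightarrow> complex^2 \<Rightarrow> complex^2 \<Rightarrow> real" where
  "d_c h Z X = Re (\<i> * (delbar h Z X - del h Z X))"

definition theta0 :: "(complex^2 \<Rightarrow> complex) \<Rightarrow> nat \<Rightarrow> real \<Rightarrow> nspace \<Rightarrow> nspace \<Rightarrow> real" where
  "theta0 \<FF> chi c P X = - 1 / 2 * frechet_derivative (f_fun \<FF> chi c) (at P) X"

definition theta1 :: "(complex^2 \<Rightarrow> complex) \<Rightarrow> nat \<Rightarrow> nspace \<Rightarrow> nspace \<Rightarrow> real" where
  "theta1 \<FF> chi P X = 1 / 2 * Im (omega12 \<FF> chi P (V_field P) X)"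

definition theta2 :: "(complex^2 \<Rightarrow> complex) \<Rightarrow> nat \<Rightarrow> nspace \<Rightarrow> nspace \<Rightarrow> real" where
  "theta2 \<FF> chi P X = - 1 / 2 * Re (omega12 \<FF> chi P (V_field P) X)"

definition theta3 :: "(complex^2 \<Rightarrow> complex) \<Rightarrow> nat \<Rightarrow> nspace \<Rightarrow> nspace \<Rightarrow> real" where
  "theta3 \<FF> chi P X =
     pi * (sigma_of X + (\<Sum>i\<in>UNIV. tzeta_of P $ i * zeta_of X $ i - zeta_of P $ i * tzeta_of X $ i))
     + pi / 2 * d_c (r_squared \<FF>) (Z_of P) (Z_of X)
     + 2 * pi * real chi * Re (\<Sum>\<^sub>\<infinity>q\<in>UNIV - {0}. inst_eta q P X)"

definition eta_form :: "(complex^2 \<Rightarrow> complex) \<Rightarrow> nat \<Rightarrow> nspace \<Rightarrow> nspace \<Rightarrow> real" where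
  "eta_form \<FF> chi P X = theta3 \<FF> chi P X - 1 / 2 * g_N \<FF> chi P (V_field P) X"

definition qk_form ::
  "(complex^2 \<Rightarrow> complex) \<Rightarrow> nat \<Rightarrow> real \<Rightarrow> nspace \<Rightarrow> nspace \<Rightarrow> nspace \<Rightarrow> real" where
  "qk_form \<FF> chi c P X Y = - 1 / f_fun \<FF> chi c P *
     (2 / f3_fun \<FF> chi c P * (eta_form \<FF> chi P X * eta_form \<FF> chi P Y) + g_N \<FF> chi P X Y
      - 2 / f_fun \<FF> chi c P *
        (theta0 \<FF> chi c P X * theta0 \<FF> chi c P Y + theta1 \<FF> chi P X * theta1 \<FF> chi P Y
         + theta2 \<FF> chi P X * theta2 \<FF> chi P Y + theta3 \<FF> chi P X * theta3 \<FF> chi P Y))"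

text \<open>The inclusion of the hypersurface \<open>Arg Z\<^sup>0 = 0\<close>, in the coordinates \<open>\<tau>\<^sub>2 = |Z\<^sup>0|\<close>, \<open>z\<^sup>1 = Z\<^sup>1 / Z\<^sup>0\<close>.\<close>

fun slice :: "iia \<Rightarrow> nspace" where
  "slice (\<tau>2, z, \<zeta>, \<zeta>t, \<sigma>) = (pair (of_real \<tau>2) (of_real \<tau>2 * z), \<zeta>, \<zeta>t, \<sigma>)"

definition qmap_metric ::
  "(complex^2 \<Rightarrow> complex) \<Rightarrow> nat \<Rightarrow> real \<Rightarrow> iia \<Rightarrow> iia \<Rightarrow> iia \<Rightarrow> real" where
  "qmap_metric \<FF> chi c p X Y = qk_form \<FF> chi c (slice p)
     (frechet_derivative slice (at p) X) (frechet_derivative slice (at p) Y)"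

definition qmap_metric_defined :: "(complex^2 \<Rightarrow> complex) \<Rightarrow> nat \<Rightarrow> real \<Rightarrow> iia \<Rightarrow> bool" where
  "qmap_metric_defined \<FF> chi c p \<longleftrightarrow> invertible (T_mat \<FF> chi (slice p)) \<and>
     f_fun \<FF> chi c (slice p) \<noteq> 0 \<and> f3_fun \<FF> chi c (slice p) \<noteq> 0"


section \<open>Isometries\<close>

definition positive_definite :: "('a::real_vector \<Rightarrow> 'a \<Rightarrow> real) \<Rightarrow> bool" where
  "positive_definite B \<longleftrightarrow> bilinear B \<and> (\<forall>X Y. B X Y = B Y X) \<and> (\<forall>X. X \<noteq> 0 \<longrightarrow> B X X > 0)"

primrec Ck_on :: "nat \<Rightarrow> 'a::real_normed_vector set \<Rightarrow> ('a \<Rightarrow> 'b::real_normed_vector) \<Rightarrow> bool" where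
  "Ck_on 0 S F \<longleftrightarrow> continuous_on S F"
| "Ck_on (Suc k) S F \<longleftrightarrow>
     F differentiable_on S \<and> (\<forall>v. Ck_on k S (\<lambda>x. frechet_derivative F (at x) v))"

definition smooth_on :: "'a::real_normed_vector set \<Rightarrow> ('a \<Rightarrow> 'b::real_normed_vector) \<Rightarrow> bool" where
  "smooth_on S F \<longleftrightarrow> (\<forall>k. Ck_on k S F)"

definition isometry_on ::
  "'a::real_normed_vector set \<Rightarrow> ('a \<Rightarrow> 'a \<Rightarrow> 'a \<Rightarrow> real) \<Rightarrow> ('a \<Rightarrow> 'a) \<Rightarrow> bool" where
  "isometry_on S g F \<longleftrightarrow> bij_betw F S S \<and> smooth_on S F \<and> smooth_on S (inv_into S F) \<and>
     (\<forall>p\<in>S. \<forall>X Y.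
        g (F p) (frechet_derivative F (at p) X) (frechet_derivative F (at p) Y) = g p X Y)"


section \<open>Semidirect products\<close>

definition semidirect ::
  "('a, 'm) monoid_scheme \<Rightarrow> ('b, 'n) monoid_scheme \<Rightarrow> ('a \<Rightarrow> 'b \<Rightarrow> 'b) \<Rightarrow> ('a \<times> 'b) monoid" where
  "semidirect G H \<phi> = \<lparr>carrier = carrier G \<times> carrier H,
     monoid.mult = (\<lambda>(g, h) (g', h'). (g \<otimes>\<^bsub>G\<^esub> g', h \<otimes>\<^bsub>H\<^esub> \<phi> g h')),
     one = (\<one>\<^bsub>G\<^esub>, \<one>\<^bsub>H\<^esub>)\<rparr>"

text \<open>
  If \<open>G\<close> and \<open>H\<close> act on \<open>E\<close>, \<open>H\<close> effectively, and \<open>G\<close> normalises \<open>H\<close> as transformations of \<open>E\<close>,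
  then \<open>g\<close> acts on \<open>H\<close> by conjugation, \<open>h \<mapsto> g h g\<^sup>-\<^sup>1\<close>. The pair \<open>(g, h)\<close> acts on \<open>E\<close> as \<open>h \<circ> g\<close>.
\<close>

definition conjugation ::
  "'x set \<Rightarrow> ('a \<Rightarrow> 'x \<Rightarrow> 'x) \<Rightarrow> ('b, 'n) monoid_scheme \<Rightarrow> ('b \<Rightarrow> 'x \<Rightarrow> 'x) \<Rightarrow> 'a \<Rightarrow> 'b \<Rightarrow> 'b" where
  "conjugation E actG H actH g h =
     (THE h'. h' \<in> carrier H \<and> (\<forall>x\<in>E. actH h' (actG g x) = actG g (actH h x)))"

definition semidirect_act ::
  "('a \<Rightarrow> 'x \<Rightarrow> 'x) \<Rightarrow> ('b \<Rightarrow> 'x \<Rightarrow> 'x) \<Rightarrow> 'a \<times> 'b \<Rightarrow> 'x \<Rightarrow> 'x" where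
  "semidirect_act actG actH = (\<lambda>(g, h) x. actH h (actG g x))"


section \<open>The groups and their actions\<close>

definition SL2Z :: "(int^2^2) monoid" where
  "SL2Z = \<lparr>carrier = {A. det A = 1}, monoid.mult = (**), one = mat 1\<rparr>"

fun iib_to_iia :: "iib \<Rightarrow> iia" where
  "iib_to_iia (\<tau>, z, cu1, c1, c0, \<psi>) =
     (let \<tau>1 = Re \<tau>; b = Re z in
      (Im \<tau>, z,
       pair \<tau>1 (- (cu1 - \<tau>1 * b)),
       pair (c0 - 1 / 6 * b\<^sup>2 * (cu1 - \<tau>1 * b)) (c1 + 1 / 2 * b * (cu1 - \<tau>1 * b)),
       - 2 * (\<psi> + 1 / 2 * \<tau>1 * c0) + c1 * (cu1 - \<tau>1 * b) - 1 / 6 * b * cu1 * (cu1 - \<tau>1 * b)))"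

fun S_duality_iib :: "int^2^2 \<Rightarrow> iib \<Rightarrow> iib" where
  "S_duality_iib A (\<tau>, z, cu1, c1, c0, \<psi>) =
     (let \<alpha> = A $ 0 $ 0; \<beta> = A $ 0 $ 1; \<gamma> = A $ 1 $ 0; \<delta> = A $ 1 $ 1; b = Re z; t = Im z in
      ((of_int \<alpha> * \<tau> + of_int \<beta>) / (of_int \<gamma> * \<tau> + of_int \<delta>),
       Complex (of_int \<gamma> * cu1 + of_int \<delta> * b) (cmod (of_int \<gamma> * \<tau> + of_int \<delta>) * t),
       of_int \<alpha> * cu1 + of_int \<beta> * b,
       c1,
       of_int \<delta> * c0 - of_int \<gamma> * \<psi>,
       - of_int \<beta> * c0 + of_int \<alpha> * \<psi>))"

definition S_duality :: "int^2^2 \<Rightarrow> iia \<Rightarrow> iia" where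
  "S_duality A p = iib_to_iia (S_duality_iib A (the_inv iib_to_iia p))"

definition R_add :: "real monoid" where
  "R_add = \<lparr>carrier = UNIV, monoid.mult = (+), one = 0\<rparr>"

fun R_act :: "real \<Rightarrow> iia \<Rightarrow> iia" where
  "R_act v (\<tau>2, z, \<zeta>, \<zeta>t, \<sigma>) =
     (\<tau>2, z + of_real v,
      pair (\<zeta> $ 0) (\<zeta> $ 1 + \<zeta> $ 0 * v),
      pair (\<zeta>t $ 0 + 1 / 6 * v ^ 3 * \<zeta> $ 0 + 1 / 2 * v\<^sup>2 * \<zeta> $ 1 - \<zeta>t $ 1 * v)
           (\<zeta>t $ 1 - 1 / 2 * \<zeta> $ 0 * v\<^sup>2 - v * \<zeta> $ 1),
      \<sigma>)"

definition Heis5 :: "((real^2) \<times> (real^2) \<times> real) monoid" where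
  "Heis5 = \<lparr>carrier = UNIV,
     monoid.mult = (\<lambda>(\<eta>, \<eta>t, \<kappa>) (\<eta>', \<eta>t', \<kappa>').
       (\<eta> + \<eta>', \<eta>t + \<eta>t', \<kappa> + \<kappa>' + (\<Sum>i\<in>UNIV. \<eta> $ i * \<eta>t' $ i - \<eta>t $ i * \<eta>' $ i))),
     one = (0, 0, 0)\<rparr>"

definition H4 :: "((real^2) \<times> (real^2) \<times> real) monoid" where
  "H4 = Heis5\<lparr>carrier := {(\<eta>, \<eta>t, \<kappa>). \<eta> $ 0 = 0}\<rparr>"

fun Heis5_act :: "(real^2) \<times> (real^2) \<times> real \<Rightarrow> iia \<Rightarrow> iia" where
  "Heis5_act (\<eta>, \<eta>t, \<kappa>) (\<tau>2, z, \<zeta>, \<zeta>t, \<sigma>) =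
     (\<tau>2, z, \<zeta> + \<eta>, \<zeta>t + \<eta>t, \<sigma> + \<kappa> + (\<Sum>i\<in>UNIV. \<zeta>t $ i * \<eta> $ i - \<zeta> $ i * \<eta>t $ i))"

definition R_H4 :: "(real \<times> ((real^2) \<times> (real^2) \<times> real)) monoid" where
  "R_H4 = semidirect R_add H4 (conjugation iia_space R_act H4 Heis5_act)"

definition R_H4_act :: "real \<times> ((real^2) \<times> (real^2) \<times> real) \<Rightarrow> iia \<Rightarrow> iia" where
  "R_H4_act = semidirect_act R_act Heis5_act"

definition SL2Z_R_H4 :: "((int^2^2) \<times> (real \<times> ((real^2) \<times> (real^2) \<times> real))) monoid" where
  "SL2Z_R_H4 = semidirect SL2Z R_H4 (conjugation iia_space S_duality R_H4 R_H4_act)"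

definition SL2Z_R_H4_act :: "(int^2^2) \<times> (real \<times> ((real^2) \<times> (real^2) \<times> real)) \<Rightarrow> iia \<Rightarrow> iia" where
  "SL2Z_R_H4_act = semidirect_act S_duality R_H4_act"

end

theory Submission
  imports Defs "HOL-Real_Asymp.Real_Asymp"
begin

text \<open>
  Poisson summation turns the instanton sums into lattice sums. Integrating Lipschitz' formula for
  \<open>\<Sum>\<^sub>n (w + n)\<^sup>-\<^sup>k\<close>, \<open>k = 2, 3\<close>, at \<open>w = x + i a cosh s\<close> over \<open>s\<close> produces the Bessel functions,
  and the sums over \<open>q\<close> and \<open>k\<close> become \<open>E(\<tau>) = \<Sum> |m \<tau> + n|\<^sup>-\<^sup>3\<close> (\<open>eisenstein\<close>) and
  \<open>G(\<tau>) = \<Sum> (m \<tau> + n)\<^sup>2 / |m \<tau> + n|\<^sup>5\<close> (\<open>twisted_eisenstein\<close>); the terms with \<open>m = 0\<close> come from the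
  \<open>\<zeta>(3)\<close> term of the prepotential and from the one-loop constant. In particular
  \<open>f = 4 \<pi> \<tau>\<^sub>2\<^sup>2 R\<^sub>1\<close>.

  In terms of four complex one-forms \<open>((a, c), (p, d\<tau>))\<close> (\<open>coframe\<close>) the metric is, up to scalars,
  the sum of a form in \<open>(a, c)\<close> and a form in \<open>(p, d\<tau>)\<close>, whose coefficients are rational in
  \<open>t\<close>, \<open>R\<^sub>1\<close> and a multiple \<open>g\<close> of \<open>G\<close>. Both are positive definite because
  \<open>|G| \<le> E\<close> gives \<open>2 |g| < t\<^sup>3 - R\<^sub>1\<close>. With \<open>j = \<gamma> \<tau> + \<delta>\<close>, S-duality multiplies \<open>a\<close> and \<open>c\<close> by \<open>1/j\<close>
  and \<open>d\<tau>\<close> by \<open>1/j\<^sup>2\<close>, fixes \<open>p\<close>, multiplies \<open>t\<close> by \<open>|j|\<close>, \<open>E\<close> by \<open>|j|\<^sup>3\<close> and \<open>G\<close> by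
  \<open>|j|\<^sup>3 cnj j / j\<close>; the metric is invariant under these substitutions. The actions of \<open>\<real>\<close> and \<open>H\<^sub>4\<close>
  fix all four forms and all coefficients. Finally, in type IIB coordinates \<open>R_H4\<close> consists of
  polynomial shifts that S-duality permutes.
\<close>

section \<open>Two-sided sums and Lipschitz' formula\<close>

lemma summable_on_Un_ranges:
  fixes h :: "'a \<Rightarrow> 'b :: banach" and f g :: "nat \<Rightarrow> 'a"
  assumes "inj f" "inj g" "range f \<inter> range g = {}"
    and "(\<lambda>k. h (f k)) summable_on UNIV" "(\<lambda>k. h (g k)) summable_on UNIV"
  shows "h summable_on (range f \<union> range g)"
  using assms by (intro summable_on_Un_disjoint) (simp_all add: summable_on_reindex o_def)

lemma sums_infsum_Un_ranges:
  fixes h :: "'a \<Rightarrow> 'b :: banach" and f g :: "nat \<Rightarrow> 'a"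
  assumes "inj f" "inj g" "range f \<inter> range g = {}" "h summable_on (range f \<union> range g)"
  shows "(\<lambda>k. h (f k) + h (g k)) sums infsum h (range f \<union> range g)"
proof -
  have sum_range: "(\<lambda>k. h (e k)) sums infsum h (range e)"
    if "inj e" "range e \<subseteq> range f \<union> range g" for e :: "nat \<Rightarrow> 'a"
    using has_sum_infsum[OF summable_on_subset_banach[OF assms(4) that(2)]] that(1)
    by (auto simp: has_sum_reindex o_def intro: has_sum_imp_sums)
  have "infsum h (range f \<union> range g) = infsum h (range f) + infsum h (range g)"
    using assms(3,4) by (intro infsum_Un_disjoint) (auto intro: summable_on_subset_banach)
  thus ?thesis using assms(1,2) by (simp add: sums_add sum_range)
qed

lemma int_UNIV_eq_Un_ranges: "(UNIV :: int set) = range int \<union> range (\<lambda>k. - int k - 1)"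
proof (intro equalityI subsetI)
  fix n :: int
  show "n \<in> range int \<union> range (\<lambda>k. - int k - 1)"
  proof (cases "n \<ge> 0")
    case True
    thus ?thesis by (intro UnI1 range_eqI[of _ _ "nat n"]) simp
  next
    case False
    thus ?thesis by (intro UnI2 range_eqI[of _ _ "nat (- n - 1)"]) simp
  qed
qed simp

lemma nonzero_int_eq_Un_ranges:
  "UNIV - {0 :: int} = range (\<lambda>k. int (Suc k)) \<union> range (\<lambda>k. - int (Suc k))"
proof (intro equalityI subsetI)
  fix n :: int assume n_nonzero: "n \<in> UNIV - {0}"
  show "n \<in> range (\<lambda>k. int (Suc k)) \<union> range (\<lambda>k. - int (Suc k))"
  proof (cases "n > 0")
    case True
    thus ?thesis by (intro UnI1 range_eqI[of _ _ "nat (n - 1)"]) simp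
  next
    case False
    thus ?thesis using n_nonzero by (intro UnI2 range_eqI[of _ _ "nat (- n - 1)"]) auto
  qed
qed auto

definition int_sums :: "(int \<Rightarrow> 'a :: real_normed_vector) \<Rightarrow> 'a \<Rightarrow> bool" (infixr "int'_sums" 80) where
  "h int_sums S \<longleftrightarrow> (\<lambda>k. h (int k) + h (- int k - 1)) sums S"

lemma has_sum_imp_int_sums:
  fixes h :: "int \<Rightarrow> 'a :: banach"
  assumes "(h has_sum S) UNIV"
  shows "h int_sums S"
proof -
  have "(\<lambda>k. h (int k) + h (- int k - 1)) sums infsum h (range int \<union> range (\<lambda>k. - int k - 1))"
    using assms by (intro sums_infsum_Un_ranges)
      (auto simp: inj_on_def int_UNIV_eq_Un_ranges[symmetric] summable_on_def)
  thus ?thesis using assms by (simp add: int_sums_def int_UNIV_eq_Un_ranges[symmetric] infsumI)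
qed

lemma int_sums_unique2: "h int_sums S \<Longrightarrow> h int_sums T \<Longrightarrow> S = T"
  unfolding int_sums_def by (rule sums_unique2)

lemma int_sums_add: "h int_sums S \<Longrightarrow> h' int_sums S' \<Longrightarrow> (\<lambda>n. h n + h' n) int_sums (S + S')"
  unfolding int_sums_def using sums_add[of _ S _ S'] by (force simp: algebra_simps)

lemma int_sums_diff: "h int_sums S \<Longrightarrow> h' int_sums S' \<Longrightarrow> (\<lambda>n. h n - h' n) int_sums (S - S')"
  unfolding int_sums_def using sums_diff[of _ S _ S'] by (force simp: algebra_simps)

lemma int_sums_mult:
  fixes c :: "'a :: real_normed_algebra"
  shows "h int_sums S \<Longrightarrow> (\<lambda>n. c * h n) int_sums (c * S)"
  unfolding int_sums_def by (simp add: sums_mult flip: distrib_left)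

lemma int_sums_Re: "h int_sums S \<Longrightarrow> (\<lambda>n. Re (h n)) int_sums Re S"
  and int_sums_Im: "h int_sums S \<Longrightarrow> (\<lambda>n. Im (h n)) int_sums Im S"
  unfolding int_sums_def using sums_Re sums_Im by force+

lemma int_sums_telescope:
  fixes h :: "int \<Rightarrow> 'a :: real_normed_vector"
  assumes "(\<lambda>N. h (- int N) - h (int N)) \<longlonglongrightarrow> L"
  shows "(\<lambda>n. h n - h (n + 1)) int_sums L"
proof -
  have "h (- int (Suc k)) - h (int (Suc k)) - (h (- int k) - h (int k)) =
      h (int k) - h (int k + 1) + (h (- int k - 1) - h (- int k - 1 + 1))" for k
    using arg_cong[of "- int (Suc k)" "- int k - 1" h] by (simp add: algebra_simps)
  thus ?thesis using telescope_sums[OF assms] by (simp only: int_sums_def) simp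
qed

definition power_gf :: "nat \<Rightarrow> 'a :: {real_normed_field, banach} \<Rightarrow> 'a" where
  "power_gf m z = (\<Sum>n. of_nat n ^ m * z ^ n)"

lemma summable_power_gf:
  fixes z :: "'a :: {real_normed_field, banach}"
  assumes "norm z < 1"
  shows "summable (\<lambda>n. of_nat n ^ m * z ^ n)"
  using assms
proof (induction m arbitrary: z)
  case 0
  thus ?case by (simp add: summable_geometric)
next
  case (Suc m)
  have "summable (\<lambda>n. diffs (\<lambda>n. of_nat n ^ m) n * z ^ n)"
    by (rule termdiff_converges[OF Suc.prems Suc.IH])
  from summable_mult[OF this, of z]
  have "summable (\<lambda>n. of_nat (Suc n) ^ Suc m * z ^ Suc n)"
    by (simp add: diffs_def mult_ac)
  thus ?case by (subst (asm) summable_Suc_iff)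
qed

lemma sums_power_gf:
  fixes z :: "'a :: {real_normed_field, banach}"
  assumes "norm z < 1" "m > 0"
  shows "(\<lambda>n. of_nat (Suc n) ^ m * z ^ Suc n) sums power_gf m z"
  using summable_sums[OF summable_power_gf[OF assms(1)], of m] assms(2)
  unfolding power_gf_def by (subst sums_Suc_iff) (simp add: zero_power)

lemma power_gf_has_field_derivative:
  fixes z :: "'a :: {real_normed_field, banach}"
  assumes "norm z < 1" "z \<noteq> 0"
  shows "(power_gf m has_field_derivative power_gf (Suc m) z / z) (at z)"
proof -
  have "(\<lambda>n. z * (diffs (\<lambda>n. of_nat n ^ m) n * z ^ n)) sums power_gf (Suc m) z"
    using sums_power_gf[OF assms(1), of "Suc m"] by (simp add: diffs_def mult_ac)
  hence "(\<lambda>n. diffs (\<lambda>n. of_nat n ^ m) n * z ^ n) sums (power_gf (Suc m) z / z)"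
    using assms(2) sums_divide[of _ "power_gf (Suc m) z" z] by fastforce
  moreover have "(power_gf m has_field_derivative (\<Sum>n. diffs (\<lambda>n. of_nat n ^ m) n * z ^ n)) (at z)"
    unfolding power_gf_def[abs_def]
    by (rule termdiffs_strong'[OF summable_power_gf assms(1)])
  ultimately show ?thesis by (simp add: sums_iff)
qed

lemma norm_exp_2pi_i_less_1: "Im w > 0 \<Longrightarrow> norm (exp (2 * of_real pi * \<i> * w)) < 1"
  by simp

lemma Digamma_reflection_upper:
  fixes w :: complex
  assumes "Im w > 0"
  shows "Digamma (1 - w) - Digamma w = of_real pi * cot (of_real pi * w)"
proof -
  have nonpole: "w \<notin> \<int>\<^sub>\<le>\<^sub>0" "1 - w \<notin> \<int>\<^sub>\<le>\<^sub>0"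
    using assms by (auto elim!: nonpos_Ints_cases simp: complex_eq_iff)
  have "((\<lambda>z. rGamma z * rGamma (1 - z)) has_field_derivative
      rGamma w * rGamma (1 - w) * (Digamma (1 - w) - Digamma w)) (at w)"
    using nonpole by (auto intro!: derivative_eq_intros simp: algebra_simps)
  moreover have "((\<lambda>z. rGamma z * rGamma (1 - z)) has_field_derivative cos (of_real pi * w)) (at w)"
    unfolding rGamma_reflection_complex by (auto intro!: derivative_eq_intros)
  ultimately have "rGamma w * rGamma (1 - w) * (Digamma (1 - w) - Digamma w) = cos (of_real pi * w)"
    by (rule DERIV_unique)
  moreover have "sin (of_real pi * w) \<noteq> 0"
    using nonpole rGamma_reflection_complex[of w] by (auto simp: rGamma_eq_zero_iff)
  ultimately show ?thesis
    by (simp add: rGamma_reflection_complex cot_def field_simps)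
qed

lemma pi_cot_eq_power_gf:
  assumes "Im w > 0"
  shows "of_real pi * cot (of_real pi * w) =
    of_real pi * \<i> - 2 * of_real pi * \<i> * power_gf 0 (exp (2 * of_real pi * \<i> * w))"
proof -
  define r q where "r = exp (of_real pi * \<i> * w)" and "q = exp (2 * of_real pi * \<i> * w)"
  have r_square: "r \<noteq> 0" "q = r\<^sup>2"
    by (simp_all add: r_def q_def power2_eq_square mult_ac flip: exp_add)
  have "norm q < 1" unfolding q_def by (rule norm_exp_2pi_i_less_1[OF assms])
  hence power_gf_0: "power_gf 0 q = 1 / (1 - q)" and q_neq_1: "q \<noteq> 1"
    by (auto simp: power_gf_def suminf_geometric)
  have "cos (of_real pi * w) = (r + 1 / r) / 2" "sin (of_real pi * w) = (r - 1 / r) / (2 * \<i>)"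
    by (simp_all add: cos_exp_eq sin_exp_eq' r_def exp_minus divide_simps) (simp_all add: algebra_simps)
  moreover have "x / 2 / (y / (2 * \<i>)) = \<i> * (x / y)" for x y :: complex
    by (cases "y = 0") (simp_all add: field_simps)
  ultimately have "cot (of_real pi * w) = \<i> * ((r + 1 / r) / (r - 1 / r))"
    by (simp only: cot_def)
  also have "(r + 1 / r) / (r - 1 / r) = (q + 1) / (q - 1)"
    using r_square q_neq_1 by (simp add: divide_simps power2_eq_square)
  also have "\<dots> = 1 - 2 / (1 - q)"
    using q_neq_1 by (simp add: field_simps)
  finally have "cot (of_real pi * w) = \<i> * (1 - 2 / (1 - q))" .
  thus ?thesis unfolding q_def[symmetric] power_gf_0 by (simp only:) (simp add: algebra_simps)
qed

lemma Polygamma_reflection_upper: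
  fixes w :: complex
  assumes "Im w > 0"
  shows "(-1) ^ m * Polygamma m (1 - w) - Polygamma m w =
    (if m = 0 then of_real pi * \<i> else 0) -
    (2 * of_real pi * \<i>) ^ Suc m * power_gf m (exp (2 * of_real pi * \<i> * w))"
  using assms
proof (induction m arbitrary: w)
  case 0
  thus ?case by (simp add: Digamma_reflection_upper pi_cot_eq_power_gf)
next
  case (Suc m)
  let ?c = "2 * of_real pi * \<i> :: complex"
  have nonpole: "w \<notin> \<int>\<^sub>\<le>\<^sub>0" "1 - w \<notin> \<int>\<^sub>\<le>\<^sub>0"
    using Suc.prems by (auto elim!: nonpos_Ints_cases simp: complex_eq_iff)
  have "((\<lambda>w. (-1) ^ m * Polygamma m (1 - w) - Polygamma m w) has_field_derivative
      (-1) ^ Suc m * Polygamma (Suc m) (1 - w) - Polygamma (Suc m) w) (at w)"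
    using nonpole by (auto intro!: derivative_eq_intros)
  moreover have "((\<lambda>w. (if m = 0 then of_real pi * \<i> else 0) - ?c ^ Suc m * power_gf m (exp (?c * w)))
      has_field_derivative 0 - ?c ^ Suc m * (?c * power_gf (Suc m) (exp (?c * w)))) (at w)"
  proof (intro DERIV_diff DERIV_cmult DERIV_const)
    have "((\<lambda>w. exp (?c * w)) has_field_derivative ?c * exp (?c * w)) (at w)"
      by (auto intro!: derivative_eq_intros)
    from DERIV_chain2[OF power_gf_has_field_derivative[OF norm_exp_2pi_i_less_1[OF Suc.prems]] this]
    show "((\<lambda>w. power_gf m (exp (?c * w))) has_field_derivative
        ?c * power_gf (Suc m) (exp (?c * w))) (at w)"
      by (simp add: mult_ac)
  qed
  hence "((\<lambda>w. (-1) ^ m * Polygamma m (1 - w) - Polygamma m w) has_field_derivative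
      0 - ?c ^ Suc m * (?c * power_gf (Suc m) (exp (?c * w)))) (at w)"
    by (rule has_field_derivative_transform_within_open[OF _ open_halfspace_Im_gt[of 0]])
      (use Suc in auto)
  ultimately have "(-1) ^ Suc m * Polygamma (Suc m) (1 - w) - Polygamma (Suc m) w =
      0 - ?c ^ Suc m * (?c * power_gf (Suc m) (exp (?c * w)))"
    by (rule DERIV_unique)
  thus ?case by simp
qed

theorem lipschitz_formula:
  fixes w :: complex
  assumes "Im w > 0" "m > 0"
  shows "(\<lambda>n. 1 / (w + of_int n) ^ Suc m) int_sums
    ((- 2 * of_real pi * \<i>) ^ Suc m / fact m * power_gf m (exp (2 * of_real pi * \<i> * w)))"
proof -
  let ?c = "2 * of_real pi * \<i> :: complex"
  have "w \<noteq> 0" "1 - w \<noteq> 0" using assms by auto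
  hence "(\<lambda>k. inverse ((w + of_nat k) ^ Suc m) +
      (-1) ^ Suc m * inverse ((1 - w + of_nat k) ^ Suc m)) sums
      ((-1) ^ Suc m * Polygamma m w / fact m + (-1) ^ Suc m *
        ((-1) ^ Suc m * Polygamma m (1 - w) / fact m))"
    using assms(2) by (intro sums_add sums_mult Polygamma_LIMSEQ) auto
  also have "(-1) ^ Suc m * Polygamma m w / fact m +
      (-1) ^ Suc m * ((-1) ^ Suc m * Polygamma m (1 - w) / fact m) =
      (-1) ^ m / fact m * ((-1) ^ m * Polygamma m (1 - w) - Polygamma m w)"
    by (simp add: field_simps)
  also have "\<dots> = (- ?c) ^ Suc m / fact m * power_gf m (exp (?c * w))"
    using assms(2) by (simp add: Polygamma_reflection_upper[OF assms(1)] power_minus[of ?c])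
  finally have "(\<lambda>k. inverse ((w + of_nat k) ^ Suc m) +
      (-1) ^ Suc m * inverse ((1 - w + of_nat k) ^ Suc m))
      sums ((- ?c) ^ Suc m / fact m * power_gf m (exp (?c * w)))" .
  moreover have "inverse ((w + of_nat k) ^ Suc m) +
      (-1) ^ Suc m * inverse ((1 - w + of_nat k) ^ Suc m) =
      1 / (w + of_int (int k)) ^ Suc m + 1 / (w + of_int (- int k - 1)) ^ Suc m" for k
  proof -
    have "w + of_int (- int k - 1) = - (1 - w + of_nat k)" by simp
    hence "(w + of_int (- int k - 1)) ^ Suc m = (-1) ^ Suc m * (1 - w + of_nat k) ^ Suc m"
      by (simp only: power_minus[of "1 - w + of_nat k"])
    moreover have "1 / ((-1) ^ Suc m * x) = (-1) ^ Suc m * inverse x" for x :: complex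
      by (cases "even m") (simp_all add: inverse_eq_divide)
    ultimately show ?thesis by (simp only: of_int_of_nat_eq inverse_eq_divide)
  qed
  ultimately show ?thesis by (simp only: int_sums_def mult_minus_left)
qed

section \<open>Bessel functions and Poisson summation\<close>

lemma sums_integral_dominated:
  fixes F :: "nat \<Rightarrow> real \<Rightarrow> real"
  assumes integral: "\<And>k. (F k has_integral y k) S" and h_integrable: "h integrable_on S"
    and bound: "\<And>k s. s \<in> S \<Longrightarrow> \<bar>F k s\<bar> \<le> M k * h s" and M_summable: "summable M" "\<And>k. M k \<ge> 0"
    and h_nonneg: "\<And>s. s \<in> S \<Longrightarrow> h s \<ge> 0"
    and sums: "\<And>s. s \<in> S \<Longrightarrow> (\<lambda>k. F k s) sums G s"
  shows "y sums integral S G"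
proof -
  have partial: "((\<lambda>s. \<Sum>k<n. F k s) has_integral (\<Sum>k<n. y k)) S" for n
    by (intro has_integral_sum integral) auto
  have "(\<lambda>n. integral S (\<lambda>s. \<Sum>k<n. F k s)) \<longlonglongrightarrow> integral S G"
  proof (rule dominated_convergence(2))
    show "(\<lambda>s. \<Sum>k<n. F k s) integrable_on S" for n using partial by blast
    show "(\<lambda>s. suminf M * h s) integrable_on S" using h_integrable by (rule integrable_on_mult_right)
    show "norm (\<Sum>k<n. F k s) \<le> suminf M * h s" if "s \<in> S" for n s
    proof -
      have "norm (\<Sum>k<n. F k s) \<le> (\<Sum>k<n. M k * h s)"
        using bound[OF that] by (intro sum_norm_le) simp
      also have "\<dots> = (\<Sum>k<n. M k) * h s" by (simp add: sum_distrib_right)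
      also have "\<dots> \<le> suminf M * h s"
        by (intro mult_right_mono sum_le_suminf M_summable h_nonneg that) auto
      finally show ?thesis .
    qed
    show "(\<lambda>n. \<Sum>k<n. F k s) \<longlonglongrightarrow> G s" if "s \<in> S" for s
      using sums[OF that] by (simp add: sums_def)
  qed
  thus ?thesis using integral_unique[OF partial] by (simp add: sums_def)
qed

lemma has_integral_to_inf_antiderivative:
  fixes \<phi> \<Phi> :: "real \<Rightarrow> real"
  assumes deriv: "\<And>s. s \<ge> a \<Longrightarrow> (\<Phi> has_real_derivative \<phi> s) (at s)"
    and nonneg: "\<And>s. s \<ge> a \<Longrightarrow> \<phi> s \<ge> 0" and lim: "(\<Phi> \<longlongrightarrow> L) at_top"
  shows "(\<phi> has_integral L - \<Phi> a) {a..}"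
proof -
  have int: "(\<phi> has_integral \<Phi> y - \<Phi> a) {a..y}" if "y \<ge> a" for y
    using fundamental_theorem_of_calculus[of a y \<Phi> \<phi>] that deriv
    by (simp add: has_real_derivative_iff_has_vector_derivative[symmetric]
        has_field_derivative_at_within)
  show ?thesis
  proof (rule has_integral_to_inf)
    show "\<phi> integrable_on {a..y}" for y using int[of y] by (cases "y \<ge> a") auto
    have "eventually (\<lambda>y. integral {a..y} \<phi> = \<Phi> y - \<Phi> a) at_top"
      using eventually_ge_at_top[of a] by eventually_elim (use int in auto)
    thus "((\<lambda>y. integral {a..y} \<phi>) \<longlongrightarrow> L - \<Phi> a) at_top"
      using tendsto_diff[OF lim tendsto_const] by (simp add: filterlim_cong)
  qed (use nonneg in auto)
qed

context
  fixes a \<rho> :: real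
  assumes a_pos: "a > 0" and \<rho>_pos: "\<rho> > 0"
begin

primrec quadratic_power_integral :: "nat \<Rightarrow> real \<Rightarrow> real" where
  "quadratic_power_integral 0 v = arctan (a * v / \<rho>) / (a * \<rho>)"
| "quadratic_power_integral (Suc k) v =
     (v / (\<rho>\<^sup>2 + a\<^sup>2 * v\<^sup>2) ^ Suc k + real (2 * k + 1) * quadratic_power_integral k v) /
     (real (2 * (k + 1)) * \<rho>\<^sup>2)"

lemma quadratic_pos: "\<rho>\<^sup>2 + a\<^sup>2 * v\<^sup>2 > 0"
  using \<rho>_pos by (intro add_pos_nonneg) auto

lemma divide_quadratic_power_deriv:
  "((\<lambda>v. v / (\<rho>\<^sup>2 + a\<^sup>2 * v\<^sup>2) ^ Suc k) has_real_derivative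
     real (2 * (k + 1)) * \<rho>\<^sup>2 / (\<rho>\<^sup>2 + a\<^sup>2 * v\<^sup>2) ^ Suc (Suc k) -
     real (2 * k + 1) / (\<rho>\<^sup>2 + a\<^sup>2 * v\<^sup>2) ^ Suc k) (at v)"
proof -
  define N where "N = (\<lambda>v. \<rho>\<^sup>2 + a\<^sup>2 * v\<^sup>2)"
  have N_pos: "N v > 0" by (simp add: N_def quadratic_pos)
  have N_deriv: "(N has_real_derivative 2 * a\<^sup>2 * v) (at v)"
    unfolding N_def by (auto intro!: derivative_eq_intros)
  have "((\<lambda>v. v / N v ^ Suc k) has_real_derivative
      (N v ^ Suc k - v * (real (Suc k) * N v ^ k * (2 * a\<^sup>2 * v))) / (N v ^ Suc k * N v ^ Suc k))
      (at v)"
    by (rule DERIV_cong[OF DERIV_divide[OF DERIV_ident DERIV_power[OF N_deriv]]])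
      (use N_pos in \<open>simp_all add: mult_ac\<close>)
  moreover have "(N v ^ Suc k - v * (real (Suc k) * N v ^ k * (2 * a\<^sup>2 * v))) /
      (N v ^ Suc k * N v ^ Suc k) =
      real (2 * (k + 1)) * \<rho>\<^sup>2 / N v ^ Suc (Suc k) - real (2 * k + 1) / N v ^ Suc k"
  proof -
    have "N v ^ Suc k - v * (real (Suc k) * N v ^ k * (2 * a\<^sup>2 * v)) =
        N v ^ k * (real (2 * (k + 1)) * \<rho>\<^sup>2 - real (2 * k + 1) * N v)"
      by (simp add: N_def algebra_simps power2_eq_square)
    also have "\<dots> / (N v ^ Suc k * N v ^ Suc k) =
        real (2 * (k + 1)) * \<rho>\<^sup>2 / N v ^ Suc (Suc k) - real (2 * k + 1) / N v ^ Suc k"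
      using N_pos by (simp add: diff_divide_distrib)
    finally show ?thesis .
  qed
  ultimately show ?thesis by (simp add: N_def)
qed

lemma quadratic_power_integral_deriv:
  "(quadratic_power_integral k has_real_derivative 1 / (\<rho>\<^sup>2 + a\<^sup>2 * v\<^sup>2) ^ Suc k) (at v)"
proof (induction k)
  case 0
  have "((\<lambda>v. arctan (a * v / \<rho>) / (a * \<rho>)) has_real_derivative
      inverse (1 + (a * v / \<rho>)\<^sup>2) * (a / \<rho>) / (a * \<rho>)) (at v)"
    using a_pos \<rho>_pos by (auto intro!: derivative_eq_intros)
  moreover have "1 + (a * v / \<rho>)\<^sup>2 = (\<rho>\<^sup>2 + a\<^sup>2 * v\<^sup>2) / \<rho>\<^sup>2"
    using \<rho>_pos by (simp add: field_simps)
  ultimately show ?case using a_pos \<rho>_pos quadratic_pos[of v] by (simp add: power2_eq_square)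
next
  case (Suc k)
  from DERIV_cdivide[OF DERIV_add[OF divide_quadratic_power_deriv[of k v]
        DERIV_cmult[OF Suc.IH, of "real (2 * k + 1)"]], of "real (2 * (k + 1)) * \<rho>\<^sup>2"]
  have "(quadratic_power_integral (Suc k) has_real_derivative
      real (2 * (k + 1)) * \<rho>\<^sup>2 / (\<rho>\<^sup>2 + a\<^sup>2 * v\<^sup>2) ^ Suc (Suc k) /
      (real (2 * (k + 1)) * \<rho>\<^sup>2)) (at v)"
    by (simp only: quadratic_power_integral.simps(2)[abs_def]) simp
  thus ?case using \<rho>_pos by (simp del: quadratic_power_integral.simps)
qed

lemma quadratic_power_integral_at_top:
  "(quadratic_power_integral k \<longlongrightarrow> pi / (2 * a * \<rho> ^ (2 * k + 1)) *
    (pochhammer (1 / 2) k / fact k)) at_top"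
proof (induction k)
  case 0
  have "filterlim (\<lambda>v. a * v / \<rho>) at_top at_top" using a_pos \<rho>_pos by real_asymp
  hence "((\<lambda>v. arctan (a * v / \<rho>)) \<longlongrightarrow> pi / 2) at_top"
    by (rule filterlim_compose[OF tendsto_arctan_at_top])
  from tendsto_divide[OF this tendsto_const[of "a * \<rho>"]] show ?case
    using a_pos \<rho>_pos by (simp add: mult.assoc)
next
  case (Suc k)
  have "((\<lambda>v. v / (\<rho>\<^sup>2 + a\<^sup>2 * v\<^sup>2)) \<longlongrightarrow> 0) at_top" "((\<lambda>v. 1 / (\<rho>\<^sup>2 + a\<^sup>2 * v\<^sup>2)) \<longlongrightarrow> 0) at_top"
    using a_pos \<rho>_pos by real_asymp+
  hence "((\<lambda>v. v / (\<rho>\<^sup>2 + a\<^sup>2 * v\<^sup>2) ^ Suc k) \<longlongrightarrow> 0 * 0 ^ k) at_top"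
    using tendsto_mult[OF _ tendsto_power] by (fastforce simp: power_divide)
  hence "(quadratic_power_integral (Suc k) \<longlongrightarrow>
      (0 * 0 ^ k + real (2 * k + 1) *
        (pi / (2 * a * \<rho> ^ (2 * k + 1)) * (pochhammer (1 / 2) k / fact k))) /
        (real (2 * (k + 1)) * \<rho>\<^sup>2)) at_top"
    unfolding quadratic_power_integral.simps(2)[abs_def]
    using \<rho>_pos by (intro tendsto_divide tendsto_add tendsto_mult tendsto_const Suc.IH) auto
  also have "0 * 0 ^ k + real (2 * k + 1) *
      (pi / (2 * a * \<rho> ^ (2 * k + 1)) * (pochhammer (1 / 2) k / fact k)) =
      2 * (pi / (2 * a * \<rho> ^ (2 * k + 1)) * (pochhammer (1 / 2) (Suc k) / fact k))"
    by (simp add: pochhammer_Suc algebra_simps add_divide_distrib)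
  also have "\<dots> / (real (2 * (k + 1)) * \<rho>\<^sup>2) =
      pi / (2 * a * \<rho> ^ (2 * Suc k + 1)) * (pochhammer (1 / 2) (Suc k) / fact (Suc k))"
    using a_pos \<rho>_pos by (simp add: field_simps power2_eq_square)
  finally show ?case .
qed

lemma has_integral_cosh_over_power:
  "((\<lambda>s. cosh s / (\<rho>\<^sup>2 + a\<^sup>2 * (sinh s)\<^sup>2) ^ Suc k) has_integral
     pi / (2 * a * \<rho> ^ (2 * k + 1)) * (pochhammer (1 / 2) k / fact k)) {0..}"
proof -
  have "((\<lambda>s. quadratic_power_integral k (sinh s)) has_real_derivative
      cosh s / (\<rho>\<^sup>2 + a\<^sup>2 * (sinh s)\<^sup>2) ^ Suc k) (at s)" for s
  proof -
    have "(sinh has_real_derivative cosh s) (at s)" by (auto intro!: derivative_eq_intros)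
    from DERIV_chain2[OF quadratic_power_integral_deriv this] show ?thesis by simp
  qed
  moreover have "filterlim (sinh :: real \<Rightarrow> real) at_top at_top" by real_asymp
  moreover have "quadratic_power_integral k 0 = 0" by (induction k) simp_all
  ultimately show ?thesis
    using has_integral_to_inf_antiderivative[of 0 "\<lambda>s. quadratic_power_integral k (sinh s)",
        OF _ _ filterlim_compose[OF quadratic_power_integral_at_top]]
    by (simp add: quadratic_pos less_imp_le)
qed

end

lemma inverse_power_Complex:
  assumes "u \<noteq> 0"
  shows "1 / Complex y u ^ m = cnj (Complex y u) ^ m / of_real ((y\<^sup>2 + u\<^sup>2) ^ m)"
proof -
  have "Complex y u * cnj (Complex y u) = of_real (y\<^sup>2 + u\<^sup>2)"
    by (simp add: complex_eq_iff power2_eq_square)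
  hence "Complex y u ^ m * cnj (Complex y u) ^ m = of_real ((y\<^sup>2 + u\<^sup>2) ^ m)"
    by (simp flip: power_mult_distrib)
  moreover have "Complex y u \<noteq> 0" "y\<^sup>2 + u\<^sup>2 \<noteq> 0"
    using assms by (auto simp: complex_eq_iff add_nonneg_eq_0_iff)
  ultimately show ?thesis by (simp add: divide_eq_eq eq_divide_eq mult_ac del: of_real_power)
qed

lemma Re_Im_inverse_power_Complex:
  fixes y u :: real
  assumes "u \<noteq> 0"
  defines "N \<equiv> y\<^sup>2 + u\<^sup>2"
  shows "Re (1 / Complex y u) = y / N"
    and "Re (1 / Complex y u ^ 2) = 2 * y\<^sup>2 / N ^ 2 - 1 / N"
    and "Re (1 / Complex y u ^ 3) = 4 * y ^ 3 / N ^ 3 - 3 * y / N ^ 2"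
    and "Im (1 / Complex y u ^ 3) = u / N ^ 2 - 4 * y\<^sup>2 * u / N ^ 3"
proof -
  have N_nonzero: "N \<noteq> 0" using assms(1) by (auto simp: N_def add_nonneg_eq_0_iff)
  note inv = inverse_power_Complex[OF assms(1), folded N_def] Re_divide_of_real Im_divide_of_real
  have "Re (1 / Complex y u ^ 1) = y / N ^ 1"
    unfolding inv by (simp add: N_def)
  thus "Re (1 / Complex y u) = y / N" by simp
  have "Re (1 / Complex y u ^ 2) = (2 * y\<^sup>2 - N) / N ^ 2"
    unfolding inv by (simp add: N_def power2_eq_square)
  thus "Re (1 / Complex y u ^ 2) = 2 * y\<^sup>2 / N ^ 2 - 1 / N"
    using N_nonzero by (simp add: diff_divide_distrib power2_eq_square)
  have "Re (1 / Complex y u ^ 3) = (4 * y ^ 3 - 3 * y * N) / N ^ 3"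
    unfolding inv by (simp add: N_def power2_eq_square power3_eq_cube algebra_simps)
  thus "Re (1 / Complex y u ^ 3) = 4 * y ^ 3 / N ^ 3 - 3 * y / N ^ 2"
    using N_nonzero by (simp add: diff_divide_distrib power2_eq_square power3_eq_cube)
  have "Im (1 / Complex y u ^ 3) = (u * N - 4 * y\<^sup>2 * u) / N ^ 3"
    unfolding inv by (simp add: N_def power2_eq_square power3_eq_cube algebra_simps)
  thus "Im (1 / Complex y u ^ 3) = u / N ^ 2 - 4 * y\<^sup>2 * u / N ^ 3"
    using N_nonzero by (simp add: diff_divide_distrib power2_eq_square power3_eq_cube)
qed

context
  fixes a y :: real
  assumes a_pos: "a > 0"
begin

lemma kernel_nonzero: "Complex y a \<noteq> 0" and kernel_norm_pos: "cmod (Complex y a) > 0"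
  using a_pos by (auto simp: complex_eq_iff)

lemma kernel_norm_square: "(cmod (Complex y a))\<^sup>2 = y\<^sup>2 + a\<^sup>2"
  by (simp add: cmod_power2)

lemma kernel_quadratic:
  "y\<^sup>2 + (a * cosh s)\<^sup>2 = (cmod (Complex y a))\<^sup>2 + a\<^sup>2 * (sinh s)\<^sup>2"
  by (simp add: kernel_norm_square cosh_square_eq power_mult_distrib algebra_simps)

lemmas Re_Im_inverse_power_kernel =
  Re_Im_inverse_power_Complex[of "a * cosh s" y for s, unfolded kernel_quadratic]

lemma has_integral_kernel_powers:
  defines "N \<equiv> \<lambda>s. (cmod (Complex y a))\<^sup>2 + a\<^sup>2 * (sinh s)\<^sup>2"
  shows "((\<lambda>s. cosh s / N s) has_integral pi / (2 * a * cmod (Complex y a))) {0..}"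
    and "((\<lambda>s. cosh s / N s ^ 2) has_integral pi / (4 * a * cmod (Complex y a) ^ 3)) {0..}"
    and "((\<lambda>s. cosh s / N s ^ 3) has_integral 3 * pi / (16 * a * cmod (Complex y a) ^ 5)) {0..}"
  using has_integral_cosh_over_power[OF a_pos kernel_norm_pos, of 0]
    has_integral_cosh_over_power[OF a_pos kernel_norm_pos, of 1]
    has_integral_cosh_over_power[OF a_pos kernel_norm_pos, of 2]
  by (simp_all add: N_def pochhammer_Suc eval_nat_numeral mult_ac)

lemma cosh_Re_kernel_has_integral:
  "((\<lambda>s. cosh s * Re (1 / Complex y (a * cosh s))) has_integral
     pi * y / (2 * a * cmod (Complex y a))) {0..}"
  using has_integral_mult_right[OF has_integral_kernel_powers(1), of y] a_pos
  by (simp add: Re_Im_inverse_power_kernel mult_ac)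

lemma cosh_Re_kernel_square_has_integral:
  "((\<lambda>s. cosh s * Re (1 / Complex y (a * cosh s) ^ 2)) has_integral
     - (pi * a / 2) / cmod (Complex y a) ^ 3) {0..}"
proof -
  define \<rho> where "\<rho> = cmod (Complex y a)"
  have \<rho>_pos: "\<rho> > 0" "\<rho>\<^sup>2 = y\<^sup>2 + a\<^sup>2" by (simp_all add: \<rho>_def kernel_nonzero kernel_norm_square)
  have "((\<lambda>s. cosh s * Re (1 / Complex y (a * cosh s) ^ 2)) has_integral
      2 * y\<^sup>2 * (pi / (4 * a * \<rho> ^ 3)) - pi / (2 * a * \<rho>)) {0..}"
    using has_integral_diff[OF has_integral_mult_right[OF has_integral_kernel_powers(2), of "2 * y\<^sup>2"]
        has_integral_kernel_powers(1)] a_pos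
    by (simp add: Re_Im_inverse_power_kernel \<rho>_def algebra_simps)
  also have "2 * y\<^sup>2 * (pi / (4 * a * \<rho> ^ 3)) - pi / (2 * a * \<rho>) = pi / (2 * a * \<rho> ^ 3) * (y\<^sup>2 - \<rho>\<^sup>2)"
    using a_pos \<rho>_pos(1)
    by (simp add: divide_simps) (simp add: algebra_simps power2_eq_square power3_eq_cube)
  also have "\<dots> = - (pi * a / 2) / \<rho> ^ 3"
    unfolding \<rho>_pos(2) using a_pos by (simp add: power2_eq_square)
  finally show ?thesis by (simp add: \<rho>_def)
qed

lemma cosh_Re_kernel_cube_has_integral:
  "((\<lambda>s. cosh s * Re (1 / Complex y (a * cosh s) ^ 3)) has_integral
     - (3 * pi * a / 4) * (y / cmod (Complex y a) ^ 5)) {0..}"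
proof -
  define \<rho> where "\<rho> = cmod (Complex y a)"
  have \<rho>_pos: "\<rho> > 0" "\<rho>\<^sup>2 = y\<^sup>2 + a\<^sup>2" by (simp_all add: \<rho>_def kernel_nonzero kernel_norm_square)
  have "((\<lambda>s. cosh s * Re (1 / Complex y (a * cosh s) ^ 3)) has_integral
      4 * y ^ 3 * (3 * pi / (16 * a * \<rho> ^ 5)) - 3 * y * (pi / (4 * a * \<rho> ^ 3))) {0..}"
    using has_integral_diff[OF has_integral_mult_right[OF has_integral_kernel_powers(3), of "4 * y ^ 3"]
        has_integral_mult_right[OF has_integral_kernel_powers(2), of "3 * y"]] a_pos
    by (simp add: Re_Im_inverse_power_kernel \<rho>_def algebra_simps)
  also have "4 * y ^ 3 * (3 * pi / (16 * a * \<rho> ^ 5)) - 3 * y * (pi / (4 * a * \<rho> ^ 3)) =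
      3 * pi * y / (4 * a * \<rho> ^ 5) * (y\<^sup>2 - \<rho>\<^sup>2)"
    using a_pos \<rho>_pos(1) by (simp add: divide_simps) (simp add: algebra_simps eval_nat_numeral)
  also have "\<dots> = - (3 * pi * a / 4) * (y / \<rho> ^ 5)"
    unfolding \<rho>_pos(2) using a_pos by (simp add: power2_eq_square)
  finally show ?thesis by (simp add: \<rho>_def)
qed

lemma Im_kernel_cube_has_integral:
  "((\<lambda>s. Im (1 / Complex y (a * cosh s) ^ 3)) has_integral
     pi / 4 * ((a\<^sup>2 - 2 * y\<^sup>2) / cmod (Complex y a) ^ 5)) {0..}"
proof -
  define \<rho> where "\<rho> = cmod (Complex y a)"
  have \<rho>_pos: "\<rho> > 0" "\<rho>\<^sup>2 = y\<^sup>2 + a\<^sup>2" by (simp_all add: \<rho>_def kernel_nonzero kernel_norm_square)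
  have "((\<lambda>s. Im (1 / Complex y (a * cosh s) ^ 3)) has_integral
      a * (pi / (4 * a * \<rho> ^ 3)) - 4 * y\<^sup>2 * a * (3 * pi / (16 * a * \<rho> ^ 5))) {0..}"
    using has_integral_diff[OF has_integral_mult_right[OF has_integral_kernel_powers(2), of a]
        has_integral_mult_right[OF has_integral_kernel_powers(3), of "4 * y\<^sup>2 * a"]] a_pos
    by (simp add: Re_Im_inverse_power_kernel \<rho>_def algebra_simps)
  also have "a * (pi / (4 * a * \<rho> ^ 3)) - 4 * y\<^sup>2 * a * (3 * pi / (16 * a * \<rho> ^ 5)) =
      pi / (4 * \<rho> ^ 5) * (\<rho>\<^sup>2 - 3 * y\<^sup>2)"
    using a_pos \<rho>_pos(1) by (simp add: divide_simps) (simp add: algebra_simps eval_nat_numeral)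
  also have "\<dots> = pi / 4 * ((a\<^sup>2 - 2 * y\<^sup>2) / \<rho> ^ 5)" by (simp add: \<rho>_pos(2))
  finally show ?thesis by (simp add: \<rho>_def)
qed

lemma kernel_bound:
  assumes "\<bar>F\<bar> \<le> cosh s / (cmod (Complex y (a * cosh s)) powr (3 / 2) * (a * cosh s) powr (3 / 2))"
  shows "\<bar>F\<bar> \<le> sqrt 2 * a powr (- 3 / 2) * exp (- (1 / 2) * s) * cmod (Complex y a) powr (- 3 / 2)"
proof -
  have cosh: "cosh s > 0" "cosh s \<ge> 1" by (simp_all add: cosh_real_pos cosh_real_ge_1)
  hence "a\<^sup>2 \<le> (a * cosh s)\<^sup>2" using a_pos by (intro power_mono) auto
  hence "cmod (Complex y a) \<le> cmod (Complex y (a * cosh s))"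
    unfolding complex_norm by (intro real_sqrt_le_mono) simp
  hence "cosh s / (cmod (Complex y (a * cosh s)) powr (3 / 2) * (a * cosh s) powr (3 / 2)) \<le>
      cosh s / (cmod (Complex y a) powr (3 / 2) * (a * cosh s) powr (3 / 2))"
    using kernel_norm_pos a_pos cosh
    by (intro divide_left_mono mult_right_mono powr_mono2 mult_pos_pos) auto
  also have "\<dots> = a powr (- 3 / 2) * (cosh s powr 1 * cosh s powr (- 3 / 2)) *
      cmod (Complex y a) powr (- 3 / 2)"
    using a_pos cosh by (simp add: powr_mult powr_minus field_simps)
  also have "cosh s powr 1 * cosh s powr (- 3 / 2) = cosh s powr (- 1 / 2)"
    by (simp only: powr_add[symmetric]) simp
  also have "cosh s powr (- 1 / 2) \<le> (exp s / 2) powr (- 1 / 2)"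
    by (intro powr_mono2') (auto simp: cosh_def)
  also have "(exp s / 2) powr (- 1 / 2) = sqrt 2 * exp (- (1 / 2) * s)"
    by (simp add: powr_divide powr_minus exp_powr_real field_simps exp_minus powr_half_sqrt[symmetric])
  finally show ?thesis using assms by (simp add: mult_ac mult_left_mono mult_right_mono)
qed

end

lemma power_le_fact_mult_exp:
  fixes x :: real
  assumes "x \<ge> 0"
  shows "x ^ n \<le> fact n * exp x"
proof -
  have "(\<Sum>k\<in>{n}. x ^ k / fact k) \<le> (\<Sum>k. x ^ k / fact k)"
    using assms exp_converges[of x]
    by (intro sum_le_suminf) (auto simp: sums_iff scaleR_conv_of_real divide_inverse mult_ac)
  also have "\<dots> = exp x" by (simp add: exp_def scaleR_conv_of_real divide_inverse mult_ac)
  finally show ?thesis by (simp add: field_simps)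
qed

lemma bessel_K_integrand_bound:
  fixes x \<nu> :: real
  assumes "x > 0"
  obtains C where "\<And>s. s \<ge> 0 \<Longrightarrow> exp (- x * cosh s) * cosh (\<nu> * s) \<le> C * exp (- 1 * s)"
proof
  fix s :: real assume s_nonneg: "s \<ge> 0"
  define n where "n = nat \<lceil>\<bar>\<nu>\<bar>\<rceil> + 1"
  have n_ge: "\<bar>\<nu>\<bar> + 1 \<le> real n" unfolding n_def by linarith
  have "(x / 2 * exp s) ^ n \<le> fact n * exp (x / 2 * exp s)"
    using assms by (intro power_le_fact_mult_exp) simp
  also have "\<dots> \<le> fact n * exp (x * cosh s)"
    using assms by (intro mult_left_mono) (auto simp: cosh_def field_simps)
  finally have "exp (- x * cosh s) \<le> fact n * (2 / x) ^ n * exp (- real n * s)"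
    using assms by (simp add: exp_minus power_mult_distrib power_divide exp_of_nat_mult
        exp_of_nat2_mult divide_simps mult_ac)
  moreover have "cosh (\<nu> * s) \<le> exp (\<bar>\<nu>\<bar> * s)"
  proof -
    have "cosh (\<nu> * s) = cosh (\<bar>\<nu>\<bar> * s)" by (simp add: abs_if)
    also have "\<dots> \<le> exp (\<bar>\<nu>\<bar> * s)" using s_nonneg by (simp add: cosh_def field_simps)
    finally show ?thesis .
  qed
  ultimately have "exp (- x * cosh s) * cosh (\<nu> * s) \<le>
      fact n * (2 / x) ^ n * exp (- real n * s) * exp (\<bar>\<nu>\<bar> * s)"
    using assms by (intro mult_mono) auto
  also have "\<dots> = fact n * (2 / x) ^ n * exp ((\<bar>\<nu>\<bar> - real n) * s)"
    by (simp add: left_diff_distrib mult.assoc flip: exp_add)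
  also have "\<dots> \<le> fact n * (2 / x) ^ n * exp (- 1 * s)"
    using n_ge s_nonneg assms mult_right_mono[of "\<bar>\<nu>\<bar> - real n" "- 1" s] by (intro mult_left_mono) auto
  finally show "exp (- x * cosh s) * cosh (\<nu> * s) \<le>
      fact (nat \<lceil>\<bar>\<nu>\<bar>\<rceil> + 1) * (2 / x) ^ (nat \<lceil>\<bar>\<nu>\<bar>\<rceil> + 1) * exp (- 1 * s)"
    unfolding n_def .
qed

lemma bessel_K_has_integral:
  assumes "x > 0"
  shows "((\<lambda>s. exp (- x * cosh s) * cosh (\<nu> * s)) has_integral bessel_K \<nu> x) {0..}"
proof -
  obtain C where C_bound: "\<And>s. s \<ge> 0 \<Longrightarrow> exp (- x * cosh s) * cosh (\<nu> * s) \<le> C * exp (- 1 * s)"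
    using bessel_K_integrand_bound[OF assms] by blast
  have "(\<lambda>s. exp (- x * cosh s) * cosh (\<nu> * s)) integrable_on {0..}"
  proof (rule measurable_bounded_by_integrable_imp_integrable)
    show "(\<lambda>s. exp (- x * cosh s) * cosh (\<nu> * s)) \<in> borel_measurable (lebesgue_on {0..})"
      by (intro continuous_imp_measurable_on_sets_lebesgue continuous_intros) auto
    show "(\<lambda>s. C * exp (- 1 * s)) integrable_on {0..}"
      by (intro integrable_on_mult_right integrable_on_exp_minus_to_infinity) simp
  qed (use C_bound in auto)
  thus ?thesis unfolding bessel_K_def by (rule integrable_integral)
qed

lemma bessel_K_nonneg: "x > 0 \<Longrightarrow> bessel_K \<nu> x \<ge> 0"
  by (rule has_integral_nonneg[OF bessel_K_has_integral]) auto

lemma bessel_K_decay: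
  assumes "0 < x" "x \<le> y"
  shows "bessel_K \<nu> y \<le> exp x * bessel_K \<nu> x * exp (- y)"
proof -
  have "bessel_K \<nu> y \<le> exp (x - y) * bessel_K \<nu> x"
  proof (rule has_integral_le[OF bessel_K_has_integral
      has_integral_mult_right[OF bessel_K_has_integral]])
    fix s :: real
    have "0 \<le> (y - x) * (cosh s - 1)"
      using assms by (intro mult_nonneg_nonneg) (auto simp: cosh_real_ge_1)
    hence "exp (- y * cosh s) \<le> exp (x - y) * exp (- x * cosh s)"
      unfolding exp_add[symmetric] exp_le_cancel_iff by (simp add: algebra_simps)
    from mult_right_mono[OF this, of "cosh (\<nu> * s)"]
    show "exp (- y * cosh s) * cosh (\<nu> * s) \<le> exp (x - y) * (exp (- x * cosh s) * cosh (\<nu> * s))"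
      by (simp add: mult.assoc)
  qed (use assms in auto)
  thus ?thesis by (simp add: exp_diff exp_minus field_simps)
qed

lemma summable_power_mult_exp:
  fixes b :: real
  assumes "b > 0"
  shows "summable (\<lambda>n. real (Suc n) ^ p * exp (- b * real (Suc n)))"
proof -
  have "summable (\<lambda>n. real n ^ p * exp (- b) ^ n)"
    using assms by (intro summable_power_gf) simp
  hence "summable (\<lambda>n. real n ^ p * exp (- b * real n))"
    by (simp add: exp_of_nat_mult[symmetric] mult.commute)
  thus ?thesis by (subst summable_Suc_iff)
qed

lemma bessel_series_sums:
  fixes c :: "nat \<Rightarrow> real"
  assumes a_pos: "a > 0" and c_bound: "\<And>q. \<bar>c q\<bar> \<le> real (Suc q) ^ p"
    and G_integral: "\<And>s. s \<ge> 0 \<Longrightarrow>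
      (\<lambda>q. c q * (exp (- (2 * pi * real (Suc q) * a) * cosh s) * cosh (\<nu> * s))) sums G s"
  shows "(\<lambda>q. c q * bessel_K \<nu> (2 * pi * real (Suc q) * a)) sums integral {0..} G"
proof (rule sums_integral_dominated)
  let ?M = "\<lambda>q. real (Suc q) ^ p * exp (- (pi * a) * real (Suc q))"
  show "((\<lambda>s. c q * (exp (- (2 * pi * real (Suc q) * a) * cosh s) * cosh (\<nu> * s))) has_integral
      c q * bessel_K \<nu> (2 * pi * real (Suc q) * a)) {0..}" for q
    using a_pos by (intro has_integral_mult_right bessel_K_has_integral) auto
  show "(\<lambda>s. exp (- (pi * a) * cosh s) * cosh (\<nu> * s)) integrable_on {0..}"
    using a_pos by (intro has_integral_integrable[OF bessel_K_has_integral]) auto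
  show "summable ?M" using a_pos by (intro summable_power_mult_exp) auto
  show "\<bar>c q * (exp (- (2 * pi * real (Suc q) * a) * cosh s) * cosh (\<nu> * s))\<bar> \<le>
      ?M q * (exp (- (pi * a) * cosh s) * cosh (\<nu> * s))" for q s
  proof -
    have "0 \<le> (real (Suc q) - 1) * cosh s + real (Suc q) * (cosh s - 1)"
      by (intro add_nonneg_nonneg mult_nonneg_nonneg) (auto simp: cosh_real_ge_1)
    hence "(pi * a) * (real (Suc q) + cosh s) \<le> (pi * a) * (2 * real (Suc q) * cosh s)"
      using a_pos by (intro mult_left_mono) (auto simp: algebra_simps)
    hence "exp (- (2 * pi * real (Suc q) * a) * cosh s) \<le>
        exp (- (pi * a) * real (Suc q)) * exp (- (pi * a) * cosh s)"
      unfolding exp_add[symmetric] exp_le_cancel_iff by (simp add: algebra_simps)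
    hence "\<bar>c q\<bar> * (exp (- (2 * pi * real (Suc q) * a) * cosh s) * cosh (\<nu> * s)) \<le>
        real (Suc q) ^ p * (exp (- (pi * a) * real (Suc q)) * exp (- (pi * a) * cosh s) * cosh (\<nu> * s))"
      by (intro mult_mono c_bound mult_right_mono) auto
    thus ?thesis by (simp add: abs_mult mult_ac)
  qed
qed (use G_integral in auto)

definition bessel_cos_series :: "nat \<Rightarrow> real \<Rightarrow> real \<Rightarrow> real \<Rightarrow> real" where
  "bessel_cos_series p \<nu> x a =
     (\<Sum>n. real (Suc n) ^ p * cos (2 * pi * real (Suc n) * x) * bessel_K \<nu> (2 * pi * real (Suc n) * a))"

definition bessel_sin_series :: "nat \<Rightarrow> real \<Rightarrow> real \<Rightarrow> real \<Rightarrow> real" where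
  "bessel_sin_series p \<nu> x a =
     (\<Sum>n. real (Suc n) ^ p * sin (2 * pi * real (Suc n) * x) * bessel_K \<nu> (2 * pi * real (Suc n) * a))"

lemma Re_Im_exp_2pi_i_power:
  fixes x u :: real
  shows "Re (of_nat n ^ p * exp (2 * of_real pi * \<i> * Complex x u) ^ n) =
      real n ^ p * cos (2 * pi * real n * x) * exp (- (2 * pi * real n) * u)"
    and "Im (of_nat n ^ p * exp (2 * of_real pi * \<i> * Complex x u) ^ n) =
      real n ^ p * sin (2 * pi * real n * x) * exp (- (2 * pi * real n) * u)"
proof -
  have "of_nat n ^ p * w = of_real (real n ^ p) * w" for w :: complex by simp
  thus "Re (of_nat n ^ p * exp (2 * of_real pi * \<i> * Complex x u) ^ n) =
      real n ^ p * cos (2 * pi * real n * x) * exp (- (2 * pi * real n) * u)"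
    "Im (of_nat n ^ p * exp (2 * of_real pi * \<i> * Complex x u) ^ n) =
      real n ^ p * sin (2 * pi * real n * x) * exp (- (2 * pi * real n) * u)"
    by (simp_all only:) (simp_all add: exp_of_nat_mult[symmetric] Re_exp Im_exp mult_ac)
qed

lemma Fourier_sums_power_gf:
  assumes "u > 0" "p > 0"
  shows "(\<lambda>n. real (Suc n) ^ p * cos (2 * pi * real (Suc n) * x) * exp (- (2 * pi * real (Suc n)) * u))
      sums Re (power_gf p (exp (2 * of_real pi * \<i> * Complex x u)))"
    and "(\<lambda>n. real (Suc n) ^ p * sin (2 * pi * real (Suc n) * x) * exp (- (2 * pi * real (Suc n)) * u))
      sums Im (power_gf p (exp (2 * of_real pi * \<i> * Complex x u)))"
proof -
  have "(\<lambda>n. of_nat (Suc n) ^ p * exp (2 * of_real pi * \<i> * Complex x u) ^ Suc n) sums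
      power_gf p (exp (2 * of_real pi * \<i> * Complex x u))"
    using assms by (intro sums_power_gf norm_exp_2pi_i_less_1) simp_all
  from sums_Re[OF this] sums_Im[OF this] show
    "(\<lambda>n. real (Suc n) ^ p * cos (2 * pi * real (Suc n) * x) * exp (- (2 * pi * real (Suc n)) * u))
      sums Re (power_gf p (exp (2 * of_real pi * \<i> * Complex x u)))"
    "(\<lambda>n. real (Suc n) ^ p * sin (2 * pi * real (Suc n) * x) * exp (- (2 * pi * real (Suc n)) * u))
      sums Im (power_gf p (exp (2 * of_real pi * \<i> * Complex x u)))"
    by (simp_all only: Re_Im_exp_2pi_i_power)
qed

lemma lattice_norm_bound:
  fixes \<tau> :: complex and m n :: int
  assumes \<epsilon>_le_Im: "\<epsilon> > 0" "Im \<tau> \<ge> \<epsilon>" and norm_le_R: "cmod \<tau> \<le> R" and nonzero: "(m, n) \<noteq> (0, 0)"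
  shows "1 + \<bar>real_of_int m\<bar> + \<bar>real_of_int n\<bar> \<le> 2 * (1 + (1 + R) / \<epsilon>) * cmod (of_int m * \<tau> + of_int n)"
proof -
  define w where "w = of_int m * \<tau> + of_int n"
  have "\<bar>real_of_int m\<bar> * \<epsilon> \<le> \<bar>real_of_int m\<bar> * Im \<tau>" using \<epsilon>_le_Im by (intro mult_left_mono) auto
  also have "\<dots> = \<bar>Im w\<bar>" using \<epsilon>_le_Im by (simp add: w_def abs_mult)
  also have "\<dots> \<le> cmod w" by (rule abs_Im_le_cmod)
  finally have m_bound: "\<bar>real_of_int m\<bar> \<le> cmod w / \<epsilon>" using \<epsilon>_le_Im by (simp add: field_simps)
  have "\<bar>real_of_int n\<bar> = cmod (w - of_int m * \<tau>)" by (simp add: w_def)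
  also have "\<dots> \<le> cmod w + \<bar>real_of_int m\<bar> * cmod \<tau>"
    by (metis norm_triangle_ineq4 norm_mult norm_of_int)
  also have "\<dots> \<le> cmod w + cmod w / \<epsilon> * R" using m_bound norm_le_R \<epsilon>_le_Im
    by (intro add_mono mult_mono) auto
  finally have n_bound: "\<bar>real_of_int n\<bar> \<le> cmod w + cmod w / \<epsilon> * R" .
  have "1 \<le> \<bar>m\<bar> + \<bar>n\<bar>" using nonzero by auto
  hence "1 \<le> \<bar>real_of_int m\<bar> + \<bar>real_of_int n\<bar>" by linarith
  hence "1 + \<bar>real_of_int m\<bar> + \<bar>real_of_int n\<bar> \<le> 2 * (\<bar>real_of_int m\<bar> + \<bar>real_of_int n\<bar>)" by simp
  also have "\<dots> \<le> 2 * (cmod w / \<epsilon> + (cmod w + cmod w / \<epsilon> * R))"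
    by (intro mult_left_mono add_mono m_bound n_bound) auto
  also have "\<dots> = 2 * (1 + (1 + R) / \<epsilon>) * cmod w" using \<epsilon>_le_Im by (simp add: field_simps)
  finally show ?thesis by (simp add: w_def)
qed

lemma summable_on_int_powr:
  assumes "p < - 1"
  shows "(\<lambda>n::int. (1 + \<bar>real_of_int n\<bar>) powr p) summable_on UNIV"
proof -
  have "summable (\<lambda>k. real (Suc k) powr p)"
    using assms by (subst summable_Suc_iff) (simp add: summable_real_powr_iff)
  hence "(\<lambda>k. real (Suc k) powr p) summable_on UNIV"
    and "(\<lambda>k. real (Suc (Suc k)) powr p) summable_on UNIV"
    using summable_Suc_iff[of "\<lambda>k. real (Suc k) powr p"]
    by (auto intro!: summable_nonneg_imp_summable_on)
  thus ?thesis unfolding int_UNIV_eq_Un_ranges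
    by (intro summable_on_Un_ranges) (auto simp: inj_on_def algebra_simps)
qed

lemma summable_kernel_powr:
  fixes x a :: real
  assumes a_pos: "a > 0" and p_less: "p < - 1"
  shows "(\<lambda>n. cmod (Complex (x + of_int n) a) powr p) summable_on UNIV"
proof (rule summable_on_comparison_test)
  define C where "C = 2 * (1 + (1 + cmod (Complex x a)) / a)"
  have C_pos: "C > 0" using a_pos
    by (auto simp: C_def intro!: mult_pos_pos add_pos_nonneg divide_nonneg_pos)
  show "(\<lambda>n::int. C powr (- p) * (1 + \<bar>real_of_int n\<bar>) powr p) summable_on UNIV"
    by (intro summable_on_cmult_right summable_on_int_powr p_less)
  show "cmod (Complex (x + of_int n) a) powr p \<le> C powr (- p) * (1 + \<bar>real_of_int n\<bar>) powr p" for n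
  proof -
    have "of_int 1 * Complex x a + of_int n = Complex (x + of_int n) a" by (simp add: complex_eq_iff)
    hence "1 + \<bar>real_of_int n\<bar> \<le> C * cmod (Complex (x + of_int n) a)"
      using lattice_norm_bound[of a "Complex x a" "cmod (Complex x a)" 1 n] a_pos unfolding C_def
      by simp
    hence "cmod (Complex (x + of_int n) a) powr p \<le> ((1 + \<bar>real_of_int n\<bar>) / C) powr p"
      using C_pos p_less by (intro powr_mono2') (auto simp: field_simps)
    also have "\<dots> = C powr (- p) * (1 + \<bar>real_of_int n\<bar>) powr p"
      using C_pos by (simp add: powr_divide powr_minus field_simps)
    finally show ?thesis .
  qed
qed auto

lemma poisson_bessel:
  fixes f :: "real \<Rightarrow> real \<Rightarrow> real"
  assumes a_pos: "a > 0" and integral: "\<And>y. (f y has_integral I y) {0..}"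
    and bound: "\<And>y s. s \<ge> 0 \<Longrightarrow> \<bar>f y s\<bar> \<le> C * exp (- (1 / 2) * s) * cmod (Complex y a) powr (- 3 / 2)"
    and c_bound: "\<And>q. \<bar>c q\<bar> \<le> real (Suc q) ^ p"
    and fourier: "\<And>s. s \<ge> 0 \<Longrightarrow>
      (\<lambda>q. c q * (exp (- (2 * pi * real (Suc q) * a) * cosh s) * cosh (\<nu> * s))) sums G s"
    and lipschitz: "\<And>s. s \<ge> 0 \<Longrightarrow> (\<lambda>n. f (x + of_int n) s) int_sums (\<gamma> * G s)"
  shows "(\<lambda>n. I (x + of_int n)) int_sums (\<gamma> * (\<Sum>q. c q * bessel_K \<nu> (2 * pi * real (Suc q) * a)))"
proof -
  define M where "M n = cmod (Complex (x + of_int n) a) powr (- 3 / 2)" for n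
  have "0 \<le> C * exp (- (1 / 2) * 0) * cmod (Complex 0 a) powr (- 3 / 2)"
    by (rule order_trans[OF abs_ge_zero bound]) simp
  hence "C \<ge> 0" using kernel_nonzero[OF a_pos, of 0] by (simp add: zero_le_mult_iff)
  have M_sums: "(\<lambda>k. M (int k) + M (- int k - 1)) sums infsum M UNIV"
    using has_sum_imp_int_sums[OF has_sum_infsum[OF summable_kernel_powr[OF a_pos, of "- 3 / 2" x]]]
    by (simp add: int_sums_def M_def[abs_def])
  have "(\<lambda>k. I (x + of_int (int k)) + I (x + of_int (- int k - 1))) sums integral {0..} (\<lambda>s. \<gamma> * G s)"
  proof (rule sums_integral_dominated)
    show "((\<lambda>s. f (x + of_int (int k)) s + f (x + of_int (- int k - 1)) s) has_integral
        I (x + of_int (int k)) + I (x + of_int (- int k - 1))) {0..}" for k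
      by (intro has_integral_add integral)
    show "(\<lambda>s. C * exp (- (1 / 2) * s)) integrable_on {0..}"
      by (intro integrable_on_mult_right integrable_on_exp_minus_to_infinity) simp
    show "\<bar>f (x + of_int (int k)) s + f (x + of_int (- int k - 1)) s\<bar> \<le>
        (M (int k) + M (- int k - 1)) * (C * exp (- (1 / 2) * s))" if "s \<in> {0..}" for k s
      using bound[of s "x + of_int (int k)"] bound[of s "x + of_int (- int k - 1)"] that
      by (simp add: M_def algebra_simps)
    show "(\<lambda>k. f (x + of_int (int k)) s + f (x + of_int (- int k - 1)) s) sums (\<gamma> * G s)"
      if "s \<in> {0..}" for s
      using lipschitz[of s] that by (simp add: int_sums_def)
  qed (use M_sums \<open>C \<ge> 0\<close> in \<open>auto simp: sums_iff M_def\<close>)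
  moreover have "(\<Sum>q. c q * bessel_K \<nu> (2 * pi * real (Suc q) * a)) = integral {0..} G"
    using bessel_series_sums[OF a_pos c_bound fourier] by (rule sums_unique[symmetric])
  ultimately show ?thesis by (simp add: int_sums_def)
qed

lemma abs_cosh_mult_Re_le:
  fixes w :: complex
  assumes "cmod w powr (3 / 2) * u powr (3 / 2) \<le> cmod v" "w \<noteq> 0" "u > 0"
  shows "\<bar>cosh s * Re (1 / v)\<bar> \<le> cosh s / (cmod w powr (3 / 2) * u powr (3 / 2))"
    and "\<bar>Im (1 / v)\<bar> \<le> cosh s / (cmod w powr (3 / 2) * u powr (3 / 2))"
proof -
  have pos: "cmod w powr (3 / 2) * u powr (3 / 2) > 0" using assms by simp
  hence "cosh s * (1 / cmod v) \<le> cosh s * (1 / (cmod w powr (3 / 2) * u powr (3 / 2)))"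
    using assms(1) by (intro mult_left_mono frac_le) auto
  hence "cosh s * cmod (1 / v) \<le> cosh s / (cmod w powr (3 / 2) * u powr (3 / 2))"
    by (simp add: norm_divide)
  moreover have "\<bar>cosh s * Re (1 / v)\<bar> \<le> cosh s * cmod (1 / v)"
    unfolding abs_mult using abs_Re_le_cmod[of "1 / v"] by (intro mult_mono) auto
  moreover have "\<bar>Im (1 / v)\<bar> \<le> cosh s * cmod (1 / v)"
    using abs_Im_le_cmod[of "1 / v"] mult_right_mono[OF cosh_real_ge_1[of s], of "cmod (1 / v)"] by simp
  ultimately show "\<bar>cosh s * Re (1 / v)\<bar> \<le> cosh s / (cmod w powr (3 / 2) * u powr (3 / 2))"
    "\<bar>Im (1 / v)\<bar> \<le> cosh s / (cmod w powr (3 / 2) * u powr (3 / 2))"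
    by linarith+
qed

lemma powr_three_halves_mult_le:
  fixes u x y :: real
  assumes "0 < u" "u \<le> x" "u \<le> y"
  shows "x powr (3 / 2) * u powr (3 / 2) \<le> x\<^sup>2 * y"
proof -
  have "x powr (3 / 2) * u powr (3 / 2) = x powr (3 / 2) * (u powr (1 / 2) * u powr 1)"
    by (simp only: powr_add[symmetric]) simp
  also have "\<dots> \<le> x powr (3 / 2) * (x powr (1 / 2) * y powr 1)"
    using assms by (intro mult_left_mono mult_mono powr_mono2) auto
  also have "\<dots> = x powr 2 * y"
    using powr_add[of x "3 / 2" "1 / 2"] assms by simp
  also have "\<dots> = x\<^sup>2 * y" using assms by simp
  finally show ?thesis .
qed

context
  fixes a x :: real
  assumes a_pos: "a > 0"
begin

lemma mult_cosh_pos: "a * cosh s > 0"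
  using a_pos by (simp add: cosh_real_pos)

lemma le_cmod_Complex: "a * cosh s \<le> cmod (Complex y (a * cosh s))"
  using abs_Im_le_cmod[of "Complex y (a * cosh s)"] by simp

lemma cube_kernel_bounds:
  "\<bar>cosh s * Re (1 / Complex y (a * cosh s) ^ 3)\<bar> \<le>
     sqrt 2 * a powr (- 3 / 2) * exp (- (1 / 2) * s) * cmod (Complex y a) powr (- 3 / 2)"
  "\<bar>Im (1 / Complex y (a * cosh s) ^ 3)\<bar> \<le>
     sqrt 2 * a powr (- 3 / 2) * exp (- (1 / 2) * s) * cmod (Complex y a) powr (- 3 / 2)"
proof -
  have "cmod (Complex y (a * cosh s)) powr (3 / 2) * (a * cosh s) powr (3 / 2) \<le>
      cmod (Complex y (a * cosh s) ^ 3)"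
    unfolding norm_power unfolding power3_eq_cube power2_eq_square[symmetric]
    by (intro powr_three_halves_mult_le mult_cosh_pos le_cmod_Complex)
  from abs_cosh_mult_Re_le[OF this kernel_nonzero[OF mult_cosh_pos] mult_cosh_pos, of s]
  show "\<bar>cosh s * Re (1 / Complex y (a * cosh s) ^ 3)\<bar> \<le>
      sqrt 2 * a powr (- 3 / 2) * exp (- (1 / 2) * s) * cmod (Complex y a) powr (- 3 / 2)"
    "\<bar>Im (1 / Complex y (a * cosh s) ^ 3)\<bar> \<le>
      sqrt 2 * a powr (- 3 / 2) * exp (- (1 / 2) * s) * cmod (Complex y a) powr (- 3 / 2)"
    by (blast intro: kernel_bound[OF a_pos])+
qed

lemma lipschitz_formula_kernel:
  assumes "m > 0"
  shows "(\<lambda>n. 1 / Complex (x + of_int n) (a * cosh s) ^ Suc m) int_sums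
    ((- 2 * of_real pi * \<i>) ^ Suc m / fact m * power_gf m
      (exp (2 * of_real pi * \<i> * Complex x (a * cosh s))))"
proof -
  have "Complex (x + of_int n) u = Complex x u + of_int n" for n u by (simp add: complex_eq_iff)
  thus ?thesis using lipschitz_formula[of "Complex x (a * cosh s)" m] mult_cosh_pos assms by simp
qed

theorem poisson_K0_cos:
  "(\<lambda>n. (a\<^sup>2 - 2 * (x + of_int n)\<^sup>2) / cmod (Complex (x + of_int n) a) ^ 5) int_sums
     (16 * pi\<^sup>2 * bessel_cos_series 2 0 x a)"
proof -
  let ?S = "\<lambda>s. power_gf 2 (exp (2 * of_real pi * \<i> * Complex x (a * cosh s)))"
  have "(\<lambda>n. pi / 4 * ((a\<^sup>2 - 2 * (x + of_int n)\<^sup>2) / cmod (Complex (x + of_int n) a) ^ 5)) int_sums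
      (4 * pi ^ 3 * bessel_cos_series 2 0 x a)"
    unfolding bessel_cos_series_def
  proof (rule poisson_bessel[OF a_pos Im_kernel_cube_has_integral[OF a_pos] cube_kernel_bounds(2)])
    show "\<bar>real (Suc q) ^ 2 * cos (2 * pi * real (Suc q) * x)\<bar> \<le> real (Suc q) ^ 2" for q
      by (simp add: abs_mult mult_left_le)
    show "(\<lambda>q. real (Suc q) ^ 2 * cos (2 * pi * real (Suc q) * x) *
        (exp (- (2 * pi * real (Suc q) * a) * cosh s) * cosh (0 * s))) sums Re (?S s)" for s
      using Fourier_sums_power_gf(1)[OF mult_cosh_pos, of 2 x s] by (simp add: mult.assoc)
    show "(\<lambda>n. Im (1 / Complex (x + of_int n) (a * cosh s) ^ 3)) int_sums (4 * pi ^ 3 * Re (?S s))"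
      for s
      using int_sums_Im[OF lipschitz_formula_kernel[of 2 s]]
      by (simp add: eval_nat_numeral power_mult_distrib mult_ac)
  qed
  from int_sums_mult[OF this, of "4 / pi"]
  have "(\<lambda>n. 4 / pi * (pi / 4 * ((a\<^sup>2 - 2 * (x + of_int n)\<^sup>2) / cmod (Complex (x + of_int n) a) ^ 5)))
      int_sums (4 / pi * (4 * pi ^ 3 * bessel_cos_series 2 0 x a))" .
  moreover have "4 / pi * (pi / 4 * r) = r" "4 / pi * (4 * pi ^ 3 * r) = 16 * pi\<^sup>2 * r" for r
    by (simp_all add: power2_eq_square power3_eq_cube)
  ultimately show ?thesis by (simp only:)
qed

theorem poisson_K1_sin:
  "(\<lambda>n. (x + of_int n) / cmod (Complex (x + of_int n) a) ^ 5) int_sums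
     (16 * pi\<^sup>2 / (3 * a) * bessel_sin_series 2 1 x a)"
proof -
  let ?S = "\<lambda>s. power_gf 2 (exp (2 * of_real pi * \<i> * Complex x (a * cosh s)))"
  have "(\<lambda>n. - (3 * pi * a / 4) * ((x + of_int n) / cmod (Complex (x + of_int n) a) ^ 5)) int_sums
      (- 4 * pi ^ 3 * bessel_sin_series 2 1 x a)"
    unfolding bessel_sin_series_def
  proof (rule poisson_bessel[OF a_pos cosh_Re_kernel_cube_has_integral[OF a_pos] cube_kernel_bounds(1)])
    show "\<bar>real (Suc q) ^ 2 * sin (2 * pi * real (Suc q) * x)\<bar> \<le> real (Suc q) ^ 2" for q
      by (simp add: abs_mult mult_left_le)
    show "(\<lambda>q. real (Suc q) ^ 2 * sin (2 * pi * real (Suc q) * x) *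
        (exp (- (2 * pi * real (Suc q) * a) * cosh s) * cosh (1 * s))) sums (cosh s * Im (?S s))" for s
      using sums_mult[OF Fourier_sums_power_gf(2)[OF mult_cosh_pos, of 2 x s], of "cosh s"]
      by (simp add: mult_ac)
    show "(\<lambda>n. cosh s * Re (1 / Complex (x + of_int n) (a * cosh s) ^ 3)) int_sums
        (- 4 * pi ^ 3 * (cosh s * Im (?S s)))" for s
      using int_sums_mult[OF int_sums_Re[OF lipschitz_formula_kernel[of 2 s]], of "cosh s"]
      by (simp add: eval_nat_numeral power_mult_distrib mult_ac)
  qed
  from int_sums_mult[OF this, of "- 4 / (3 * pi * a)"]
  have "(\<lambda>n. - 4 / (3 * pi * a) *
      (- (3 * pi * a / 4) * ((x + of_int n) / cmod (Complex (x + of_int n) a) ^ 5)))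
      int_sums (- 4 / (3 * pi * a) * (- 4 * pi ^ 3 * bessel_sin_series 2 1 x a))" .
  moreover have "- 4 / (3 * pi * a) * (- (3 * pi * a / 4) * r) = r"
    "- 4 / (3 * pi * a) * (- 4 * pi ^ 3 * r) = 16 * pi\<^sup>2 / (3 * a) * r" for r
    using a_pos by (simp_all add: power2_eq_square power3_eq_cube)
  ultimately show ?thesis by (simp only:)
qed

lemma cosh_Re_kernel_telescope:
  "(\<lambda>n. cosh s * Re (1 / Complex (x + of_int n) (a * cosh s)) -
     cosh s * Re (1 / Complex (x + of_int n + 1) (a * cosh s))) int_sums 0"
proof -
  have "((\<lambda>N. cosh s * ((x - real N) / ((x - real N)\<^sup>2 + u\<^sup>2)) -
      cosh s * ((x + real N) / ((x + real N)\<^sup>2 + u\<^sup>2))) \<longlongrightarrow> 0) at_top" for u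
    by real_asymp
  hence "(\<lambda>N. cosh s * Re (1 / Complex (x + of_int (- int N)) (a * cosh s)) -
      cosh s * Re (1 / Complex (x + of_int (int N)) (a * cosh s))) \<longlonglongrightarrow> 0"
    by (simp add: Re_Im_inverse_power_Complex(1)[OF less_imp_neq[OF mult_cosh_pos, symmetric]])
  from int_sums_telescope[OF this] show ?thesis by (simp add: add.assoc)
qed

lemma kernel_antiderivative_telescope:
  "(\<lambda>n. (x + of_int n) / cmod (Complex (x + of_int n) a) -
     (x + of_int n + 1) / cmod (Complex (x + of_int n + 1) a)) int_sums (- 2)"
proof -
  have "((\<lambda>N. (x - real N) / sqrt ((x - real N)\<^sup>2 + a\<^sup>2)) \<longlongrightarrow> - 1) at_top"
    "((\<lambda>N. (x + real N) / sqrt ((x + real N)\<^sup>2 + a\<^sup>2)) \<longlongrightarrow> 1) at_top"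
    by real_asymp+
  from tendsto_diff[OF this]
  have "(\<lambda>N. (x + of_int (- int N)) / cmod (Complex (x + of_int (- int N)) a) -
      (x + of_int (int N)) / cmod (Complex (x + of_int (int N)) a)) \<longlonglongrightarrow> - 2"
    by (simp add: complex_norm)
  from int_sums_telescope[OF this] show ?thesis by (simp add: add.assoc)
qed

text \<open>
  The kernel \<open>1 / w\<^sup>2\<close> decays too slowly for the integrals over \<open>s\<close> to be dominated uniformly in \<open>n\<close>.
  Subtracting the telescoping \<open>1 / w - 1 / (w + 1)\<close> makes it cubic; the integrated telescoping series
  does not vanish and contributes the summand \<open>2 / a\<^sup>2\<close> of \<open>poisson_K1_cos\<close>.
\<close>

lemma regularized_square_kernel_bound:
  "\<bar>cosh s * Re (1 / Complex y (a * cosh s) ^ 2) -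
     (cosh s * Re (1 / Complex y (a * cosh s)) - cosh s * Re (1 / Complex (y + 1) (a * cosh s)))\<bar> \<le>
     sqrt 2 * a powr (- 3 / 2) * exp (- (1 / 2) * s) * cmod (Complex y a) powr (- 3 / 2)"
proof (rule kernel_bound[OF a_pos])
  define w where "w = Complex y (a * cosh s)"
  have Complex_eq_w: "Complex (y + 1) (a * cosh s) = w + 1" by (simp add: w_def complex_eq_iff)
  have nonzero: "w \<noteq> 0" "w + 1 \<noteq> 0"
    using kernel_nonzero[OF mult_cosh_pos, of y s] kernel_nonzero[OF mult_cosh_pos, of "y + 1" s]
        Complex_eq_w
    by (simp_all add: w_def)
  have "cosh s * Re (1 / w\<^sup>2) - (cosh s * Re (1 / w) - cosh s * Re (1 / (w + 1))) =
      cosh s * Re (1 / w\<^sup>2 - (1 / w - 1 / (w + 1)))"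
    by (simp add: algebra_simps)
  also have "1 / w\<^sup>2 - (1 / w - 1 / (w + 1)) = 1 / (w\<^sup>2 * (w + 1))"
    using nonzero by (simp add: divide_simps) (simp add: algebra_simps power2_eq_square)
  finally have "cosh s * Re (1 / w\<^sup>2) - (cosh s * Re (1 / w) - cosh s * Re (1 / (w + 1))) =
      cosh s * Re (1 / (w\<^sup>2 * (w + 1)))" .
  moreover have "cmod w powr (3 / 2) * (a * cosh s) powr (3 / 2) \<le> cmod (w\<^sup>2 * (w + 1))"
    unfolding norm_mult norm_power Complex_eq_w[symmetric] unfolding w_def
    by (intro powr_three_halves_mult_le mult_cosh_pos le_cmod_Complex)
  ultimately show "\<bar>cosh s * Re (1 / Complex y (a * cosh s) ^ 2) -
      (cosh s * Re (1 / Complex y (a * cosh s)) - cosh s * Re (1 / Complex (y + 1) (a * cosh s)))\<bar> \<le>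
      cosh s / (cmod (Complex y (a * cosh s)) powr (3 / 2) * (a * cosh s) powr (3 / 2))"
    unfolding Complex_eq_w w_def[symmetric] using abs_cosh_mult_Re_le(1) nonzero(1) mult_cosh_pos
    by metis
qed

theorem poisson_K1_cos:
  "(\<lambda>n. 1 / cmod (Complex (x + of_int n) a) ^ 3) int_sums
     (2 / a\<^sup>2 + 8 * pi / a * bessel_cos_series 1 1 x a)"
proof -
  let ?S = "\<lambda>s. power_gf 1 (exp (2 * of_real pi * \<i> * Complex x (a * cosh s)))"
  have "(\<lambda>n. - (pi * a / 2) / cmod (Complex (x + of_int n) a) ^ 3 -
      (pi * (x + of_int n) / (2 * a * cmod (Complex (x + of_int n) a)) -
       pi * (x + of_int n + 1) / (2 * a * cmod (Complex (x + of_int n + 1) a)))) int_sums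
      (- 4 * pi\<^sup>2 * bessel_cos_series 1 1 x a)"
    unfolding bessel_cos_series_def
  proof (rule poisson_bessel[OF a_pos has_integral_diff[OF cosh_Re_kernel_square_has_integral[OF a_pos]
          has_integral_diff[OF cosh_Re_kernel_has_integral[OF a_pos]
            cosh_Re_kernel_has_integral[OF a_pos]]]
        regularized_square_kernel_bound])
    show "\<bar>real (Suc q) ^ 1 * cos (2 * pi * real (Suc q) * x)\<bar> \<le> real (Suc q) ^ 1" for q
      by (simp add: abs_mult mult_left_le)
    show "(\<lambda>q. real (Suc q) ^ 1 * cos (2 * pi * real (Suc q) * x) *
        (exp (- (2 * pi * real (Suc q) * a) * cosh s) * cosh (1 * s))) sums (cosh s * Re (?S s))" for s
      using sums_mult[OF Fourier_sums_power_gf(1)[OF mult_cosh_pos, of 1 x s], of "cosh s"]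
      by (simp add: mult_ac)
    show "(\<lambda>n. cosh s * Re (1 / Complex (x + of_int n) (a * cosh s) ^ 2) -
        (cosh s * Re (1 / Complex (x + of_int n) (a * cosh s)) -
         cosh s * Re (1 / Complex (x + of_int n + 1) (a * cosh s)))) int_sums
        (- 4 * pi\<^sup>2 * (cosh s * Re (?S s)))" for s
      using int_sums_diff[OF int_sums_mult[OF int_sums_Re[OF lipschitz_formula_kernel[of 1 s]],
          of "cosh s"]
          cosh_Re_kernel_telescope[of s]]
      by (simp add: eval_nat_numeral power_mult_distrib mult_ac)
  qed
  from int_sums_add[OF this int_sums_mult[OF kernel_antiderivative_telescope, of "pi / (2 * a)"]]
  have "(\<lambda>n. - (pi * a / 2) * (1 / cmod (Complex (x + of_int n) a) ^ 3)) int_sums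
      (- pi / a - 4 * pi\<^sup>2 * bessel_cos_series 1 1 x a)"
    by (simp add: algebra_simps)
  from int_sums_mult[OF this, of "- 2 / (pi * a)"]
  have "(\<lambda>n. - 2 / (pi * a) * (- (pi * a / 2) * (1 / cmod (Complex (x + of_int n) a) ^ 3))) int_sums
      (- 2 / (pi * a) * (- pi / a - 4 * pi\<^sup>2 * bessel_cos_series 1 1 x a))" .
  moreover have "- 2 / (pi * a) * (- (pi * a / 2) * r) = r" for r using a_pos by simp
  moreover have "- 2 / (pi * a) * (- pi / a - 4 * pi\<^sup>2 * r) = 2 / a\<^sup>2 + 8 * pi / a * r" for r
    using a_pos by (simp add: field_simps power2_eq_square)
  ultimately show ?thesis by (simp only:)
qed

end

section \<open>Lattice sums\<close>

abbreviation int_lattice :: "(int \<times> int) set" where "int_lattice \<equiv> UNIV - {(0, 0)}"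

definition lattice_point :: "complex \<Rightarrow> int \<times> int \<Rightarrow> complex" where
  "lattice_point \<tau> x = of_int (fst x) * \<tau> + of_int (snd x)"

definition lattice_sum :: "(complex \<Rightarrow> 'a :: {comm_monoid_add, t2_space}) \<Rightarrow> complex \<Rightarrow> 'a" where
  "lattice_sum F \<tau> = (\<Sum>\<^sub>\<infinity>x\<in>int_lattice. F (lattice_point \<tau> x))"

lemma eisenstein_eq_lattice_sum: "eisenstein \<tau> = lattice_sum (\<lambda>w. 1 / cmod w ^ 3) \<tau>"
  by (simp add: eisenstein_def lattice_sum_def lattice_point_def case_prod_unfold)

text \<open>The companion of \<open>eisenstein\<close>, of weight \<open>(-1, 1)\<close> up to \<open>|j|\<^sup>3\<close>, through which its derivative
  is expressed.\<close>

definition twisted_eisenstein :: "complex \<Rightarrow> complex" where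
  "twisted_eisenstein = lattice_sum (\<lambda>w. w\<^sup>2 / of_real (cmod w) ^ 5)"

lemma lattice_point_nonzero: "Im \<tau> > 0 \<Longrightarrow> x \<in> int_lattice \<Longrightarrow> lattice_point \<tau> x \<noteq> 0"
  by (cases x) (auto simp: lattice_point_def complex_eq_iff)

lemma lattice_point_uminus: "lattice_point \<tau> (- x) = - lattice_point \<tau> x"
  by (simp add: lattice_point_def)

lemma summable_on_product_nonneg:
  fixes f :: "'a \<Rightarrow> real" and g :: "'b \<Rightarrow> real"
  assumes f_summable: "f summable_on A" "\<And>x. x \<in> A \<Longrightarrow> f x \<ge> 0"
    and g_summable: "g summable_on B" "\<And>y. y \<in> B \<Longrightarrow> g y \<ge> 0"
  shows "(\<lambda>x. f (fst x) * g (snd x)) summable_on A \<times> B"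
proof (rule summable_on_SigmaI)
  show "((\<lambda>y. f (fst (x, y)) * g (snd (x, y))) has_sum f x * infsum g B) B" for x
    using has_sum_cmult_right[OF has_sum_infsum[OF g_summable(1)]] by simp
  show "(\<lambda>x. f x * infsum g B) summable_on A"
    by (rule summable_on_cmult_left[OF f_summable(1)])
qed (use f_summable g_summable in auto)

lemma summable_on_inverse_cube_lattice:
  "(\<lambda>x :: int \<times> int. 1 / (1 + \<bar>real_of_int (fst x)\<bar> + \<bar>real_of_int (snd x)\<bar>) ^ 3) summable_on UNIV"
proof (rule summable_on_comparison_test)
  let ?f = "\<lambda>n::int. (1 + \<bar>real_of_int n\<bar>) powr (- 3 / 2)"
  have "(\<lambda>x. ?f (fst x) * ?f (snd x)) summable_on UNIV \<times> UNIV"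
    by (intro summable_on_product_nonneg summable_on_int_powr) auto
  thus "(\<lambda>x :: int \<times> int. ?f (fst x) * ?f (snd x)) summable_on UNIV" by simp
  fix x :: "int \<times> int"
  define A B where "A = 1 + \<bar>real_of_int (fst x)\<bar>" and "B = 1 + \<bar>real_of_int (snd x)\<bar>"
  have ge_1: "A \<ge> 1" "B \<ge> 1" by (auto simp: A_def B_def)
  have "A powr (3 / 2) * B powr (3 / 2) \<le> (A + B - 1) powr (3 / 2) * (A + B - 1) powr (3 / 2)"
    using ge_1 by (intro mult_mono powr_mono2) auto
  also have "\<dots> = (A + B - 1) ^ 3" using ge_1 by (simp add: powr_numeral flip: powr_add)
  finally have "1 / (A + B - 1) ^ 3 \<le> 1 / (A powr (3 / 2) * B powr (3 / 2))"
    using ge_1 by (intro divide_left_mono mult_pos_pos) auto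
  also have "\<dots> = A powr (- 3 / 2) * B powr (- 3 / 2)" using ge_1 by (simp add: powr_minus field_simps)
  finally show "1 / (1 + \<bar>real_of_int (fst x)\<bar> + \<bar>real_of_int (snd x)\<bar>) ^ 3 \<le> ?f (fst x) * ?f (snd x)"
    by (simp add: A_def B_def add_ac)
qed auto

definition lattice_const :: "real \<Rightarrow> real \<Rightarrow> real" where
  "lattice_const \<epsilon> R = (2 * (1 + (1 + R) / \<epsilon>)) ^ 3"

lemma inverse_cube_lattice_point_le:
  assumes "\<epsilon> > 0" "Im \<tau> \<ge> \<epsilon>" "cmod \<tau> \<le> R" "x \<in> int_lattice"
  shows "1 / cmod (lattice_point \<tau> x) ^ 3 \<le>
    lattice_const \<epsilon> R * (1 / (1 + \<bar>real_of_int (fst x)\<bar> + \<bar>real_of_int (snd x)\<bar>) ^ 3)"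
proof -
  define A C where "A = 1 + \<bar>real_of_int (fst x)\<bar> + \<bar>real_of_int (snd x)\<bar>"
    and "C = 2 * (1 + (1 + R) / \<epsilon>)"
  have A_pos: "A > 0" by (simp add: A_def add_pos_nonneg)
  have "A \<le> C * cmod (lattice_point \<tau> x)"
    unfolding A_def C_def lattice_point_def using assms
    by (intro lattice_norm_bound[of \<epsilon> \<tau> R "fst x" "snd x"]) (auto simp: prod_eq_iff)
  hence "A ^ 3 \<le> C ^ 3 * cmod (lattice_point \<tau> x) ^ 3"
    using A_pos by (simp add: power_mono flip: power_mult_distrib)
  moreover have "cmod (lattice_point \<tau> x) > 0"
    using lattice_point_nonzero[of \<tau> x] assms by simp
  ultimately show ?thesis
    unfolding A_def[symmetric] lattice_const_def C_def[symmetric] using A_pos by (simp add: field_simps)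
qed

lemma abs_summable_on_lattice:
  fixes F :: "complex \<Rightarrow> 'a :: real_normed_vector"
  assumes Im_pos: "Im \<tau> > 0" and F_decay: "\<And>w. w \<noteq> 0 \<Longrightarrow> norm (F w) \<le> C / cmod w ^ 3"
  shows "(\<lambda>x. norm (F (lattice_point \<tau> x))) summable_on int_lattice"
proof -
  let ?b = "\<lambda>x. lattice_const (Im \<tau>) (cmod \<tau>) *
      (1 / (1 + \<bar>real_of_int (fst x)\<bar> + \<bar>real_of_int (snd x)\<bar>) ^ 3)"
  have C_nonneg: "C \<ge> 0" using order_trans[OF norm_ge_zero F_decay[of 1]] by simp
  have "(\<lambda>x. C * ?b x) summable_on int_lattice"
    using summable_on_subset_banach[OF summable_on_inverse_cube_lattice]
    by (intro summable_on_cmult_right) auto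
  thus ?thesis
  proof (rule Infinite_Sum.abs_summable_on_comparison_test')
    fix x assume x_lattice: "x \<in> int_lattice"
    have "norm (F (lattice_point \<tau> x)) \<le> C * (1 / cmod (lattice_point \<tau> x) ^ 3)"
      using F_decay[OF lattice_point_nonzero[OF Im_pos x_lattice]] by simp
    also have "\<dots> \<le> C * ?b x"
      using Im_pos x_lattice C_nonneg by (intro mult_left_mono inverse_cube_lattice_point_le) auto
    finally show "norm (F (lattice_point \<tau> x)) \<le> C * ?b x" .
  qed
qed

lemma has_sum_lattice_sum:
  fixes F :: "complex \<Rightarrow> 'a :: banach"
  assumes "Im \<tau> > 0" "\<And>w. w \<noteq> 0 \<Longrightarrow> norm (F w) \<le> C / cmod w ^ 3"
  shows "((\<lambda>x. F (lattice_point \<tau> x)) has_sum lattice_sum F \<tau>) int_lattice"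
  unfolding lattice_sum_def
  by (rule has_sum_infsum[OF abs_summable_summable[OF abs_summable_on_lattice[OF assms]]])

lemma norm_square_over_fifth: "norm (w\<^sup>2 / of_real (cmod w) ^ 5) = 1 / cmod w ^ 3"
  by (cases "w = 0") (simp_all add: norm_divide norm_power divide_simps flip: power_add)

lemma eisenstein_has_sum:
  assumes "Im \<tau> > 0"
  shows "((\<lambda>x. 1 / cmod (lattice_point \<tau> x) ^ 3) has_sum eisenstein \<tau>) int_lattice"
  unfolding eisenstein_eq_lattice_sum using assms
  by (rule has_sum_lattice_sum[where C = 1]) (simp add: norm_divide norm_power)

lemma twisted_eisenstein_has_sum:
  assumes "Im \<tau> > 0"
  shows "((\<lambda>x. (lattice_point \<tau> x)\<^sup>2 / of_real (cmod (lattice_point \<tau> x)) ^ 5) has_sum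
    twisted_eisenstein \<tau>) int_lattice"
  unfolding twisted_eisenstein_def using assms
  by (rule has_sum_lattice_sum[where C = 1]) (simp add: norm_square_over_fifth)

lemma norm_twisted_eisenstein_le:
  assumes "Im \<tau> > 0"
  shows "cmod (twisted_eisenstein \<tau>) \<le> eisenstein \<tau>"
  by (rule norm_infsum_le[OF twisted_eisenstein_has_sum eisenstein_has_sum])
    (use assms in \<open>simp_all add: norm_square_over_fifth\<close>)

lemma eisenstein_pos:
  assumes "Im \<tau> > 0"
  shows "eisenstein \<tau> > 0"
proof -
  have "(\<Sum>x\<in>{(0, 1)}. 1 / cmod (lattice_point \<tau> x) ^ 3) \<le> eisenstein \<tau>"
    by (rule finite_sum_le_has_sum[OF eisenstein_has_sum[OF assms]]) auto
  thus ?thesis by (simp add: lattice_point_def)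
qed

lemma range_int_Suc: "range (\<lambda>k. int (Suc k)) = {0<..}"
proof (intro equalityI subsetI)
  fix n :: int assume "n \<in> {0<..}"
  thus "n \<in> range (\<lambda>k. int (Suc k))" by (intro range_eqI[of _ _ "nat (n - 1)"]) simp
qed auto

lemma infsum_int_lattice_even:
  fixes f :: "int \<times> int \<Rightarrow> real"
  assumes f_summable: "f summable_on int_lattice" and even: "\<And>x. f (- x) = f x"
  shows "infsum f int_lattice =
    2 * infsum f ({0<..} \<times> UNIV) + 2 * infsum f ({0} \<times> {0<..})"
proof -
  define P Q where "P = {0 :: int<..} \<times> (UNIV :: int set)" and "Q = {0 :: int} \<times> {0 :: int<..}"
  have mem: "x \<in> P \<longleftrightarrow> fst x > 0" "x \<in> Q \<longleftrightarrow> fst x = 0 \<and> snd x > 0" for x :: "int \<times> int"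
    by (auto simp: P_def Q_def mem_Times_iff)
  have mem_uminus: "x \<in> uminus ` A \<longleftrightarrow> - x \<in> A" for x :: "int \<times> int" and A
    by (metis image_iff minus_minus)
  have cover: "int_lattice = (P \<union> uminus ` P) \<union> (Q \<union> uminus ` Q)"
    by (auto simp: set_eq_iff mem mem_uminus)
  have summable: "f summable_on A" if "A \<subseteq> int_lattice" for A
    using f_summable that by (rule summable_on_subset_banach)
  have flip: "infsum f (uminus ` A) = infsum f A" for A
    by (subst infsum_reindex) (auto simp: o_def even)
  have "infsum f int_lattice = infsum f (P \<union> uminus ` P) + infsum f (Q \<union> uminus ` Q)"
    unfolding cover by (intro infsum_Un_disjoint summable) (auto simp: mem mem_uminus)
  also have "infsum f (P \<union> uminus ` P) = infsum f P + infsum f (uminus ` P)"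
    by (intro infsum_Un_disjoint summable) (auto simp: mem mem_uminus)
  also have "infsum f (Q \<union> uminus ` Q) = infsum f Q + infsum f (uminus ` Q)"
    by (intro infsum_Un_disjoint summable) (auto simp: mem mem_uminus)
  finally show ?thesis by (simp add: flip P_def Q_def)
qed

lemma lattice_sum_rows:
  fixes F :: "complex \<Rightarrow> real"
  assumes Im_pos: "Im \<tau> > 0" and F_decay: "\<And>w. w \<noteq> 0 \<Longrightarrow> norm (F w) \<le> C / cmod w ^ 3"
    and even: "\<And>w. F (- w) = F w"
    and row: "\<And>k. (\<lambda>n. F (of_nat (Suc k) * \<tau> + of_int n)) int_sums r k"
  shows "(\<lambda>k. 2 * r k) sums (lattice_sum F \<tau> - 2 * (\<Sum>n. F (of_nat (Suc n))))"
proof -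
  define f where "f x = F (lattice_point \<tau> x)" for x
  have f_summable: "f summable_on int_lattice"
    unfolding f_def[abs_def]
    by (rule abs_summable_summable[OF abs_summable_on_lattice[OF Im_pos F_decay]])
  have total: "lattice_sum F \<tau> = 2 * infsum f ({0<..} \<times> UNIV) + 2 * infsum f ({0} \<times> {0<..})"
    using infsum_int_lattice_even[OF f_summable]
    unfolding lattice_sum_def f_def lattice_point_uminus even by blast
  have f_subset: "(f has_sum infsum f A) A" if "A \<subseteq> int_lattice" for A
    using summable_on_subset_banach[OF f_summable that] by (rule has_sum_infsum)
  have axis_eq_range: "{0} \<times> {0<..} = range (\<lambda>k. (0 :: int, int (Suc k)))"
    unfolding range_int_Suc[symmetric] by auto
  have "(f has_sum infsum f ({0} \<times> {0<..})) (range (\<lambda>k. (0, int (Suc k))))"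
    unfolding axis_eq_range[symmetric] by (rule f_subset) auto
  hence "((\<lambda>k. f (0, int (Suc k))) has_sum infsum f ({0} \<times> {0<..})) UNIV"
    by (subst (asm) has_sum_reindex) (auto simp: inj_on_def o_def)
  hence axis: "(\<Sum>n. F (of_nat (Suc n))) = infsum f ({0} \<times> {0<..})"
    by (auto dest!: has_sum_imp_sums simp: sums_iff f_def lattice_point_def)
  have upper: "(f has_sum infsum f ({0<..} \<times> UNIV)) ({0<..} \<times> UNIV)"
    by (rule f_subset) auto
  have "((\<lambda>n. f (m, n)) has_sum r (nat (m - 1))) UNIV" if m_pos: "m \<in> {0<..}" for m
  proof -
    have "(\<lambda>n. f (m, n)) summable_on UNIV"
      using has_sum_imp_summable[OF upper] m_pos
      by (intro summable_on_SigmaD1[where f = "\<lambda>x y. f (x, y)"]) auto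
    hence "((\<lambda>n. f (m, n)) has_sum infsum (\<lambda>n. f (m, n)) UNIV) UNIV"
      by (rule has_sum_infsum)
    moreover have "(\<lambda>n. f (m, n)) int_sums r (nat (m - 1))"
      using row[of "nat (m - 1)"] m_pos by (simp add: f_def lattice_point_def of_nat_diff)
    ultimately show ?thesis using has_sum_imp_int_sums int_sums_unique2 by metis
  qed
  with upper have "((\<lambda>m. r (nat (m - 1))) has_sum infsum f ({0<..} \<times> UNIV)) {0<..}"
    by (rule has_sum_Sigma')
  hence "(r has_sum infsum f ({0<..} \<times> UNIV)) UNIV"
    unfolding range_int_Suc[symmetric] by (subst (asm) has_sum_reindex) (auto simp: inj_on_def o_def)
  from sums_mult[OF has_sum_imp_sums[OF this], of 2] show ?thesis unfolding total axis by simp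
qed

lemma of_nat_mult_add_of_int_eq_Complex:
  "of_nat m * \<tau> + of_int n = Complex (real m * Re \<tau> + of_int n) (real m * Im \<tau>)"
  by (simp add: complex_eq_iff)

lemma eisenstein_rows:
  assumes Im_pos: "Im \<tau> > 0"
  shows "(\<lambda>k. 2 * (2 / (real (Suc k) * Im \<tau>)\<^sup>2 +
      8 * pi / (real (Suc k) * Im \<tau>) * bessel_cos_series 1 1 (real (Suc k) * Re \<tau>)
      (real (Suc k) * Im \<tau>)))
    sums (eisenstein \<tau> - 2 * zeta3)"
proof -
  have "(\<lambda>k. 2 * (2 / (real (Suc k) * Im \<tau>)\<^sup>2 +
      8 * pi / (real (Suc k) * Im \<tau>) * bessel_cos_series 1 1 (real (Suc k) * Re \<tau>)
      (real (Suc k) * Im \<tau>)))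
    sums (lattice_sum (\<lambda>w. 1 / cmod w ^ 3) \<tau> - 2 * (\<Sum>n. 1 / cmod (of_nat (Suc n)) ^ 3))"
  proof (rule lattice_sum_rows[OF Im_pos, where C = 1])
    show "(\<lambda>n. 1 / cmod (of_nat (Suc k) * \<tau> + of_int n) ^ 3) int_sums
        (2 / (real (Suc k) * Im \<tau>)\<^sup>2 +
         8 * pi / (real (Suc k) * Im \<tau>) * bessel_cos_series 1 1 (real (Suc k) * Re \<tau>)
         (real (Suc k) * Im \<tau>))" for k
      unfolding of_nat_mult_add_of_int_eq_Complex using Im_pos by (intro poisson_K1_cos) simp
  qed (simp_all add: norm_divide norm_power)
  thus ?thesis by (simp add: eisenstein_eq_lattice_sum zeta3_def norm_of_nat del: of_nat_Suc)
qed

lemma inverse_cube_eq_sum_over_fifth: "1 / cmod w ^ 3 = ((Re w)\<^sup>2 + (Im w)\<^sup>2) / cmod w ^ 5"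
proof -
  have "1 / cmod w ^ 3 = (cmod w)\<^sup>2 / cmod w ^ 5"
    by (cases "w = 0") (simp_all add: divide_simps flip: power_add)
  thus ?thesis by (simp add: cmod_power2)
qed

lemma Re_Im_square_over_fifth:
  "Re (w\<^sup>2 / of_real (cmod w) ^ 5) = ((Re w)\<^sup>2 - (Im w)\<^sup>2) / cmod w ^ 5"
  "Im (w\<^sup>2 / of_real (cmod w) ^ 5) = 2 * (Re w * Im w) / cmod w ^ 5"
  by (simp_all flip: of_real_power add: power2_eq_square)

lemma Re_twisted_eisenstein_rows:
  assumes Im_pos: "Im \<tau> > 0"
  shows "(\<lambda>k. 2 * (16 * pi\<^sup>2 * bessel_cos_series 2 0 (real (Suc k) * Re \<tau>) (real (Suc k) * Im \<tau>)))
    sums (4 * zeta3 - (eisenstein \<tau> + 3 * Re (twisted_eisenstein \<tau>)) / 2)"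
proof -
  define F where "F w = ((Im w)\<^sup>2 - 2 * (Re w)\<^sup>2) / cmod w ^ 5" for w
  have F_eq: "F w = - (1 / 2) * (1 / cmod w ^ 3) + - (3 / 2) * Re (w\<^sup>2 / of_real (cmod w) ^ 5)" for w
    unfolding F_def inverse_cube_eq_sum_over_fifth Re_Im_square_over_fifth
    by (cases "w = 0") (simp_all add: field_simps)
  have decay: "\<bar>F w\<bar> \<le> 2 * (1 / cmod w ^ 3)" for w
    using abs_Re_le_cmod[of "w\<^sup>2 / of_real (cmod w) ^ 5"] zero_le_power[OF norm_ge_zero, of w 3]
    unfolding F_eq norm_square_over_fifth by linarith
  have rows: "(\<lambda>k. 2 * (16 * pi\<^sup>2 * bessel_cos_series 2 0 (real (Suc k) * Re \<tau>) (real (Suc k) * Im \<tau>)))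
      sums (lattice_sum F \<tau> - 2 * (\<Sum>n. F (of_nat (Suc n))))"
  proof (rule lattice_sum_rows[OF Im_pos])
    show "(\<lambda>n. F (of_nat (Suc k) * \<tau> + of_int n)) int_sums
        (16 * pi\<^sup>2 * bessel_cos_series 2 0 (real (Suc k) * Re \<tau>) (real (Suc k) * Im \<tau>))" for k
      unfolding of_nat_mult_add_of_int_eq_Complex F_def complex.sel
      using Im_pos by (intro poisson_K0_cos) simp
  qed (use decay in \<open>auto simp: F_def\<close>)
  have "((\<lambda>x. F (lattice_point \<tau> x)) has_sum
      (- (1 / 2) * eisenstein \<tau> + - (3 / 2) * Re (twisted_eisenstein \<tau>))) int_lattice"
    unfolding F_eq using Im_pos
    by (intro has_sum_add has_sum_cmult_right eisenstein_has_sum has_sum_Re twisted_eisenstein_has_sum)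
  hence "lattice_sum F \<tau> = - (1 / 2) * eisenstein \<tau> + - (3 / 2) * Re (twisted_eisenstein \<tau>)"
    unfolding lattice_sum_def by (rule infsumI)
  moreover have "(\<Sum>n. F (of_nat (Suc n))) = - 2 * zeta3"
  proof -
    have "F (of_nat (Suc n)) = - 2 * (1 / real (Suc n) ^ 3)" for n
      by (simp add: F_def norm_of_nat divide_simps eval_nat_numeral del: of_nat_Suc)
    moreover have "summable (\<lambda>n. 1 / real (Suc n) ^ 3)"
      using inverse_power_summable[of 3, where 'a = real]
          summable_Suc_iff[of "\<lambda>n. inverse (real n ^ 3)"]
      by (simp add: divide_inverse)
    ultimately show ?thesis unfolding zeta3_def by (simp only: suminf_mult)
  qed
  ultimately have "lattice_sum F \<tau> - 2 * (\<Sum>n. F (of_nat (Suc n))) =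
      4 * zeta3 - (eisenstein \<tau> + 3 * Re (twisted_eisenstein \<tau>)) / 2"
    by (simp only:) (simp add: field_simps)
  thus ?thesis using rows by (simp only:)
qed

lemma Im_twisted_eisenstein_rows:
  assumes Im_pos: "Im \<tau> > 0"
  shows "(\<lambda>k. 2 * (16 * pi\<^sup>2 / 3 * bessel_sin_series 2 1 (real (Suc k) * Re \<tau>) (real (Suc k) * Im \<tau>)))
    sums (Im (twisted_eisenstein \<tau>) / 2)"
proof -
  define F where "F w = Re w * Im w / cmod w ^ 5" for w
  have F_eq: "F w = 1 / 2 * Im (w\<^sup>2 / of_real (cmod w) ^ 5)" for w
    unfolding F_def Re_Im_square_over_fifth by simp
  have decay: "\<bar>F w\<bar> \<le> 1 / cmod w ^ 3" for w
    using abs_Im_le_cmod[of "w\<^sup>2 / of_real (cmod w) ^ 5"] unfolding F_eq norm_square_over_fifth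
    by linarith
  have rows: "(\<lambda>k. 2 *
      (16 * pi\<^sup>2 / 3 * bessel_sin_series 2 1 (real (Suc k) * Re \<tau>) (real (Suc k) * Im \<tau>)))
      sums (lattice_sum F \<tau> - 2 * (\<Sum>n. F (of_nat (Suc n))))"
  proof (rule lattice_sum_rows[OF Im_pos])
    fix k
    define a x where "a = real (Suc k) * Im \<tau>" and "x = real (Suc k) * Re \<tau>"
    have a_pos: "a > 0" using Im_pos by (simp add: a_def)
    show "(\<lambda>n. F (of_nat (Suc k) * \<tau> + of_int n)) int_sums (16 * pi\<^sup>2 / 3 * bessel_sin_series 2 1 x a)"
      using int_sums_mult[OF poisson_K1_sin[OF a_pos, of x], of a] a_pos
      unfolding of_nat_mult_add_of_int_eq_Complex F_def a_def[symmetric] x_def[symmetric]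
      by (simp add: mult_ac)
  qed (use decay in \<open>auto simp: F_def\<close>)
  have "((\<lambda>x. F (lattice_point \<tau> x)) has_sum (1 / 2 * Im (twisted_eisenstein \<tau>))) int_lattice"
    unfolding F_eq using Im_pos by (intro has_sum_cmult_right has_sum_Im twisted_eisenstein_has_sum)
  hence "lattice_sum F \<tau> = 1 / 2 * Im (twisted_eisenstein \<tau>)"
    unfolding lattice_sum_def by (rule infsumI)
  moreover have "(\<Sum>n. F (of_nat (Suc n))) = 0" by (simp add: F_def)
  ultimately have "lattice_sum F \<tau> - 2 * (\<Sum>n. F (of_nat (Suc n))) = Im (twisted_eisenstein \<tau>) / 2"
    by simp
  thus ?thesis using rows by (simp only:)
qed

section \<open>Modular transformations and the derivative of lattice sums\<close>

lemma UNIV_2: "(UNIV :: 2 set) = {0, 1}"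
  by (rule card_subset_eq[symmetric]) auto

lemma sum_UNIV_2: "(\<Sum>i\<in>(UNIV :: 2 set). f i) = f 0 + f 1"
  unfolding UNIV_2 by simp

lemma all_2: "(\<forall>i :: 2. P i) \<longleftrightarrow> P 0 \<and> P 1"
  using UNIV_2 by (metis UNIV_I insertE singletonD)

lemma vec2_eq_iff: "x = y \<longleftrightarrow> x $ 0 = y $ 0 \<and> x $ 1 = y $ 1" for x y :: "'a^2"
  by (simp add: vec_eq_iff all_2)

lemma det_matrix_2: "det A = A $ 0 $ 0 * A $ 1 $ 1 - A $ 0 $ 1 * A $ 1 $ 0"
  for A :: "'a :: comm_ring_1^2^2"
proof -
  have two: "(2 :: 2) = 0" by simp
  show ?thesis using det_2[of A] unfolding two by (simp add: algebra_simps)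
qed

lemma matrix_mult_2_nth: "(A ** B) $ i $ j = A $ i $ 0 * B $ 0 $ j + A $ i $ 1 * B $ 1 $ j"
  for A B :: "'a :: semiring_1^2^2"
  by (simp add: matrix_matrix_mult_def sum_UNIV_2)

lemma pair_nth [simp]: "pair x y $ 0 = x" "pair x y $ 1 = y"
  by (simp_all add: pair_def)

definition adjugate_2 :: "'a :: comm_ring_1^2^2 \<Rightarrow> 'a^2^2" where
  "adjugate_2 A = pair (pair (A $ 1 $ 1) (- A $ 0 $ 1)) (pair (- A $ 1 $ 0) (A $ 0 $ 0))"

lemma adjugate_2_mult:
  assumes "det A = 1"
  shows "adjugate_2 A ** A = mat 1" "A ** adjugate_2 A = mat 1" "det (adjugate_2 A) = 1"
  using assms
  by (simp_all add: adjugate_2_def vec2_eq_iff matrix_mult_2_nth mat_def det_matrix_2 algebra_simps)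

definition automorphy :: "int^2^2 \<Rightarrow> complex \<Rightarrow> complex" where
  "automorphy A \<tau> = of_int (A $ 1 $ 0) * \<tau> + of_int (A $ 1 $ 1)"

definition moebius :: "int^2^2 \<Rightarrow> complex \<Rightarrow> complex" where
  "moebius A \<tau> = (of_int (A $ 0 $ 0) * \<tau> + of_int (A $ 0 $ 1)) / automorphy A \<tau>"

lemma automorphy_nonzero:
  assumes "det A = 1" "Im \<tau> > 0"
  shows "automorphy A \<tau> \<noteq> 0"
proof -
  have "(A $ 1 $ 0, A $ 1 $ 1) \<in> int_lattice" using assms(1) by (auto simp: det_matrix_2)
  from lattice_point_nonzero[OF assms(2) this] show ?thesis
    by (simp add: automorphy_def lattice_point_def)
qed

lemma Im_moebius:
  assumes "det A = 1" "Im \<tau> > 0"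
  shows "Im (moebius A \<tau>) = Im \<tau> / (cmod (automorphy A \<tau>))\<^sup>2"
proof -
  have "moebius A \<tau> = (of_int (A $ 0 $ 0) * \<tau> + of_int (A $ 0 $ 1)) * cnj (automorphy A \<tau>) /
      of_real ((cmod (automorphy A \<tau>))\<^sup>2)"
    unfolding complex_norm_square using automorphy_nonzero[OF assms] by (simp add: moebius_def)
  hence "Im (moebius A \<tau>) = Im ((of_int (A $ 0 $ 0) * \<tau> + of_int (A $ 0 $ 1)) * cnj (automorphy A \<tau>)) /
      (cmod (automorphy A \<tau>))\<^sup>2"
    by (simp only: Im_divide_of_real)
  also have "Im ((of_int (A $ 0 $ 0) * \<tau> + of_int (A $ 0 $ 1)) * cnj (automorphy A \<tau>)) =
      of_int (det A) * Im \<tau>"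
    by (simp add: automorphy_def det_matrix_2 algebra_simps)
  finally show ?thesis by (simp add: assms(1))
qed

lemma Im_moebius_pos: "det A = 1 \<Longrightarrow> Im \<tau> > 0 \<Longrightarrow> Im (moebius A \<tau>) > 0"
  by (simp add: Im_moebius automorphy_nonzero)

definition lattice_act :: "int^2^2 \<Rightarrow> int \<times> int \<Rightarrow> int \<times> int" where
  "lattice_act A x = (fst x * A $ 0 $ 0 + snd x * A $ 1 $ 0, fst x * A $ 0 $ 1 + snd x * A $ 1 $ 1)"

lemma lattice_act_mult: "lattice_act B (lattice_act A x) = lattice_act (A ** B) x"
  by (simp add: lattice_act_def matrix_mult_2_nth algebra_simps)

lemma lattice_act_mat_1: "lattice_act (mat 1) x = x"
  by (simp add: lattice_act_def mat_def)

lemma bij_betw_lattice_act: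
  assumes "det A = 1"
  shows "bij_betw (lattice_act A) int_lattice int_lattice"
proof (rule bij_betw_byWitness[of _ "lattice_act (adjugate_2 A)"])
  have inverse: "lattice_act (adjugate_2 A) (lattice_act A x) = x"
    "lattice_act A (lattice_act (adjugate_2 A) x) = x" for x
    by (simp_all add: lattice_act_mult lattice_act_mat_1 adjugate_2_mult[OF assms])
  have maps: "lattice_act C ` int_lattice \<subseteq> int_lattice"
    if "\<And>x. lattice_act B (lattice_act C x) = x" for B C
  proof (intro image_subsetI)
    fix x assume "x \<in> int_lattice"
    thus "lattice_act C x \<in> int_lattice" using that[of x] by (auto simp: lattice_act_def)
  qed
  show "lattice_act A ` int_lattice \<subseteq> int_lattice"
      "lattice_act (adjugate_2 A) ` int_lattice \<subseteq> int_lattice"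
    by (rule maps[OF inverse(1)], rule maps[OF inverse(2)])
qed (simp_all add: lattice_act_mult lattice_act_mat_1 adjugate_2_mult[OF assms])

lemma lattice_point_moebius:
  assumes "automorphy A \<tau> \<noteq> 0"
  shows "lattice_point (moebius A \<tau>) x = lattice_point \<tau> (lattice_act A x) / automorphy A \<tau>"
  using assms by (simp add: lattice_point_def lattice_act_def moebius_def automorphy_def field_simps)

lemma lattice_sum_moebius:
  fixes F :: "complex \<Rightarrow> 'a :: {banach, real_normed_field}"
  assumes det_Im: "det A = 1" "Im \<tau> > 0" and F_homogeneous: "\<And>w. F (w / automorphy A \<tau>) = c * F w"
  shows "lattice_sum F (moebius A \<tau>) = c * lattice_sum F \<tau>"
proof -
  have "lattice_sum F (moebius A \<tau>) = (\<Sum>\<^sub>\<infinity>x\<in>int_lattice. c * F (lattice_point \<tau> (lattice_act A x)))"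
    by (simp add: lattice_sum_def lattice_point_moebius[OF automorphy_nonzero[OF det_Im]] F_homogeneous)
  also have "\<dots> = c * (\<Sum>\<^sub>\<infinity>x\<in>int_lattice. F (lattice_point \<tau> (lattice_act A x)))"
    by (rule infsum_cmult_right')
  also have "(\<Sum>\<^sub>\<infinity>x\<in>int_lattice. F (lattice_point \<tau> (lattice_act A x))) = lattice_sum F \<tau>"
    unfolding lattice_sum_def by (rule infsum_reindex_bij_betw[OF bij_betw_lattice_act[OF det_Im(1)]])
  finally show ?thesis .
qed

lemma eisenstein_moebius:
  assumes "det A = 1" "Im \<tau> > 0"
  shows "eisenstein (moebius A \<tau>) = cmod (automorphy A \<tau>) ^ 3 * eisenstein \<tau>"
  unfolding eisenstein_eq_lattice_sum
  by (rule lattice_sum_moebius[OF assms]) (simp add: norm_divide power_divide)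

lemma twisted_eisenstein_moebius:
  fixes A :: "int^2^2" and \<tau> :: complex
  assumes "det A = 1" "Im \<tau> > 0"
  defines "j \<equiv> automorphy A \<tau>"
  shows "twisted_eisenstein (moebius A \<tau>) = of_real (cmod j) ^ 3 * (cnj j / j) * twisted_eisenstein \<tau>"
  unfolding twisted_eisenstein_def
proof (rule lattice_sum_moebius[OF assms(1,2)])
  fix w
  have j_nonzero: "j \<noteq> 0" unfolding j_def by (rule automorphy_nonzero[OF assms(1,2)])
  have "of_real (cmod j) ^ 5 = of_real (cmod j) ^ 3 * (j * cnj j)"
    unfolding complex_norm_square[symmetric] by (simp flip: power_add)
  hence "(w / j)\<^sup>2 / of_real (cmod (w / j)) ^ 5 =
      of_real (cmod j) ^ 3 * (cnj j / j) * (w\<^sup>2 / of_real (cmod w) ^ 5)"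
    using j_nonzero by (cases "w = 0") (simp_all add: norm_divide power_divide power2_eq_square
        field_simps)
  thus "(w / automorphy A \<tau>)\<^sup>2 / of_real (cmod (w / automorphy A \<tau>)) ^ 5 =
      of_real (cmod j) ^ 3 * (cnj j / j) * (w\<^sup>2 / of_real (cmod w) ^ 5)"
    by (simp only: j_def)
qed

lemma has_derivative_suminf_dominated:
  fixes f :: "nat \<Rightarrow> 'a :: real_normed_vector \<Rightarrow> 'b :: banach"
  assumes S_open_convex: "open S" "convex S" "x \<in> S"
    and deriv: "\<And>i y. y \<in> S \<Longrightarrow> (f i has_derivative f' i y) (at y)"
    and bound: "\<And>i y h. y \<in> S \<Longrightarrow> norm (f' i y h) \<le> M i * norm h" and M_summable: "summable M"
    and sums: "\<And>y. y \<in> S \<Longrightarrow> (\<lambda>i. f i y) sums F y"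
  shows "(F has_derivative (\<lambda>h. \<Sum>i. f' i x h)) (at x)"
proof -
  have f'_summable: "summable (\<lambda>i. f' i y h)" if "y \<in> S" for y h
    by (rule summable_comparison_test'[OF summable_mult2[OF M_summable, of "norm h"]])
      (use bound[OF that] in auto)
  have "\<exists>G. \<forall>y\<in>S. (\<lambda>i. f i y) sums G y \<and> (G has_derivative (\<lambda>h. \<Sum>i. f' i y h)) (at y within S)"
  proof (rule has_derivative_series[OF S_open_convex(2) has_derivative_at_withinI[OF deriv] _
      S_open_convex(3) sums[OF S_open_convex(3)]])
    fix \<epsilon> :: real assume "\<epsilon> > 0"
    from suminf_exist_split[OF this M_summable] obtain N
      where tail_less: "\<And>n. n \<ge> N \<Longrightarrow> norm (\<Sum>i. M (i + n)) < \<epsilon>" by auto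
    have "norm ((\<Sum>i<n. f' i y h) - (\<Sum>i. f' i y h)) \<le> \<epsilon> * norm h" if "n \<ge> N" "y \<in> S" for n y h
    proof -
      have tail: "summable (\<lambda>i. M (i + n))" by (intro summable_ignore_initial_segment M_summable)
      have "(\<Sum>i. f' i y h) = (\<Sum>i. f' (i + n) y h) + (\<Sum>i<n. f' i y h)"
        by (rule suminf_split_initial_segment[OF f'_summable[OF that(2)]])
      hence "norm ((\<Sum>i<n. f' i y h) - (\<Sum>i. f' i y h)) = norm (\<Sum>i. f' (i + n) y h)" by simp
      also have "\<dots> \<le> (\<Sum>i. M (i + n) * norm h)"
        by (rule norm_suminf_le[OF bound[OF that(2)] summable_mult2[OF tail]])
      also have "\<dots> = (\<Sum>i. M (i + n)) * norm h" by (rule suminf_mult2[symmetric, OF tail])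
      also have "\<dots> \<le> \<epsilon> * norm h" using tail_less[OF that(1)] by (intro mult_right_mono) auto
      finally show ?thesis .
    qed
    thus "\<forall>\<^sub>F n in sequentially. \<forall>y\<in>S. \<forall>h. norm ((\<Sum>i<n. f' i y h) - (\<Sum>i. f' i y h)) \<le> \<epsilon> * norm h"
      unfolding eventually_sequentially by blast
  qed
  then obtain G where G_sums: "\<And>y. y \<in> S \<Longrightarrow> (\<lambda>i. f i y) sums G y"
    "(G has_derivative (\<lambda>h. \<Sum>i. f' i x h)) (at x within S)" using S_open_convex(3) by blast
  hence "(G has_derivative (\<lambda>h. \<Sum>i. f' i x h)) (at x)" using at_within_open[OF S_open_convex(3,1)]
    by simp
  thus ?thesis
    by (rule has_derivative_transform_within_open[OF _ S_open_convex(1,3)])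
      (rule sums_unique2[OF G_sums(1) sums])
qed

lemma has_derivative_infsum_dominated:
  fixes f :: "'i \<Rightarrow> 'a :: real_normed_vector \<Rightarrow> 'b :: banach"
  assumes countable_infinite: "countable A" "infinite A" and S_open_convex: "open S" "convex S" "x \<in> S"
    and deriv: "\<And>i y. i \<in> A \<Longrightarrow> y \<in> S \<Longrightarrow> (f i has_derivative f' i y) (at y)"
    and bound: "\<And>i y h. i \<in> A \<Longrightarrow> y \<in> S \<Longrightarrow> norm (f' i y h) \<le> M i * norm h"
    and M_summable: "M summable_on A" and has_sum: "\<And>y. y \<in> S \<Longrightarrow> ((\<lambda>i. f i y) has_sum F y) A"
    and has_sum': "\<And>h. ((\<lambda>i. f' i x h) has_sum F' h) A"
  shows "(F has_derivative F') (at x)"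
proof -
  define e where "e = from_nat_into A"
  have bij_e: "bij_betw e UNIV A" unfolding e_def
    by (rule bij_betw_from_nat_into[OF countable_infinite])
  have mem: "e n \<in> A" for n using bij_e by (auto simp: bij_betw_def)
  have sums: "(\<lambda>n. g (e n)) sums c" if "(g has_sum c) A" for g :: "'i \<Rightarrow> 'b" and c
    using that has_sum_reindex_bij_betw[OF bij_e, of g c] by (simp add: has_sum_imp_sums)
  have "(\<lambda>n. M (e n)) summable_on UNIV"
    using M_summable summable_on_reindex_bij_betw[OF bij_e, of M] by simp
  hence "(F has_derivative (\<lambda>h. \<Sum>n. f' (e n) x h)) (at x)"
    using S_open_convex deriv[OF mem] bound[OF mem] sums[OF has_sum]
    by (intro has_derivative_suminf_dominated[where f = "\<lambda>n. f (e n)" and M = "\<lambda>n. M (e n)"])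
      (auto intro: summable_on_imp_summable)
  moreover have "(\<lambda>h. \<Sum>n. f' (e n) x h) = F'"
    using sums_unique[OF sums[OF has_sum']] by auto
  ultimately show ?thesis by simp
qed

lemma has_derivative_inverse_cube_lattice_point:
  assumes "lattice_point \<tau> x \<noteq> 0"
  shows "((\<lambda>\<tau>. 1 / cmod (lattice_point \<tau> x) ^ 3) has_derivative
    (\<lambda>h. - 3 * real_of_int (fst x) * Re (cnj (lattice_point \<tau> x) * h) /
      cmod (lattice_point \<tau> x) ^ 5)) (at \<tau>)"
proof -
  define w where "w = lattice_point \<tau> x"
  have w_nonzero: "w \<noteq> 0" using assms by (simp add: w_def)
  have "((\<lambda>\<tau>. lattice_point \<tau> x) has_derivative (\<lambda>h. of_int (fst x) * h)) (at \<tau>)"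
    unfolding lattice_point_def by (auto intro!: derivative_eq_intros)
  from has_derivative_compose[OF this has_derivative_norm[OF assms]]
  have norm_deriv: "((\<lambda>\<tau>. cmod (lattice_point \<tau> x)) has_derivative
      (\<lambda>h. inner (of_int (fst x) * h) (sgn w))) (at \<tau>)"
    by (simp add: w_def)
  have "((\<lambda>\<tau>. 1 / cmod (lattice_point \<tau> x) ^ 3) has_derivative
      (\<lambda>h. - (3 * (inner (of_int (fst x) * h) (sgn w) * cmod w ^ 2)) / (cmod w ^ 3 * cmod w ^ 3)))
      (at \<tau>)"
    using w_nonzero by (auto intro!: derivative_eq_intros norm_deriv simp: w_def fun_eq_iff)
  moreover have "inner (of_int (fst x) * h) (sgn w) = real_of_int (fst x) * Re (cnj w * h) / cmod w"
    for h
    by (simp add: sgn_div_norm inner_complex_def add_divide_distrib field_simps)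
  hence "- (3 * (inner (of_int (fst x) * h) (sgn w) * cmod w ^ 2)) / (cmod w ^ 3 * cmod w ^ 3) =
      - 3 * real_of_int (fst x) * Re (cnj w * h) / cmod w ^ 5" for h
    using w_nonzero by (simp add: field_simps eval_nat_numeral)
  ultimately show ?thesis unfolding w_def by simp
qed

lemma inverse_cube_lattice_point_derivative_le:
  assumes \<epsilon>_le_Im: "\<epsilon> > 0" "Im \<tau> \<ge> \<epsilon>" and x_lattice: "x \<in> int_lattice"
  shows "\<bar>- 3 * real_of_int (fst x) * Re (cnj (lattice_point \<tau> x) * h) / cmod (lattice_point \<tau> x) ^ 5\<bar> \<le>
    3 / \<epsilon> * (1 / cmod (lattice_point \<tau> x) ^ 3) * norm h"
proof -
  define w where "w = lattice_point \<tau> x"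
  have w_pos: "cmod w > 0" using lattice_point_nonzero[of \<tau> x] assms by (simp add: w_def)
  have "\<bar>real_of_int (fst x)\<bar> * \<epsilon> \<le> \<bar>real_of_int (fst x)\<bar> * Im \<tau>" using \<epsilon>_le_Im
    by (intro mult_left_mono) auto
  also have "\<dots> = \<bar>Im w\<bar>" using \<epsilon>_le_Im by (simp add: w_def lattice_point_def abs_mult)
  also have "\<dots> \<le> cmod w" by (rule abs_Im_le_cmod)
  finally have fst_x: "\<bar>real_of_int (fst x)\<bar> \<le> cmod w / \<epsilon>" using \<epsilon>_le_Im by (simp add: field_simps)
  have "\<bar>- 3 * real_of_int (fst x) * Re (cnj w * h) / cmod w ^ 5\<bar> =
      3 * (\<bar>real_of_int (fst x)\<bar> * \<bar>Re (cnj w * h)\<bar>) / cmod w ^ 5"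
    by (simp add: abs_mult)
  also have "\<dots> \<le> 3 * (cmod w / \<epsilon> * (cmod w * norm h)) / cmod w ^ 5"
    using abs_Re_le_cmod[of "cnj w * h"] fst_x \<epsilon>_le_Im
    by (intro divide_right_mono mult_left_mono mult_mono) (auto simp: norm_mult)
  also have "\<dots> = 3 / \<epsilon> * (1 / cmod w ^ 3) * norm h"
    using w_pos \<epsilon>_le_Im by (simp add: field_simps eval_nat_numeral)
  finally show ?thesis by (simp only: w_def)
qed

lemma inverse_cube_lattice_point_derivative_eq:
  fixes \<tau> h :: complex and x :: "int \<times> int"
  assumes Im_pos: "Im \<tau> > 0"
  defines "w \<equiv> lattice_point \<tau> x"
  shows "- 3 * real_of_int (fst x) * Re (cnj w * h) / cmod w ^ 5 =
    - (3 / (2 * Im \<tau>)) * (1 / cmod w ^ 3 * Im h - Im (cnj (w\<^sup>2 / of_real (cmod w) ^ 5) * h))"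
proof -
  have fst_x: "real_of_int (fst x) = Im w / Im \<tau>" using Im_pos by (simp add: w_def lattice_point_def)
  have "1 / cmod w ^ 3 * Im h - Im (cnj (w\<^sup>2 / of_real (cmod w) ^ 5) * h) =
      (((Re w)\<^sup>2 + (Im w)\<^sup>2) * Im h - ((Re w)\<^sup>2 - (Im w)\<^sup>2) * Im h + 2 * (Re w * Im w) * Re h) /
      cmod w ^ 5"
    unfolding inverse_cube_eq_sum_over_fifth times_complex.sel cnj.sel Re_Im_square_over_fifth
    by (simp add: add_divide_distrib diff_divide_distrib left_diff_distrib distrib_right)
  also have "\<dots> = 2 * (Im w * Re (cnj w * h)) / cmod w ^ 5"
    by (simp add: algebra_simps power2_eq_square)
  finally show ?thesis unfolding fst_x using Im_pos by simp
qed

lemma ball_half_Im: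
  assumes "z \<in> ball \<tau> (Im \<tau> / 2)"
  shows "Im z \<ge> Im \<tau> / 2" "cmod z \<le> cmod \<tau> + Im \<tau> / 2"
proof -
  have "cmod (z - \<tau>) < Im \<tau> / 2" using assms by (simp add: dist_norm norm_minus_commute)
  thus "Im z \<ge> Im \<tau> / 2" "cmod z \<le> cmod \<tau> + Im \<tau> / 2"
    using abs_Im_le_cmod[of "z - \<tau>"] norm_triangle_sub[of z \<tau>] by simp_all
qed

lemma inverse_cube_lattice_point_derivative_has_sum:
  assumes Im_pos: "Im \<tau> > 0"
  shows "((\<lambda>x. - 3 * real_of_int (fst x) * Re (cnj (lattice_point \<tau> x) * h) /
      cmod (lattice_point \<tau> x) ^ 5) has_sum
    - (3 / (2 * Im \<tau>)) * (eisenstein \<tau> * Im h - Im (cnj (twisted_eisenstein \<tau>) * h))) int_lattice"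
proof -
  have "((\<lambda>x. - Im (cnj ((lattice_point \<tau> x)\<^sup>2 / of_real (cmod (lattice_point \<tau> x)) ^ 5) * h)) has_sum
      - Im (cnj (twisted_eisenstein \<tau>) * h)) int_lattice"
    unfolding has_sum_uminus minus_minus
    by (intro has_sum_Im has_sum_cmult_left has_sum_cnj_iff[THEN iffD2] twisted_eisenstein_has_sum
        Im_pos)
  thus ?thesis
    unfolding inverse_cube_lattice_point_derivative_eq[OF Im_pos] diff_conv_add_uminus
    by (intro has_sum_cmult_right has_sum_add has_sum_cmult_left eisenstein_has_sum Im_pos)
qed

theorem eisenstein_has_derivative:
  fixes \<tau> :: complex
  assumes Im_pos: "Im \<tau> > 0"
  shows "(eisenstein has_derivative
    (\<lambda>h. - (3 / (2 * Im \<tau>)) * (eisenstein \<tau> * Im h - Im (cnj (twisted_eisenstein \<tau>) * h)))) (at \<tau>)"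
proof -
  define \<epsilon> where "\<epsilon> = Im \<tau> / 2"
  have \<epsilon>_pos: "\<epsilon> > 0" using Im_pos by (simp add: \<epsilon>_def)
  note ball = ball_half_Im[of _ \<tau>, folded \<epsilon>_def]
  let ?M = "\<lambda>x. 3 / \<epsilon> *
      (lattice_const \<epsilon> (cmod \<tau> + \<epsilon>) *
        (1 / (1 + \<bar>real_of_int (fst x)\<bar> + \<bar>real_of_int (snd x)\<bar>) ^ 3))"
  show ?thesis
  proof (rule has_derivative_infsum_dominated[where A = int_lattice and S = "ball \<tau> \<epsilon>" and M = ?M])
    show "infinite int_lattice" by (simp add: finite_prod infinite_UNIV_int)
    show "((\<lambda>z. 1 / cmod (lattice_point z x) ^ 3) has_derivative
        (\<lambda>h. - 3 * real_of_int (fst x) * Re (cnj (lattice_point z x) * h) /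
          cmod (lattice_point z x) ^ 5)) (at z)"
      if "x \<in> int_lattice" "z \<in> ball \<tau> \<epsilon>" for x z
      using that ball(1)[OF that(2)] \<epsilon>_pos
      by (intro has_derivative_inverse_cube_lattice_point lattice_point_nonzero) auto
    show "norm (- 3 * real_of_int (fst x) * Re (cnj (lattice_point z x) * h) /
        cmod (lattice_point z x) ^ 5) \<le>
        ?M x * norm h" if "x \<in> int_lattice" "z \<in> ball \<tau> \<epsilon>" for x z h
    proof -
      have "3 / \<epsilon> * (1 / cmod (lattice_point z x) ^ 3) \<le> ?M x"
        using \<epsilon>_pos by (intro mult_left_mono inverse_cube_lattice_point_le ball that) auto
      from order_trans[OF inverse_cube_lattice_point_derivative_le[OF \<epsilon>_pos ball(1)[OF that(2)] that(1)]
          mult_right_mono[OF this norm_ge_zero]]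
      show ?thesis unfolding real_norm_def .
    qed
    show "?M summable_on int_lattice"
      using summable_on_subset_banach[OF summable_on_inverse_cube_lattice, of int_lattice]
      by (intro summable_on_cmult_right) auto
    show "((\<lambda>x. 1 / cmod (lattice_point z x) ^ 3) has_sum eisenstein z) int_lattice"
      if "z \<in> ball \<tau> \<epsilon>" for z
      using ball(1)[OF that] \<epsilon>_pos by (intro eisenstein_has_sum) auto
  qed (use \<epsilon>_pos inverse_cube_lattice_point_derivative_has_sum[OF Im_pos] in auto)
qed

section \<open>Instanton sums\<close>

definition instanton_mode :: "real \<Rightarrow> complex \<Rightarrow> int \<Rightarrow> nat \<Rightarrow> complex" where
  "instanton_mode \<nu> \<tau> q k = exp (- 2 * of_real pi * \<i> * of_nat k * of_int q * of_real (Re \<tau>)) *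
     of_real (bessel_K \<nu> (2 * pi * real k * (\<bar>real_of_int q\<bar> * Im \<tau>)))"

lemma instanton_mode_eq:
  "instanton_mode \<nu> \<tau> q k =
     cis (- (2 * pi * real_of_int q * (real k * Re \<tau>))) *
     of_real (bessel_K \<nu> (2 * pi * \<bar>real_of_int q\<bar> * (real k * Im \<tau>)))"
proof -
  have "- 2 * of_real pi * \<i> * of_nat k * of_int q * of_real (Re \<tau>) =
      \<i> * of_real (- (2 * pi * real_of_int q * (real k * Re \<tau>)))"
    by simp
  thus ?thesis unfolding instanton_mode_def cis_conv_exp by (simp only: mult_ac)
qed

lemma norm_instanton_mode_le:
  assumes Im_pos: "Im \<tau> > 0" and q_k: "q \<noteq> 0" "k \<ge> 1"
  shows "norm (instanton_mode \<nu> \<tau> q k) \<le> exp (4 * pi * Im \<tau>) * bessel_K \<nu> (2 * pi * Im \<tau>) *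
    (exp (- (2 * pi * Im \<tau>) * \<bar>real_of_int q\<bar>) * exp (- (2 * pi * Im \<tau>) * real k))"
proof -
  define b where "b = 2 * pi * Im \<tau>"
  have b_pos: "b > 0" using Im_pos by (simp add: b_def)
  have ge_1: "\<bar>real_of_int q\<bar> \<ge> 1" "real k \<ge> 1" using q_k by linarith+
  have "0 \<le> (real k - 1) * (\<bar>real_of_int q\<bar> - 1)" using ge_1 by (intro mult_nonneg_nonneg) auto
  hence product_ge: "\<bar>real_of_int q\<bar> + real k - 1 \<le> \<bar>real_of_int q\<bar> * real k"
    by (simp add: algebra_simps)
  have arg: "2 * pi * \<bar>real_of_int q\<bar> * (real k * Im \<tau>) = b * (\<bar>real_of_int q\<bar> * real k)"
    by (simp add: b_def mult_ac)
  have arg_ge: "b \<le> b * (\<bar>real_of_int q\<bar> * real k)"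
    using product_ge ge_1 b_pos by simp
  hence "bessel_K \<nu> (b * (\<bar>real_of_int q\<bar> * real k)) \<ge> 0"
    using b_pos by (intro bessel_K_nonneg) simp
  hence "norm (instanton_mode \<nu> \<tau> q k) = bessel_K \<nu> (b * (\<bar>real_of_int q\<bar> * real k))"
    unfolding instanton_mode_eq arg norm_mult by (simp del: of_real_mult)
  also have "\<dots> \<le> exp b * bessel_K \<nu> b * exp (- (b * (\<bar>real_of_int q\<bar> * real k)))"
    by (rule bessel_K_decay[OF b_pos arg_ge])
  also have "\<dots> \<le> exp b * bessel_K \<nu> b * exp (b + (- b * \<bar>real_of_int q\<bar> + - b * real k))"
    using b_pos product_ge bessel_K_nonneg[OF b_pos] mult_left_mono[OF product_ge, of b]
    by (intro mult_left_mono) (auto simp: algebra_simps)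
  also have "\<dots> = exp (b + b) * bessel_K \<nu> b * (exp (- b * \<bar>real_of_int q\<bar>) * exp (- b * real k))"
    by (simp only: exp_add mult_ac)
  finally show ?thesis by (simp add: b_def mult.assoc)
qed

lemma range_Suc: "range Suc = {1..}"
  by (auto simp: image_iff Suc_le_eq gr0_conv_Suc)

lemma abs_summable_instanton_modes:
  fixes a :: "int \<Rightarrow> complex" and c :: "nat \<Rightarrow> complex"
  assumes Im_pos: "Im \<tau> > 0" and a_bound: "\<And>q. norm (a q) \<le> \<bar>real_of_int q\<bar> ^ p"
    and c_bound: "\<And>k. k \<ge> 1 \<Longrightarrow> norm (c k) \<le> M"
  shows "(\<lambda>x. norm (c (snd x) * a (fst x) * instanton_mode \<nu> \<tau> (fst x) (snd x))) summable_on
      (UNIV - {0}) \<times> {1..}"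
proof -
  define b C where "b = 2 * pi * Im \<tau>" and "C = exp (4 * pi * Im \<tau>) * bessel_K \<nu> (2 * pi * Im \<tau>)"
  have b_pos: "b > 0" and C_nonneg: "C \<ge> 0" using Im_pos by (simp_all add: b_def C_def bessel_K_nonneg)
  have M_nonneg: "M \<ge> 0" using order_trans[OF norm_ge_zero c_bound[of 1]] by simp
  have "(\<lambda>n. real (Suc n) ^ p * exp (- b * real (Suc n))) summable_on UNIV"
    using summable_power_mult_exp[OF b_pos] by (intro summable_nonneg_imp_summable_on) auto
  hence q_summable: "(\<lambda>q. \<bar>real_of_int q\<bar> ^ p * exp (- b * \<bar>real_of_int q\<bar>)) summable_on UNIV - {0}"
    unfolding nonzero_int_eq_Un_ranges
    by (intro summable_on_Un_ranges) (auto simp: inj_on_def add.commute)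
  have "(\<lambda>n. real (Suc n) ^ 0 * exp (- b * real (Suc n))) summable_on UNIV"
    using summable_power_mult_exp[OF b_pos, of 0] by (intro summable_nonneg_imp_summable_on) auto
  hence k_summable: "(\<lambda>k. exp (- b * real k)) summable_on {1..}"
    unfolding range_Suc[symmetric] by (subst summable_on_reindex) (auto simp: o_def)
  have "(\<lambda>x. M * C * ((\<bar>real_of_int (fst x)\<bar> ^ p * exp (- b * \<bar>real_of_int (fst x)\<bar>)) *
      exp (- b * real (snd x))))
      summable_on (UNIV - {0}) \<times> {1..}"
    by (intro summable_on_cmult_right summable_on_product_nonneg[OF q_summable _ k_summable]) auto
  thus ?thesis
  proof (rule Infinite_Sum.abs_summable_on_comparison_test')
    fix x :: "int \<times> nat" assume "x \<in> (UNIV - {0}) \<times> {1..}"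
    hence x_nonzero: "fst x \<noteq> 0" "snd x \<ge> 1" by (auto simp: mem_Times_iff)
    have "norm (c (snd x) * a (fst x) * instanton_mode \<nu> \<tau> (fst x) (snd x)) \<le>
        M * \<bar>real_of_int (fst x)\<bar> ^ p *
        (C * (exp (- b * \<bar>real_of_int (fst x)\<bar>) * exp (- b * real (snd x))))"
      unfolding norm_mult C_def b_def
      by (intro mult_mono norm_instanton_mode_le Im_pos x_nonzero a_bound c_bound)
        (use M_nonneg in auto)
    thus "norm (c (snd x) * a (fst x) * instanton_mode \<nu> \<tau> (fst x) (snd x)) \<le>
        M * C * ((\<bar>real_of_int (fst x)\<bar> ^ p * exp (- b * \<bar>real_of_int (fst x)\<bar>)) *
          exp (- b * real (snd x)))"
      by (simp add: mult_ac)
  qed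
qed

lemma sums_infsum_instanton_modes:
  fixes a :: "int \<Rightarrow> complex" and c :: "nat \<Rightarrow> complex"
  assumes "Im \<tau> > 0" "\<And>q. norm (a q) \<le> \<bar>real_of_int q\<bar> ^ p" "\<And>k. k \<ge> 1 \<Longrightarrow> norm (c k) \<le> M"
  shows "(\<lambda>k. c (Suc k) * (\<Sum>\<^sub>\<infinity>q\<in>UNIV - {0}. a q * instanton_mode \<nu> \<tau> q (Suc k))) sums
    (\<Sum>\<^sub>\<infinity>q\<in>UNIV - {0}. \<Sum>\<^sub>\<infinity>k\<in>{1..}. c k * a q * instanton_mode \<nu> \<tau> q k)"
proof -
  let ?f = "\<lambda>q k. c k * a q * instanton_mode \<nu> \<tau> q k"
  have summable: "(\<lambda>(q, k). ?f q k) summable_on (UNIV - {0}) \<times> {1..}"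
    using abs_summable_summable[OF abs_summable_instanton_modes[OF assms]]
    by (simp add: case_prod_unfold)
  hence "(\<lambda>(k, q). ?f q k) summable_on {1..} \<times> (UNIV - {0})"
    by (subst summable_on_swap) (simp add: case_prod_unfold)
  hence "(\<lambda>k. \<Sum>\<^sub>\<infinity>q\<in>UNIV - {0}. ?f q k) summable_on {1..}"
    using summable_on_Sigma_banach[of "\<lambda>k q. ?f q k"] by simp
  hence "((\<lambda>k. \<Sum>\<^sub>\<infinity>q\<in>UNIV - {0}. ?f q k) has_sum (\<Sum>\<^sub>\<infinity>k\<in>{1..}. \<Sum>\<^sub>\<infinity>q\<in>UNIV - {0}. ?f q k)) (range Suc)"
    unfolding range_Suc by (rule has_sum_infsum)
  hence "(\<lambda>k. \<Sum>\<^sub>\<infinity>q\<in>UNIV - {0}. ?f q (Suc k)) sums (\<Sum>\<^sub>\<infinity>k\<in>{1..}. \<Sum>\<^sub>\<infinity>q\<in>UNIV - {0}. ?f q k)"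
    by (subst (asm) has_sum_reindex) (auto simp: o_def intro: has_sum_imp_sums)
  thus ?thesis unfolding infsum_swap_banach[OF summable] by (simp only: infsum_cmult_right' mult.assoc)
qed

lemma sums_nonzero_instanton_modes:
  fixes a :: "int \<Rightarrow> complex"
  assumes "Im \<tau> > 0" "\<And>q. norm (a q) \<le> \<bar>real_of_int q\<bar> ^ p" "k \<ge> 1"
  shows "(\<lambda>n. a (int (Suc n)) * instanton_mode \<nu> \<tau> (int (Suc n)) k +
      a (- int (Suc n)) * instanton_mode \<nu> \<tau> (- int (Suc n)) k) sums
    (\<Sum>\<^sub>\<infinity>q\<in>UNIV - {0}. a q * instanton_mode \<nu> \<tau> q k)"
proof -
  have "(\<lambda>(q, k). a q * instanton_mode \<nu> \<tau> q k) summable_on (UNIV - {0}) \<times> {1..}"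
    using abs_summable_summable[OF abs_summable_instanton_modes[OF assms(1,2),
        where c = "\<lambda>_. 1" and M = 1]]
    by (simp add: case_prod_unfold)
  hence "(\<lambda>(k, q). a q * instanton_mode \<nu> \<tau> q k) summable_on {1..} \<times> (UNIV - {0})"
    by (subst summable_on_swap) (simp add: case_prod_unfold)
  hence "(\<lambda>q. a q * instanton_mode \<nu> \<tau> q k) summable_on UNIV - {0}"
    using assms(3) by (intro summable_on_SigmaD1[where f = "\<lambda>k q. a q * instanton_mode \<nu> \<tau> q k"]) auto
  thus ?thesis unfolding nonzero_int_eq_Un_ranges
    by (intro sums_infsum_Un_ranges) (auto simp: inj_on_def)
qed

lemma infsum_abs_power_instanton_mode:
  assumes "Im \<tau> > 0" "k \<ge> 1"
  shows "(\<Sum>\<^sub>\<infinity>q\<in>UNIV - {0}. of_real (\<bar>real_of_int q\<bar> ^ p) * instanton_mode \<nu> \<tau> q k) =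
    of_real (2 * bessel_cos_series p \<nu> (real k * Re \<tau>) (real k * Im \<tau>))" (is "?S = _")
proof -
  define f where "f n = real (Suc n) ^ p * cos (2 * pi * real (Suc n) * (real k * Re \<tau>)) *
    bessel_K \<nu> (2 * pi * real (Suc n) * (real k * Im \<tau>))" for n
  have "(\<lambda>n. of_real (\<bar>real_of_int (int (Suc n))\<bar> ^ p) * instanton_mode \<nu> \<tau> (int (Suc n)) k +
      of_real (\<bar>real_of_int (- int (Suc n))\<bar> ^ p) * instanton_mode \<nu> \<tau> (- int (Suc n)) k) sums ?S"
    by (rule sums_nonzero_instanton_modes[OF assms(1) _ assms(2), where p = p]) (simp add: norm_power)
  moreover have "of_real (\<bar>real_of_int (int (Suc n))\<bar> ^ p) * instanton_mode \<nu> \<tau> (int (Suc n)) k +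
      of_real (\<bar>real_of_int (- int (Suc n))\<bar> ^ p) * instanton_mode \<nu> \<tau> (- int (Suc n)) k =
      complex_of_real (2 * f n)" for n
    unfolding instanton_mode_eq f_def by (simp add: complex_eq_iff del: of_nat_Suc of_real_power)
  ultimately have pairs: "(\<lambda>n. complex_of_real (2 * f n)) sums ?S"
    by (simp only:)
  from sums_mult[OF sums_Re[OF this], of "1 / 2"]
  have "Re ?S / 2 = bessel_cos_series p \<nu> (real k * Re \<tau>) (real k * Im \<tau>)"
    by (simp add: bessel_cos_series_def f_def sums_iff del: of_nat_Suc)
  moreover have "Im ?S = 0" using sums_Im[OF pairs] by (simp add: sums_iff)
  ultimately show ?thesis by (simp add: complex_eq_iff)
qed

lemma infsum_sgn_power_instanton_mode:
  assumes "Im \<tau> > 0" "k \<ge> 1"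
  shows "(\<Sum>\<^sub>\<infinity>q\<in>UNIV - {0}. of_real (sgn (real_of_int q) * \<bar>real_of_int q\<bar> ^ p) *
      instanton_mode \<nu> \<tau> q k) =
    - \<i> * of_real (2 * bessel_sin_series p \<nu> (real k * Re \<tau>) (real k * Im \<tau>))" (is "?S = _")
proof -
  define f where "f n = real (Suc n) ^ p * sin (2 * pi * real (Suc n) * (real k * Re \<tau>)) *
    bessel_K \<nu> (2 * pi * real (Suc n) * (real k * Im \<tau>))" for n
  have "(\<lambda>n. of_real (sgn (real_of_int (int (Suc n))) * \<bar>real_of_int (int (Suc n))\<bar> ^ p) *
      instanton_mode \<nu> \<tau> (int (Suc n)) k +
      of_real (sgn (real_of_int (- int (Suc n))) * \<bar>real_of_int (- int (Suc n))\<bar> ^ p) *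
      instanton_mode \<nu> \<tau> (- int (Suc n)) k) sums ?S"
    by (rule sums_nonzero_instanton_modes[OF assms(1) _ assms(2), where p = p])
      (simp add: norm_power norm_mult abs_mult sgn_if)
  moreover have "of_real (sgn (real_of_int (int (Suc n))) * \<bar>real_of_int (int (Suc n))\<bar> ^ p) *
        instanton_mode \<nu> \<tau> (int (Suc n)) k +
      of_real (sgn (real_of_int (- int (Suc n))) * \<bar>real_of_int (- int (Suc n))\<bar> ^ p) *
        instanton_mode \<nu> \<tau> (- int (Suc n)) k =
      - \<i> * complex_of_real (2 * f n)" for n
    unfolding instanton_mode_eq f_def
    by (simp add: complex_eq_iff sgn_if del: of_nat_Suc of_real_power)
  ultimately have pairs: "(\<lambda>n. - \<i> * complex_of_real (2 * f n)) sums ?S"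
    by (simp only:)
  from sums_mult[OF sums_Im[OF this], of "- (1 / 2)"]
  have "- Im ?S / 2 = bessel_sin_series p \<nu> (real k * Re \<tau>) (real k * Im \<tau>)"
    by (simp add: bessel_sin_series_def f_def sums_iff del: of_nat_Suc)
  moreover have "Re ?S = 0" using sums_Re[OF pairs] by (simp add: sums_iff)
  ultimately show ?thesis by (simp add: complex_eq_iff)
qed

lemma sums_instanton_cos:
  assumes Im_pos: "Im \<tau> > 0" and c_bound: "\<And>k. k \<ge> 1 \<Longrightarrow> norm (c k) \<le> M"
  shows "(\<lambda>k. c (Suc k) *
      of_real (2 * bessel_cos_series p \<nu> (real (Suc k) * Re \<tau>) (real (Suc k) * Im \<tau>))) sums
    (\<Sum>\<^sub>\<infinity>q\<in>UNIV - {0}. \<Sum>\<^sub>\<infinity>k\<in>{1..}. c k * of_real (\<bar>real_of_int q\<bar> ^ p) * instanton_mode \<nu> \<tau> q k)"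
proof -
  have "cmod (of_real (\<bar>real_of_int q\<bar> ^ p)) \<le> \<bar>real_of_int q\<bar> ^ p" for q
    by (simp add: norm_power)
  from sums_infsum_instanton_modes[OF Im_pos this c_bound] show ?thesis
    unfolding infsum_abs_power_instanton_mode[OF Im_pos le_add1[of 1, unfolded plus_1_eq_Suc]] .
qed

lemma sums_instanton_sin:
  assumes Im_pos: "Im \<tau> > 0" and c_bound: "\<And>k. k \<ge> 1 \<Longrightarrow> norm (c k) \<le> M"
  shows "(\<lambda>k. c (Suc k) *
      (- \<i> * of_real (2 * bessel_sin_series p \<nu> (real (Suc k) * Re \<tau>) (real (Suc k) * Im \<tau>)))) sums
    (\<Sum>\<^sub>\<infinity>q\<in>UNIV - {0}. \<Sum>\<^sub>\<infinity>k\<in>{1..}.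
      c k * of_real (sgn (real_of_int q) * \<bar>real_of_int q\<bar> ^ p) * instanton_mode \<nu> \<tau> q k)"
proof -
  have "cmod (of_real (sgn (real_of_int q) * \<bar>real_of_int q\<bar> ^ p)) \<le> \<bar>real_of_int q\<bar> ^ p" for q
    by (simp add: norm_mult norm_power sgn_if)
  from sums_infsum_instanton_modes[OF Im_pos this c_bound] show ?thesis
    unfolding infsum_sgn_power_instanton_mode[OF Im_pos le_add1[of 1, unfolded plus_1_eq_Suc]] .
qed

definition axiodilaton :: "nspace \<Rightarrow> complex" where
  "axiodilaton P = Complex (zeta_of P $ 0) (cmod (Z_of P $ 0))"

lemma instanton_mode_axiodilaton:
  "instanton_mode \<nu> (axiodilaton P) q k =
     exp (- 2 * of_real pi * \<i> * of_nat k * of_int q * of_real (zeta_of P $ 0)) *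
     of_real (bessel_K \<nu> (2 * pi * real k * cmod (of_int q * Z_of P $ 0)))"
  by (simp add: instanton_mode_def axiodilaton_def norm_mult)

context
  fixes P :: nspace
  assumes Z0_nonzero: "Z_of P $ 0 \<noteq> 0"
begin

lemma Im_axiodilaton_pos: "Im (axiodilaton P) > 0"
  using Z0_nonzero by (simp add: axiodilaton_def)

theorem inst_V_sum:
  "(\<Sum>\<^sub>\<infinity>q\<in>UNIV - {0}. (of_int q)\<^sup>2 * inst_V q P) = of_real (1 / (32 * pi ^ 3) *
     (4 * zeta3 - (eisenstein (axiodilaton P) + 3 * Re (twisted_eisenstein (axiodilaton P))) / 2))"
proof -
  define \<tau> where "\<tau> = axiodilaton P"
  have Im_pos: "Im \<tau> > 0" unfolding \<tau>_def by (rule Im_axiodilaton_pos)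
  let ?c = "complex_of_real (1 / (2 * pi))"
  let ?cos_series = "\<lambda>k. bessel_cos_series 2 0 (real (Suc k) * Re \<tau>) (real (Suc k) * Im \<tau>)"
  have mode_sum: "(of_int q)\<^sup>2 * inst_V q P =
      (\<Sum>\<^sub>\<infinity>k\<in>{1..}. ?c * of_real (\<bar>real_of_int q\<bar> ^ 2) * instanton_mode 0 \<tau> q k)" for q
    unfolding inst_V_def \<tau>_def instanton_mode_axiodilaton infsum_cmult_right' by simp
  have "(\<lambda>k. 1 / (2 * pi) * (2 * ?cos_series k)) sums
      (1 / (32 * pi ^ 3) * (4 * zeta3 - (eisenstein \<tau> + 3 * Re (twisted_eisenstein \<tau>)) / 2))"
    using sums_mult[OF Re_twisted_eisenstein_rows[OF Im_pos], of "1 / (32 * pi ^ 3)"]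
    by (simp add: power2_eq_square power3_eq_cube)
  from sums_of_real[OF this, where 'a = complex]
  have rows: "(\<lambda>k. ?c * of_real (2 * ?cos_series k)) sums
      of_real (1 / (32 * pi ^ 3) * (4 * zeta3 - (eisenstein \<tau> + 3 * Re (twisted_eisenstein \<tau>)) / 2))"
    by (simp only: of_real_mult)
  have "(\<lambda>k. ?c * of_real (2 * ?cos_series k)) sums (\<Sum>\<^sub>\<infinity>q\<in>UNIV - {0}. (of_int q)\<^sup>2 * inst_V q P)"
    unfolding mode_sum by (rule sums_instanton_cos[OF Im_pos order_refl])
  from sums_unique2[OF this rows] show ?thesis unfolding \<tau>_def .
qed

theorem inst_A_sum:
  "(\<Sum>\<^sub>\<infinity>q\<in>UNIV - {0}. of_int q * inst_A q P X) =
     \<i> * of_real (3 * Im (axiodilaton P) / (128 * pi ^ 3) * Im (twisted_eisenstein (axiodilaton P))) *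
     dlog_Z0 P X"
proof -
  define \<tau> where "\<tau> = axiodilaton P"
  have Im_pos: "Im \<tau> > 0" unfolding \<tau>_def by (rule Im_axiodilaton_pos)
  let ?c = "complex_of_real (- (Im \<tau> / (4 * pi)))"
  let ?sin_series = "\<lambda>k. bessel_sin_series 2 1 (real (Suc k) * Re \<tau>) (real (Suc k) * Im \<tau>)"
  let ?mode_sum = "\<lambda>q. \<Sum>\<^sub>\<infinity>k\<in>{1..}.
    ?c * of_real (sgn (real_of_int q) * \<bar>real_of_int q\<bar> ^ 2) * instanton_mode 1 \<tau> q k"
  have mode_sum: "of_int q * inst_A q P X = ?mode_sum q * dlog_Z0 P X" for q
  proof -
    have mode_norm: "exp w * complex_of_real (cmod (of_int q * Z_of P $ 0) * x) =
        of_real (\<bar>real_of_int q\<bar> * Im \<tau>) * (exp w * of_real x)" for w x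
      by (simp add: \<tau>_def axiodilaton_def norm_mult)
    have sgn_square: "complex_of_real (sgn (real_of_int q) * \<bar>real_of_int q\<bar> ^ 2) =
        of_int q * of_real \<bar>real_of_int q\<bar>"
      by (simp add: sgn_if power2_eq_square)
    show ?thesis
      unfolding inst_A_def mode_norm sgn_square infsum_cmult_right' \<tau>_def
        instanton_mode_axiodilaton[symmetric]
      by simp
  qed
  have "(\<lambda>k. Im \<tau> / (4 * pi) * (2 * ?sin_series k)) sums
      (3 * Im \<tau> / (128 * pi ^ 3) * Im (twisted_eisenstein \<tau>))"
    using sums_mult[OF Im_twisted_eisenstein_rows[OF Im_pos], of "3 * Im \<tau> / (64 * pi ^ 3)"]
    by (simp add: power2_eq_square power3_eq_cube mult_ac)
  from sums_mult[OF sums_of_real[OF this], of \<i>]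
  have rows: "(\<lambda>k. ?c * (- \<i> * of_real (2 * ?sin_series k))) sums
      (\<i> * of_real (3 * Im \<tau> / (128 * pi ^ 3) * Im (twisted_eisenstein \<tau>)))"
    by (simp add: mult_ac)
  have "(\<lambda>k. ?c * (- \<i> * of_real (2 * ?sin_series k))) sums (\<Sum>\<^sub>\<infinity>q\<in>UNIV - {0}. ?mode_sum q)"
    by (rule sums_instanton_sin[OF Im_pos order_refl])
  from sums_unique2[OF this rows] show ?thesis
    unfolding mode_sum infsum_cmult_left' \<tau>_def by (simp only:)
qed

lemma eisenstein_minus_zeta_rows:
  assumes Im_pos: "Im \<tau> > 0"
  shows "(\<lambda>k. Im \<tau> / (8 * pi\<^sup>2 * real (Suc k)) *
      (2 * bessel_cos_series 1 1 (real (Suc k) * Re \<tau>) (real (Suc k) * Im \<tau>))) sums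
    ((Im \<tau>)\<^sup>2 / (64 * pi ^ 3) * (eisenstein \<tau> - 2 * zeta3) - 1 / (96 * pi))"
proof -
  let ?cos_series = "\<lambda>k. bessel_cos_series 1 1 (real (Suc k) * Re \<tau>) (real (Suc k) * Im \<tau>)"
  have row: "(Im \<tau>)\<^sup>2 / (64 * pi ^ 3) *
      (2 * (2 / (real (Suc k) * Im \<tau>)\<^sup>2 + 8 * pi / (real (Suc k) * Im \<tau>) * ?cos_series k)) -
      1 / (16 * pi ^ 3) * (1 / (real (Suc k))\<^sup>2) =
      Im \<tau> / (8 * pi\<^sup>2 * real (Suc k)) * (2 * ?cos_series k)" for k
  proof -
    have "y\<^sup>2 / (64 * pi ^ 3) * (2 * (2 / (m * y)\<^sup>2 + 8 * pi / (m * y) * s)) -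
        1 / (16 * pi ^ 3) * (1 / m\<^sup>2) = y / (8 * pi\<^sup>2 * m) * (2 * s)"
      if "y > 0" "m > 0" for y m s :: real
      using that by (simp add: field_simps power2_eq_square power3_eq_cube)
    thus ?thesis using Im_pos by simp
  qed
  have "(\<lambda>k. 1 / (16 * pi ^ 3) * (1 / (real (Suc k))\<^sup>2)) sums (1 / (16 * pi ^ 3) * (pi\<^sup>2 / 6))"
    by (intro sums_mult) (use inverse_squares_sums in \<open>simp add: add.commute\<close>)
  from sums_diff[OF sums_mult[OF eisenstein_rows[OF Im_pos], of "(Im \<tau>)\<^sup>2 / (64 * pi ^ 3)"] this]
  show ?thesis unfolding row by (simp add: power2_eq_square power3_eq_cube)
qed

theorem inst_eta_sum:
  "(\<Sum>\<^sub>\<infinity>q\<in>UNIV - {0}. inst_eta q P X) =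
     \<i> * of_real ((Im (axiodilaton P))\<^sup>2 / (64 * pi ^ 3) * (eisenstein (axiodilaton P) - 2 * zeta3) -
       1 / (96 * pi)) * dlog_Z0 P X"
proof -
  define \<tau> where "\<tau> = axiodilaton P"
  have Im_pos: "Im \<tau> > 0" unfolding \<tau>_def by (rule Im_axiodilaton_pos)
  define c where "c k = \<i> * complex_of_real (Im \<tau> / (8 * pi\<^sup>2 * real k))" for k
  let ?cos_series = "\<lambda>k. bessel_cos_series 1 1 (real (Suc k) * Re \<tau>) (real (Suc k) * Im \<tau>)"
  let ?mode_sum = "\<lambda>q. \<Sum>\<^sub>\<infinity>k\<in>{1..}. c k * of_real (\<bar>real_of_int q\<bar> ^ 1) * instanton_mode 1 \<tau> q k"
  have mode_sum: "inst_eta q P X = ?mode_sum q * dlog_Z0 P X" for q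
  proof -
    have "exp w / of_nat k * complex_of_real (cmod (of_int q * Z_of P $ 0) * x) =
        8 * (of_real pi)\<^sup>2 / \<i> * (c k * of_real (\<bar>real_of_int q\<bar> ^ 1) * (exp w * of_real x))" for w x k
      by (simp add: c_def \<tau>_def axiodilaton_def norm_mult)
    thus ?thesis
      unfolding inst_eta_def \<tau>_def instanton_mode_axiodilaton by (simp only: infsum_cmult_right') simp
  qed
  from sums_mult[OF sums_of_real[OF eisenstein_minus_zeta_rows[OF Im_pos]], of \<i>]
  have rows: "(\<lambda>k. c (Suc k) * of_real (2 * ?cos_series k)) sums
      (\<i> * of_real ((Im \<tau>)\<^sup>2 / (64 * pi ^ 3) * (eisenstein \<tau> - 2 * zeta3) - 1 / (96 * pi)))"
    by (simp only: c_def of_real_mult mult.assoc)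
  have "norm (c k) \<le> Im \<tau> / (8 * pi\<^sup>2)" if "k \<ge> 1" for k
    using that Im_pos by (simp add: c_def norm_divide norm_mult norm_power divide_simps)
  hence "(\<lambda>k. c (Suc k) * of_real (2 * ?cos_series k)) sums (\<Sum>\<^sub>\<infinity>q\<in>UNIV - {0}. ?mode_sum q)"
    by (rule sums_instanton_cos[OF Im_pos])
  from sums_unique2[OF this rows] show ?thesis
    unfolding mode_sum infsum_cmult_left' \<tau>_def by (simp only:)
qed

end

section \<open>The prepotential\<close>

lemma linear_pair: "linear (\<lambda>xy. pair (fst xy) (snd xy) :: ('a :: euclidean_space)^2)"
  by (rule linearI) (simp_all add: vec2_eq_iff)

lemma has_derivative_pair [derivative_intros]:
  fixes f g :: "'b :: real_normed_vector \<Rightarrow> 'a :: euclidean_space"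
  assumes "(f has_derivative f') (at x within S)" "(g has_derivative g') (at x within S)"
  shows "((\<lambda>x. pair (f x) (g x)) has_derivative (\<lambda>h. pair (f' h) (g' h))) (at x within S)"
  using bounded_linear.has_derivative[OF linear_pair[unfolded linear_conv_bounded_linear]
      has_derivative_Pair[OF assms]]
  by simp

lemma has_derivative_vec_nth [derivative_intros]:
  "(f has_derivative f') F \<Longrightarrow> ((\<lambda>x. f x $ i) has_derivative (\<lambda>h. f' h $ i)) F"
  by (rule bounded_linear.has_derivative[OF bounded_linear_vec_nth])

lemma frechet_derivativeI: "(f has_derivative f') (at x) \<Longrightarrow> frechet_derivative f (at x) = f'"
  using frechet_derivative_at by metis

lemma holo_partialI:
  assumes "(h has_field_derivative D) (at (Z $ i))" "open S" "Z $ i \<in> S"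
    and "\<And>w. w \<in> S \<Longrightarrow> h w = G (\<chi> k. if k = i then w else Z $ k)"
  shows "holo_partial i G Z = D"
  unfolding holo_partial_def
  by (intro DERIV_imp_deriv has_field_derivative_transform_within_open[OF assms])

lemma holo_partial_0_prepotential:
  assumes "Z $ 0 \<noteq> 0"
  shows "holo_partial 0 (prepotential chi) Z =
    (Z $ 1) ^ 3 / (6 * (Z $ 0)\<^sup>2) + \<i> * of_real (real chi * zeta3 / (8 * pi ^ 3)) * Z $ 0"
proof (rule holo_partialI[where S = UNIV])
  define c where "c = \<i> * complex_of_real (real chi * zeta3 / (8 * pi ^ 3))"
  show "((\<lambda>w. c / 2 * w\<^sup>2 - (Z $ 1) ^ 3 / (6 * w)) has_field_derivative
      (Z $ 1) ^ 3 / (6 * (Z $ 0)\<^sup>2) + \<i> * of_real (real chi * zeta3 / (8 * pi ^ 3)) * Z $ 0)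
      (at (Z $ 0))"
    unfolding c_def[symmetric] using assms
    by (auto intro!: derivative_eq_intros simp: power2_eq_square field_simps)
  show "c / 2 * w\<^sup>2 - (Z $ 1) ^ 3 / (6 * w) = prepotential chi (\<chi> k. if k = 0 then w else Z $ k)" for w
    by (simp add: prepotential_def c_def power_mult_distrib power3_eq_cube field_simps)
qed auto

lemma holo_partial_1_prepotential:
  "holo_partial 1 (prepotential chi) Z = - ((Z $ 1)\<^sup>2 / (2 * Z $ 0))"
proof (rule holo_partialI[where S = UNIV])
  define c where "c = of_nat chi * ((Z $ 0)\<^sup>2 * of_real zeta3) / (2 * (2 * of_real pi * \<i>) ^ 3)"
  show "((\<lambda>w. - (1 / 6) * w ^ 3 / Z $ 0 + c) has_field_derivative - ((Z $ 1)\<^sup>2 / (2 * Z $ 0)))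
      (at (Z $ 1))"
    by (cases "Z $ 0 = 0") (auto intro!: derivative_eq_intros simp: power2_eq_square field_simps)
  show "- (1 / 6) * w ^ 3 / Z $ 0 + c = prepotential chi (\<chi> k. if k = 1 then w else Z $ k)" for w
    by (simp add: prepotential_def c_def)
qed auto

lemma
  assumes "Z $ 0 \<noteq> 0"
  shows tau_prepotential_0_0: "tau (prepotential chi) Z 0 0 =
      \<i> * of_real (real chi * zeta3 / (8 * pi ^ 3)) - (Z $ 1 / Z $ 0) ^ 3 / 3"
    and tau_prepotential_1_0: "tau (prepotential chi) Z 1 0 = (Z $ 1 / Z $ 0)\<^sup>2 / 2"
    and tau_prepotential_0_1: "tau (prepotential chi) Z 0 1 = (Z $ 1 / Z $ 0)\<^sup>2 / 2"
    and tau_prepotential_1_1: "tau (prepotential chi) Z 1 1 = - (Z $ 1 / Z $ 0)"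
proof -
  define c where "c = \<i> * complex_of_real (real chi * zeta3 / (8 * pi ^ 3))"
  have "((\<lambda>w. (Z $ 1) ^ 3 / (6 * w\<^sup>2) + c * w) has_field_derivative c - (Z $ 1 / Z $ 0) ^ 3 / 3)
      (at (Z $ 0))"
    using assms by (auto intro!: derivative_eq_intros simp: power2_eq_square power3_eq_cube field_simps)
  thus "tau (prepotential chi) Z 0 0 =
      \<i> * of_real (real chi * zeta3 / (8 * pi ^ 3)) - (Z $ 1 / Z $ 0) ^ 3 / 3"
    unfolding tau_def c_def
    by (rule holo_partialI[where S = "- {0}"]) (use assms in \<open>auto simp: holo_partial_0_prepotential\<close>)
  have "((\<lambda>w. w ^ 3 / (6 * (Z $ 0)\<^sup>2) + c * Z $ 0) has_field_derivative (Z $ 1 / Z $ 0)\<^sup>2 / 2)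
      (at (Z $ 1))"
    using assms by (auto intro!: derivative_eq_intros simp: power2_eq_square field_simps)
  thus "tau (prepotential chi) Z 1 0 = (Z $ 1 / Z $ 0)\<^sup>2 / 2"
    unfolding tau_def c_def
    by (rule holo_partialI[where S = UNIV]) (use assms in \<open>auto simp: holo_partial_0_prepotential\<close>)
  have "((\<lambda>w. - ((Z $ 1)\<^sup>2 / (2 * w))) has_field_derivative (Z $ 1 / Z $ 0)\<^sup>2 / 2) (at (Z $ 0))"
    using assms by (auto intro!: derivative_eq_intros simp: power2_eq_square field_simps)
  thus "tau (prepotential chi) Z 0 1 = (Z $ 1 / Z $ 0)\<^sup>2 / 2"
    unfolding tau_def
    by (rule holo_partialI[where S = UNIV]) (auto simp: holo_partial_1_prepotential)
  have "((\<lambda>w. - (w\<^sup>2 / (2 * Z $ 0))) has_field_derivative - (Z $ 1 / Z $ 0)) (at (Z $ 1))"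
    using assms by (auto intro!: derivative_eq_intros)
  thus "tau (prepotential chi) Z 1 1 = - (Z $ 1 / Z $ 0)"
    unfolding tau_def
    by (rule holo_partialI[where S = UNIV]) (auto simp: holo_partial_1_prepotential)
qed

lemmas tau_prepotential =
  tau_prepotential_0_0 tau_prepotential_0_1 tau_prepotential_1_0 tau_prepotential_1_1

lemma Re_power3: "Re (z ^ 3) = (Re z) ^ 3 - 3 * Re z * (Im z)\<^sup>2"
  and Im_power3: "Im (z ^ 3) = 3 * (Re z)\<^sup>2 * Im z - (Im z) ^ 3"
  by (simp_all add: power2_eq_square power3_eq_cube algebra_simps)

lemma r_squared_prepotential:
  assumes "Z $ 0 \<noteq> 0"
  shows "r_squared (prepotential chi) Z =
    (cmod (Z $ 0))\<^sup>2 * (2 * (Im (Z $ 1 / Z $ 0)) ^ 3 / 3 - real chi * zeta3 / (8 * pi ^ 3))"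
proof -
  define z where "z = Z $ 1 / Z $ 0"
  define \<tau>00 where "\<tau>00 = tau (prepotential chi) Z 0 0"
  have Z1_eq: "Z $ 1 = z * Z $ 0" using assms by (simp add: z_def)
  have "r_squared (prepotential chi) Z =
      - Re ((of_real (Im \<tau>00) + of_real (Im (z\<^sup>2 / 2)) * (z + cnj z) + of_real (Im (- z)) *
        (z * cnj z)) *
        (Z $ 0 * cnj (Z $ 0)))"
    unfolding r_squared_def sum_UNIV_2 tau_prepotential(2-4)[OF assms, folded z_def] \<tau>00_def
    unfolding Z1_eq complex_cnj_mult by (simp only: algebra_simps)
  also have "\<dots> = - (cmod (Z $ 0))\<^sup>2 * (Im \<tau>00 + Im (z\<^sup>2 / 2) * (2 * Re z) - Im z * (cmod z)\<^sup>2)"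
    unfolding complex_add_cnj complex_norm_square[symmetric]
    by (simp add: algebra_simps flip: of_real_mult of_real_add of_real_diff of_real_minus)
  also have "\<dots> = (cmod (Z $ 0))\<^sup>2 * (2 * (Im z) ^ 3 / 3 - real chi * zeta3 / (8 * pi ^ 3))"
    unfolding \<tau>00_def tau_prepotential_0_0[OF assms] z_def[symmetric] cmod_power2[of z]
    by (simp add: Im_power2 Im_power3 power2_eq_square power3_eq_cube field_simps)
  finally show ?thesis unfolding z_def .
qed

definition instanton_coupling :: "nat \<Rightarrow> complex \<Rightarrow> complex" where
  "instanton_coupling chi \<tau> = of_real (3 * real chi / (64 * pi ^ 3)) * twisted_eisenstein \<tau>"

definition fibre_radius :: "nat \<Rightarrow> real \<Rightarrow> complex \<Rightarrow> real" where
  "fibre_radius chi t \<tau> = (t ^ 3 - R1 chi t \<tau>) / 2"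

definition schur_complement :: "nat \<Rightarrow> real \<Rightarrow> complex \<Rightarrow> real" where
  "schur_complement chi t \<tau> = fibre_radius chi t \<tau> + Re (instanton_coupling chi \<tau>)"

lemma R1_eq: "R1 chi t \<tau> = t ^ 3 / 3 - real chi / (32 * pi ^ 3) * eisenstein \<tau>"
  by (simp add: R1_def power_mult_distrib)

lemma instanton_coupling_less_fibre_radius:
  assumes "Im \<tau> > 0" "R1 chi t \<tau> > 0"
  shows "cmod (instanton_coupling chi \<tau>) < fibre_radius chi t \<tau>"
proof -
  define x where "x = real chi / (32 * pi ^ 3) * eisenstein \<tau>"
  have "cmod (instanton_coupling chi \<tau>) =
      3 / 2 * (real chi / (32 * pi ^ 3) * cmod (twisted_eisenstein \<tau>))"
    by (simp add: instanton_coupling_def norm_mult norm_divide norm_power)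
  also have "\<dots> \<le> 3 / 2 * x"
    unfolding x_def by (intro mult_left_mono norm_twisted_eisenstein_le assms) auto
  also have "\<dots> < fibre_radius chi t \<tau>"
    using assms(2) unfolding fibre_radius_def R1_eq x_def[symmetric] by simp
  finally show ?thesis .
qed

lemma schur_complement_pos:
  assumes "Im \<tau> > 0" "R1 chi t \<tau> > 0"
  shows "schur_complement chi t \<tau> > 0"
  using instanton_coupling_less_fibre_radius[OF assms] abs_Re_le_cmod[of "instanton_coupling chi \<tau>"]
  unfolding schur_complement_def by linarith

lemma R1_pos_imp_pos:
  assumes "Im \<tau> > 0" "R1 chi t \<tau> > 0"
  shows "t > 0"
proof -
  have "real chi / (32 * pi ^ 3) * eisenstein \<tau> \<ge> 0"
    using eisenstein_pos[OF assms(1)] by simp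
  hence "t ^ 3 > 0" using assms(2) unfolding R1_eq by linarith
  thus ?thesis by (simp add: zero_less_power_eq)
qed

abbreviation modulus :: "nspace \<Rightarrow> complex" where "modulus P \<equiv> Z_of P $ 1 / Z_of P $ 0"

context
  fixes P :: nspace and chi :: nat
  assumes Z0_nonzero: "Z_of P $ 0 \<noteq> 0"
begin

lemma dlog_V_field: "dlog_Z0 P (V_field P) = 4 * \<i>"
  using Z0_nonzero by (simp add: dlog_Z0_def V_field_def)

lemma f_fun_prepotential:
  assumes "c_l = real chi / (192 * pi)"
  shows "f_fun (prepotential chi) chi c_l P =
    4 * pi * ((cmod (Z_of P $ 0))\<^sup>2 * R1 chi (Im (modulus P)) (axiodilaton P))"
proof -
  have "Re (\<Sum>\<^sub>\<infinity>q\<in>UNIV - {0}. inst_eta q P (V_field P)) =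
     - 4 * ((Im (axiodilaton P))\<^sup>2 / (64 * pi ^ 3) * (eisenstein (axiodilaton P) - 2 * zeta3) - 1 /
       (96 * pi))"
    unfolding inst_eta_sum[OF Z0_nonzero] dlog_V_field by simp
  moreover have "Im (axiodilaton P) = cmod (Z_of P $ 0)" by (simp add: axiodilaton_def)
  moreover have "2 * pi * (r\<^sup>2 * (2 * t ^ 3 / 3 - x * zeta3 / (8 * pi ^ 3)) - 8 * (x / (192 * pi)) +
      x * (- 4 * (r\<^sup>2 / (64 * pi ^ 3) * (E - 2 * zeta3) - 1 / (96 * pi)))) =
      4 * pi * (r\<^sup>2 * (t ^ 3 / 3 - x / (32 * pi ^ 3) * E))" for r t x E
    by (simp add: field_simps)
  ultimately show ?thesis
    unfolding f_fun_def r_squared_prepotential[OF Z0_nonzero] R1_eq assms by (simp only:)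
qed

lemma inst_V_sum_schur_complement:
  "of_nat chi * (\<Sum>\<^sub>\<infinity>q\<in>UNIV - {0}. (of_int q)\<^sup>2 * inst_V q P) =
     of_real (real chi * zeta3 / (8 * pi ^ 3) + t ^ 3 / 3 - schur_complement chi t (axiodilaton P))"
proof -
  have "real chi * (1 / (32 * pi ^ 3) * (4 * zeta3 - (E + 3 * G) / 2)) =
      real chi * zeta3 / (8 * pi ^ 3) +
     t ^ 3 / 3 - ((t ^ 3 - (t ^ 3 / 3 - real chi / (32 * pi ^ 3) * E)) / 2 + 3 * real chi /
       (64 * pi ^ 3) * G)" for E G
    by (simp add: field_simps)
  moreover have "Re (instanton_coupling chi \<tau>) =
      3 * real chi / (64 * pi ^ 3) * Re (twisted_eisenstein \<tau>)" for \<tau>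
    by (simp add: instanton_coupling_def)
  ultimately show ?thesis
    unfolding inst_V_sum[OF Z0_nonzero] schur_complement_def fibre_radius_def R1_eq
    by (simp only: of_real_of_nat_eq[where 'a = complex, symmetric] of_real_mult[symmetric])
qed

lemma T_mat_prepotential:
  "T_mat (prepotential chi) chi P = (let b = Re (modulus P); t = Im (modulus P) in
     pair (pair (b\<^sup>2 * t - schur_complement chi t (axiodilaton P)) (- b * t)) (pair (- b * t) t))"
proof -
  have "real chi * Re (\<Sum>\<^sub>\<infinity>q\<in>UNIV - {0}. (of_int q)\<^sup>2 * inst_V q P) =
      real chi * zeta3 / (8 * pi ^ 3) + t ^ 3 / 3 - schur_complement chi t (axiodilaton P)" for t
    using arg_cong[OF inst_V_sum_schur_complement[of t], of Re] by simp
  from this[of "Im (modulus P)"] show ?thesis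
    by (simp add: T_mat_def vec2_eq_iff tau_prepotential[OF Z0_nonzero] Im_power2 Im_power3 Let_def
        diff_divide_distrib del: Im_divide)
qed

lemma W_tot_prepotential:
  assumes "dlog_Z0 P X = 0"
  shows "W_tot (prepotential chi) chi P 0 X = of_real (tzeta_of X $ 0) +
      ((modulus P) ^ 3 / 3 +
        \<i> * of_real ((Im (modulus P)) ^ 3 / 3 - schur_complement chi (Im (modulus P))
          (axiodilaton P))) *
        of_real (zeta_of X $ 0) - (modulus P)\<^sup>2 / 2 * of_real (zeta_of X $ 1)"
    and "W_tot (prepotential chi) chi P 1 X = of_real (tzeta_of X $ 1) -
      (modulus P)\<^sup>2 / 2 * of_real (zeta_of X $ 0) + modulus P * of_real (zeta_of X $ 1)"
proof -
  have "W_inst chi P 0 X =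
      of_nat chi * (\<Sum>\<^sub>\<infinity>q\<in>UNIV - {0}. (of_int q)\<^sup>2 * inst_V q P) * (\<i> * of_real (zeta_of X $ 0))"
    unfolding W_inst_def inst_A_def assms mult.assoc infsum_cmult_left'[symmetric]
    by (simp add: power2_eq_square mult_ac)
  note W_inst_0 = this[unfolded inst_V_sum_schur_complement[of "Im (modulus P)"]]
  show "W_tot (prepotential chi) chi P 0 X = of_real (tzeta_of X $ 0) +
      ((modulus P) ^ 3 / 3 +
        \<i> * of_real ((Im (modulus P)) ^ 3 / 3 - schur_complement chi (Im (modulus P))
          (axiodilaton P))) *
        of_real (zeta_of X $ 0) - (modulus P)\<^sup>2 / 2 * of_real (zeta_of X $ 1)"
    unfolding W_tot_def W_form_def sum_UNIV_2 W_inst_0 tau_prepotential[OF Z0_nonzero]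
    by (simp add: algebra_simps)
  show "W_tot (prepotential chi) chi P 1 X = of_real (tzeta_of X $ 1) -
      (modulus P)\<^sup>2 / 2 * of_real (zeta_of X $ 0) + modulus P * of_real (zeta_of X $ 1)"
    unfolding W_tot_def W_form_def sum_UNIV_2 tau_prepotential[OF Z0_nonzero]
    by (simp add: W_inst_def algebra_simps)
qed

lemma W_tot_V_field:
  "W_tot (prepotential chi) chi P 0 (V_field P) =
     of_real (- 2 * Im (axiodilaton P) * Im (instanton_coupling chi (axiodilaton P)))"
  "W_tot (prepotential chi) chi P 1 (V_field P) = 0"
proof -
  have vertical: "zeta_of (V_field P) = 0" "tzeta_of (V_field P) = 0" by (simp_all add: V_field_def)
  have "W_tot (prepotential chi) chi P 0 (V_field P) =
      of_nat chi * (\<Sum>\<^sub>\<infinity>q\<in>UNIV - {0}. of_int q * inst_A q P (V_field P))"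
    by (simp add: W_tot_def W_form_def W_inst_def vertical)
  also have "\<dots> = of_real (- 2 * Im (axiodilaton P) * Im (instanton_coupling chi (axiodilaton P)))"
    unfolding inst_A_sum[OF Z0_nonzero] dlog_V_field instanton_coupling_def
    by (simp add: complex_eq_iff)
  finally show "W_tot (prepotential chi) chi P 0 (V_field P) =
     of_real (- 2 * Im (axiodilaton P) * Im (instanton_coupling chi (axiodilaton P)))" .
  show "W_tot (prepotential chi) chi P 1 (V_field P) = 0"
    by (simp add: W_tot_def W_form_def W_inst_def vertical)
qed

end

lemma matrix_inv_eqI:
  fixes A :: "'a :: semiring_1^'n^'n"
  assumes "A ** B = mat 1" "B ** A = mat 1"
  shows "matrix_inv A = B"
proof -
  have "A ** matrix_inv A = mat 1 \<and> matrix_inv A ** A = mat 1"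
    unfolding matrix_inv_def by (rule someI_ex) (use assms in blast)
  thus ?thesis using assms by (metis matrix_mul_assoc matrix_mul_lid matrix_mul_rid)
qed

lemma sum_symmetric_form_complete_square:
  assumes "T = pair (pair (b\<^sup>2 * t - D) (- b * t)) (pair (- b * t) t)"
  shows "(\<Sum>i\<in>UNIV. \<Sum>j\<in>UNIV. of_real (T $ i $ j) * x $ i * cnj (y $ j)) =
    of_real t * ((x $ 1 - of_real b * x $ 0) * cnj (y $ 1 - of_real b * y $ 0)) -
    of_real D * (x $ 0 * cnj (y $ 0))"
  unfolding sum_UNIV_2 assms by (simp add: algebra_simps power2_eq_square)

lemma
  fixes T :: "real^2^2"
  assumes T_eq: "T = pair (pair (b\<^sup>2 * t - D) (- b * t)) (pair (- b * t) t)"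
    and nonzero: "t \<noteq> 0" "D \<noteq> 0"
  shows invertible_complete_square: "invertible T"
    and matrix_inv_complete_square: "matrix_inv T =
      pair (pair (- (1 / D)) (- (b / D))) (pair (- (b / D)) (1 / t - b\<^sup>2 / D))" (is "_ = ?inverse")
proof -
  have "T ** ?inverse = mat 1" "?inverse ** T = mat 1"
    using nonzero unfolding T_eq
    by (simp_all add: vec2_eq_iff matrix_mult_2_nth mat_def field_simps power2_eq_square)
  thus "invertible T" "matrix_inv T = ?inverse"
    by (auto simp: invertible_def intro!: matrix_inv_eqI)
qed

lemma
  fixes P :: nspace and chi :: nat
  defines "b \<equiv> Re (modulus P)" and "t \<equiv> Im (modulus P)" and "W \<equiv> W_tot (prepotential chi) chi P"
    and "D \<equiv> schur_complement chi (Im (modulus P)) (axiodilaton P)"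
  assumes Z0_nonzero: "Z_of P $ 0 \<noteq> 0" and nonzero: "t \<noteq> 0" "D \<noteq> 0"
  shows invertible_T_mat_prepotential: "invertible (T_mat (prepotential chi) chi P)"
    and g_N_prepotential: "g_N (prepotential chi) chi P X Y = 2 * pi * Re (
      of_real t * ((Z_of X $ 1 - of_real b * Z_of X $ 0) * cnj (Z_of Y $ 1 - of_real b * Z_of Y $ 0))
      - of_real D * (Z_of X $ 0 * cnj (Z_of Y $ 0))
      + of_real (1 / t) * (W 1 X * cnj (W 1 Y))
      - of_real (1 / D) * ((W 0 X + of_real b * W 1 X) * cnj (W 0 Y + of_real b * W 1 Y)))"
proof -
  have T_eq: "T_mat (prepotential chi) chi P = pair (pair (b\<^sup>2 * t - D) (- b * t)) (pair (- b * t) t)"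
    unfolding T_mat_prepotential[OF Z0_nonzero] Let_def b_def t_def D_def ..
  show "invertible (T_mat (prepotential chi) chi P)"
    by (rule invertible_complete_square[OF T_eq nonzero])
  have "(\<Sum>i\<in>UNIV. \<Sum>j\<in>UNIV. W i X * of_real (matrix_inv (T_mat (prepotential chi) chi P) $ i $ j) *
      cnj (W j Y)) =
      of_real (1 / t) * (W 1 X * cnj (W 1 Y)) -
      of_real (1 / D) * ((W 0 X + of_real b * W 1 X) * cnj (W 0 Y + of_real b * W 1 Y))"
    unfolding sum_UNIV_2 matrix_inv_complete_square[OF T_eq nonzero]
    by (simp add: field_simps power2_eq_square add_divide_distrib)
  thus "g_N (prepotential chi) chi P X Y = 2 * pi * Re (
      of_real t * ((Z_of X $ 1 - of_real b * Z_of X $ 0) * cnj (Z_of Y $ 1 - of_real b * Z_of Y $ 0))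
      - of_real D * (Z_of X $ 0 * cnj (Z_of Y $ 0))
      + of_real (1 / t) * (W 1 X * cnj (W 1 Y))
      - of_real (1 / D) * ((W 0 X + of_real b * W 1 X) * cnj (W 0 Y + of_real b * W 1 Y)))"
    unfolding g_N_def sum.distrib sum_symmetric_form_complete_square[OF T_eq] W_def[symmetric]
    by simp
qed

lemma has_derivative_cmod_nth_square:
  fixes Z :: "complex^2"
  shows "((\<lambda>Z. (cmod (Z $ 0))\<^sup>2) has_derivative (\<lambda>h. 2 * Re (cnj (Z $ 0) * h $ 0))) (at Z)"
  unfolding cmod_power2
  by (auto intro!: derivative_eq_intros simp: algebra_simps)

lemma has_derivative_cmod_nth:
  fixes Z :: "complex^2"
  assumes "Z $ 0 \<noteq> 0"
  shows "((\<lambda>Z. cmod (Z $ 0)) has_derivative (\<lambda>h. Re (cnj (Z $ 0) * h $ 0) / cmod (Z $ 0))) (at Z)"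
proof -
  have "((\<lambda>Z :: complex^2. Z $ 0) has_derivative (\<lambda>h. h $ 0)) (at Z)"
    by (intro has_derivative_vec_nth has_derivative_ident)
  from has_derivative_compose[OF this has_derivative_norm[OF assms]] show ?thesis
    by (simp add: inner_complex_def sgn_div_norm field_simps add_divide_distrib)
qed

lemma has_derivative_Im_ratio:
  fixes Z :: "complex^2"
  assumes "Z $ 0 \<noteq> 0"
  shows "((\<lambda>Z. Im (Z $ 1 / Z $ 0)) has_derivative
    (\<lambda>h. Im ((h $ 1 - Z $ 1 / Z $ 0 * h $ 0) / Z $ 0))) (at Z)"
proof -
  have "((\<lambda>Z :: complex^2. Z $ 1 / Z $ 0) has_derivative
      (\<lambda>h. (h $ 1 - Z $ 1 / Z $ 0 * h $ 0) / Z $ 0)) (at Z)"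
    using assms by (auto intro!: derivative_eq_intros simp: fun_eq_iff field_simps)
  from bounded_linear.has_derivative[OF bounded_linear_Im this] show ?thesis .
qed

lemma open_nonzero_nth: "open {Z :: complex^2. Z $ 0 \<noteq> 0}"
proof -
  have "open ((\<lambda>Z :: complex^2. Z $ 0) -` (- {0}))" by (intro open_vimage continuous_intros)
  thus ?thesis by (simp add: vimage_def)
qed

lemma r_squared_has_derivative:
  fixes Z :: "complex^2"
  assumes Z0_nonzero: "Z $ 0 \<noteq> 0"
  defines "t \<equiv> Im (Z $ 1 / Z $ 0)"
  shows "(r_squared (prepotential chi) has_derivative
     (\<lambda>h. 2 * Re (cnj (Z $ 0) * h $ 0) * (2 * t ^ 3 / 3 - real chi * zeta3 / (8 * pi ^ 3)) +
        (cmod (Z $ 0))\<^sup>2 * (2 * t\<^sup>2 * Im ((h $ 1 - Z $ 1 / Z $ 0 * h $ 0) / Z $ 0)))) (at Z)"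
proof -
  let ?c = "real chi * zeta3 / (8 * pi ^ 3)"
  have "((\<lambda>Z. 2 * (Im (Z $ 1 / Z $ 0)) ^ 3 / 3 - ?c) has_derivative
      (\<lambda>h. 2 * t\<^sup>2 * Im ((h $ 1 - Z $ 1 / Z $ 0 * h $ 0) / Z $ 0))) (at Z)"
  proof -
    have "((\<lambda>x. 2 * s x ^ 3 / 3 - ?c) has_derivative (\<lambda>h. 2 * (s x)\<^sup>2 * s' h)) (at x)"
      if "(s has_derivative s') (at x)" for s s' and x :: "complex^2"
      by (auto intro!: derivative_eq_intros that)
    from this[OF has_derivative_Im_ratio[OF Z0_nonzero]] show ?thesis unfolding t_def .
  qed
  from has_derivative_mult[OF has_derivative_cmod_nth_square this]
  have "((\<lambda>Z. (cmod (Z $ 0))\<^sup>2 * (2 * (Im (Z $ 1 / Z $ 0)) ^ 3 / 3 - ?c)) has_derivative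
      (\<lambda>h. 2 * Re (cnj (Z $ 0) * h $ 0) * (2 * t ^ 3 / 3 - ?c) +
        (cmod (Z $ 0))\<^sup>2 * (2 * t\<^sup>2 * Im ((h $ 1 - Z $ 1 / Z $ 0 * h $ 0) / Z $ 0)))) (at Z)"
    by (simp only: t_def add.commute)
  thus ?thesis
    by (rule has_derivative_transform_within_open[OF _ open_nonzero_nth])
      (use Z0_nonzero in \<open>auto simp: r_squared_prepotential\<close>)
qed

lemma R1_has_derivative:
  assumes t_deriv: "(t has_derivative t') (at x)" and \<tau>_deriv: "(\<tau> has_derivative \<tau>') (at x)"
    and pos: "Im (\<tau> x) > 0"
  shows "((\<lambda>x. R1 chi (t x) (\<tau> x)) has_derivative (\<lambda>h. (t x)\<^sup>2 * t' h +
      (3 / 2 * ((t x) ^ 3 / 3 - R1 chi (t x) (\<tau> x)) * Im (\<tau>' h) -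
        Im (cnj (instanton_coupling chi (\<tau> x)) * \<tau>' h)) / Im (\<tau> x))) (at x)"
proof (rule has_derivative_eq_rhs)
  let ?E' = "\<lambda>h. - (3 / (2 * Im (\<tau> x))) *
    (eisenstein (\<tau> x) * Im (\<tau>' h) - Im (cnj (twisted_eisenstein (\<tau> x)) * \<tau>' h))"
  have "((\<lambda>x. eisenstein (\<tau> x)) has_derivative ?E') (at x)"
    by (rule has_derivative_compose[OF \<tau>_deriv eisenstein_has_derivative[OF pos]])
  thus "((\<lambda>x. R1 chi (t x) (\<tau> x)) has_derivative
      (\<lambda>h. (3 * t' h * (t x)\<^sup>2) / 3 - real chi / (32 * pi ^ 3) * ?E' h)) (at x)"
    unfolding R1_eq
    by (intro has_derivative_diff has_derivative_mult_right)
      (auto intro!: derivative_eq_intros t_deriv)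
  have "(3 * u * (t x)\<^sup>2) / 3 - k * (- (3 / (2 * Im (\<tau> x))) * (E * v - G)) =
      (t x)\<^sup>2 * u + (3 / 2 * (k * E) * v - 3 / 2 * k * G) / Im (\<tau> x)" for u v k E G
    using pos by (simp add: field_simps)
  moreover have "Im (cnj (instanton_coupling chi z) * w) =
      3 / 2 * (real chi / (32 * pi ^ 3)) * Im (cnj (twisted_eisenstein z) * w)" for z w
    by (simp add: instanton_coupling_def field_simps)
  moreover have "(t x) ^ 3 / 3 - R1 chi (t x) (\<tau> x) = real chi / (32 * pi ^ 3) * eisenstein (\<tau> x)"
    unfolding R1_eq by simp
  ultimately show "(\<lambda>h. (3 * t' h * (t x)\<^sup>2) / 3 - real chi / (32 * pi ^ 3) * ?E' h) =
      (\<lambda>h. (t x)\<^sup>2 * t' h +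
      (3 / 2 * ((t x) ^ 3 / 3 - R1 chi (t x) (\<tau> x)) * Im (\<tau>' h) -
        Im (cnj (instanton_coupling chi (\<tau> x)) * \<tau>' h)) / Im (\<tau> x))"
    by (simp only:)
qed

lemma f_fun_has_derivative:
  fixes P :: nspace
  assumes Z0_nonzero: "Z_of P $ 0 \<noteq> 0" and c_l: "c_l = real chi / (192 * pi)"
  defines "t \<equiv> Im (modulus P)" and "r \<equiv> cmod (Z_of P $ 0)" and "\<tau> \<equiv> axiodilaton P"
    and "t' \<equiv> \<lambda>h. Im ((Z_of h $ 1 - modulus P * Z_of h $ 0) / Z_of P $ 0)"
    and "r' \<equiv> \<lambda>h. Re (cnj (Z_of P $ 0) * Z_of h $ 0) / cmod (Z_of P $ 0)"
  defines "\<tau>' \<equiv> \<lambda>h :: nspace. Complex (zeta_of h $ 0) (r' h)"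
  shows "(f_fun (prepotential chi) chi c_l has_derivative
     (\<lambda>h. 4 * pi * (r\<^sup>2 * (t\<^sup>2 * t' h + (3 / 2 * (t ^ 3 / 3 - R1 chi t \<tau>) * Im (\<tau>' h) -
          Im (cnj (instanton_coupling chi \<tau>) * \<tau>' h)) / Im \<tau>) +
        2 * (r * r' h) * R1 chi t \<tau>))) (at P)"
    (is "(_ has_derivative ?f') _")
proof -
  have nonzero: "r \<noteq> 0" "Im \<tau> > 0" using Z0_nonzero by (simp_all add: r_def \<tau>_def axiodilaton_def)
  have Z_deriv: "(fst has_derivative fst) (at P)"
    by (rule bounded_linear_imp_has_derivative[OF bounded_linear_fst])
  have "((\<lambda>P::nspace. (cmod (Z_of P $ 0))\<^sup>2) has_derivative
      (\<lambda>h. 2 * Re (cnj (Z_of P $ 0) * Z_of h $ 0))) (at P)"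
    by (rule has_derivative_compose[OF Z_deriv has_derivative_cmod_nth_square])
  moreover have "Re (cnj (Z_of P $ 0) * Z_of h $ 0) = r * r' h" for h
    using nonzero by (simp add: r_def r'_def)
  ultimately have square: "((\<lambda>P. (cmod (Z_of P $ 0))\<^sup>2) has_derivative (\<lambda>h. 2 * (r * r' h))) (at P)"
    by (simp only:)
  have t_deriv: "((\<lambda>P. Im (modulus P)) has_derivative t') (at P)"
    unfolding t'_def by (rule has_derivative_compose[OF Z_deriv has_derivative_Im_ratio[OF Z0_nonzero]])
  have "((\<lambda>P::nspace. zeta_of P $ 0) has_derivative (\<lambda>h. zeta_of h $ 0)) (at P)"
    by (intro has_derivative_vec_nth has_derivative_fst has_derivative_snd has_derivative_ident)
  hence \<tau>_deriv: "(axiodilaton has_derivative \<tau>') (at P)"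
    unfolding axiodilaton_def[abs_def] Complex_eq \<tau>'_def r'_def
    by (intro has_derivative_add has_derivative_mult_right has_derivative_of_real
        has_derivative_compose[OF Z_deriv has_derivative_cmod_nth[OF Z0_nonzero]])
  have "((\<lambda>P. 4 * pi * ((cmod (Z_of P $ 0))\<^sup>2 * R1 chi (Im (modulus P)) (axiodilaton P)))
      has_derivative ?f') (at P)"
    unfolding r_def t_def \<tau>_def
    by (intro has_derivative_mult_right has_derivative_mult square[unfolded r_def]
        R1_has_derivative t_deriv \<tau>_deriv nonzero(2)[unfolded \<tau>_def])
  thus ?thesis
  proof (rule has_derivative_transform_within_open)
    show "open {P :: nspace. Z_of P $ 0 \<noteq> 0}"
      using open_vimage_fst[OF open_nonzero_nth] by (simp add: vimage_def)
  qed (use Z0_nonzero in \<open>auto simp: f_fun_prepotential[OF _ c_l]\<close>)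
qed

section \<open>The metric in an adapted coframe\<close>

fun tau_form :: "iia \<Rightarrow> complex" where
  "tau_form (d\<tau>2, dz, d\<zeta>, d\<zeta>t, d\<sigma>) = Complex (d\<zeta> $ 0) d\<tau>2"

fun doublet_form :: "iia \<Rightarrow> iia \<Rightarrow> complex" where
  "doublet_form (\<tau>2, z, \<zeta>, \<zeta>t, \<sigma>) (d\<tau>2, dz, d\<zeta>, d\<zeta>t, d\<sigma>) =
     Complex (Re z * d\<zeta> $ 0 - d\<zeta> $ 1) (- \<tau>2 * Re dz)"

fun dual_doublet_form :: "iia \<Rightarrow> iia \<Rightarrow> complex" where
  "dual_doublet_form (\<tau>2, z, \<zeta>, \<zeta>t, \<sigma>) (d\<tau>2, dz, d\<zeta>, d\<zeta>t, d\<sigma>) = Complex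
     (- (d\<sigma> + \<zeta>t $ 0 * d\<zeta> $ 0 + \<zeta>t $ 1 * d\<zeta> $ 1 - \<zeta> $ 0 * d\<zeta>t $ 0 - \<zeta> $ 1 * d\<zeta>t $ 1) / 2)
     (\<tau>2 * (d\<zeta>t $ 0 + Re z * d\<zeta>t $ 1 + (Re z)\<^sup>2 / 2 * d\<zeta> $ 1 - (Re z) ^ 3 / 6 * d\<zeta> $ 0))"

fun singlet_form :: "iia \<Rightarrow> iia \<Rightarrow> complex" where
  "singlet_form (\<tau>2, z, \<zeta>, \<zeta>t, \<sigma>) (d\<tau>2, dz, d\<zeta>, d\<zeta>t, d\<sigma>) = Complex
     (d\<zeta>t $ 1 + Re z * d\<zeta> $ 1 - (Re z)\<^sup>2 / 2 * d\<zeta> $ 0)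
     (Im z * (\<tau>2 * Im dz + Im z * d\<tau>2 / 2))"

definition iia_tau :: "iia \<Rightarrow> complex" where
  "iia_tau p = Complex (fst (snd (snd p)) $ 0) (fst p)"

definition iia_t :: "iia \<Rightarrow> real" where
  "iia_t p = Im (fst (snd p))"

definition plus_form :: "iia \<Rightarrow> iia \<Rightarrow> complex" where
  "plus_form p X =
     dual_doublet_form p X + \<i> * of_real (Im (iia_tau p) * (iia_t p)\<^sup>2 / 2) * doublet_form p X"

definition minus_form :: "iia \<Rightarrow> iia \<Rightarrow> complex" where
  "minus_form p X =
     dual_doublet_form p X - \<i> * of_real (Im (iia_tau p) * (iia_t p)\<^sup>2 / 2) * doublet_form p X"

definition coframe :: "iia \<Rightarrow> iia \<Rightarrow> (complex \<times> complex) \<times> (complex \<times> complex)" where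
  "coframe p X = ((plus_form p X, minus_form p X), (singlet_form p X, tau_form X))"

text \<open>
  The first summand is the bilinear form of the quadratic form inverse to
  \<open>B |x|\<^sup>2 - Re (cnj g x\<^sup>2)\<close>, where \<open>B = (t\<^sup>3 - R) / 2\<close>.
\<close>

fun fibre_form :: "real \<Rightarrow> real \<Rightarrow> complex \<Rightarrow> complex \<times> complex \<Rightarrow> complex \<times> complex \<Rightarrow> real" where
  "fibre_form t R g (a, c) (a', c') = (let B = (t ^ 3 - R) / 2 in
     (B * Re (c * cnj c') + Re (cnj g * c * c')) / (B\<^sup>2 - (cmod g)\<^sup>2)
     - Re ((a - c) * cnj (a' - c')) / t ^ 3 + Re (a * cnj a') / R)"

fun base_form :: "real \<Rightarrow> real \<Rightarrow> complex \<Rightarrow> complex \<times> complex \<Rightarrow> complex \<times> complex \<Rightarrow> real" where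
  "base_form t R g (p, d) (p', d') = (let B = (t ^ 3 - R) / 2 in
     2 * B / (t * R) * Re (p * cnj p') - t / R * (Re (cnj g * cnj p * d') + Re (cnj g * cnj p' * d))
     + (B / 2 + (cmod g)\<^sup>2 / R) * Re (d * cnj d'))"

fun coframe_metric :: "real \<Rightarrow> real \<Rightarrow> real \<Rightarrow> complex \<Rightarrow>
    (complex \<times> complex) \<times> (complex \<times> complex) \<Rightarrow> (complex \<times> complex) \<times> (complex \<times> complex) \<Rightarrow> real" where
  "coframe_metric \<tau>2 t R g (x, u) (y, v) =
     1 / (2 * \<tau>2\<^sup>2 * R) * (1 / \<tau>2\<^sup>2 * fibre_form t R g x y + base_form t R g u v)"

lemma Re_mult_cnj_eq: "Re (x * cnj y) = Re x * Re y + Im x * Im y"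
  by simp

lemma fibre_form_complete_square:
  fixes c c' g :: complex and B :: real
  defines "D \<equiv> B + Re g" and "M \<equiv> B\<^sup>2 - (cmod g)\<^sup>2"
  assumes nonzero: "D \<noteq> 0" "M \<noteq> 0"
  shows "D / M * ((Re c + Im g * Im c / D) * (Re c' + Im g * Im c' / D)) + Im c * Im c' / D =
    (B * Re (c * cnj c') + Re (cnj g * c * c')) / M"
proof -
  have "(D * Re c + Im g * Im c) * (D * Re c' + Im g * Im c') + M * (Im c * Im c') =
      D * (B * Re (c * cnj c') + Re (cnj g * c * c'))"
    unfolding D_def M_def cmod_power2 by (simp add: algebra_simps power2_eq_square)
  moreover have "D / M * ((x + u / D) * (y + v / D)) + w / D =
      ((D * x + u) * (D * y + v) + M * w) / (D * M)" for x y u v w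
    using nonzero by (simp add: field_simps)
  ultimately show ?thesis using nonzero by simp
qed

definition base_vector :: "real \<Rightarrow> real \<Rightarrow> complex \<Rightarrow> complex \<Rightarrow> complex \<Rightarrow> complex" where
  "base_vector t R g p d = of_real t * p + (of_real (R / 2) - cnj g) * d"

lemma base_form_complete_square:
  fixes p d p' d' g :: complex and t R B :: real
  defines "B \<equiv> (t ^ 3 - R) / 2"
  assumes nonzero: "t \<noteq> 0" "R \<noteq> 0"
  shows "(B + Re g) * Re (d * cnj d')
      - Re ((p + of_real (t\<^sup>2 / 2) * d) * cnj (p' + of_real (t\<^sup>2 / 2) * d')) / t
      + Re (base_vector t R g p d * cnj (base_vector t R g p' d')) / R =
    base_form t R g (p, d) (p', d')"
proof -
  define pp pd pgd dd where "pp = Re (p * cnj p')" and "pd = Re (p * cnj d') + Re (p' * cnj d)"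
    and "pgd = Re (cnj g * cnj p * d') + Re (cnj g * cnj p' * d)" and "dd = Re (d * cnj d')"
  have shifted: "Re ((p + of_real (t\<^sup>2 / 2) * d) * cnj (p' + of_real (t\<^sup>2 / 2) * d')) =
      pp + t\<^sup>2 / 2 * pd + t ^ 4 / 4 * dd"
    unfolding pp_def pd_def dd_def by (simp add: field_simps eval_nat_numeral)
  have vectors: "Re (base_vector t R g p d * cnj (base_vector t R g p' d')) =
      t\<^sup>2 * pp + t * R / 2 * pd - t * pgd + (R\<^sup>2 / 4 - R * Re g + (cmod g)\<^sup>2) * dd"
    unfolding base_vector_def pp_def pd_def dd_def pgd_def cmod_power2
    by (simp add: field_simps power2_eq_square)
  have "(B + Re g) * dd - (pp + t\<^sup>2 / 2 * pd + t ^ 4 / 4 * dd) / t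
      + (t\<^sup>2 * pp + t * R / 2 * pd - t * pgd + (R\<^sup>2 / 4 - R * Re g + n) * dd) / R =
    2 * B / (t * R) * pp - t / R * pgd + (B / 2 + n / R) * dd" for n
    unfolding B_def using nonzero by (simp add: field_simps eval_nat_numeral)
  thus ?thesis
    unfolding base_form.simps Let_def shifted vectors B_def[symmetric]
    unfolding pp_def[symmetric] pgd_def[symmetric] dd_def[symmetric] .
qed

lemma qk_form_blocks:
  fixes \<tau>2 R D M fibre X V A \<eta> S :: real
  assumes "\<tau>2 \<noteq> 0" "R \<noteq> 0" "D \<noteq> 0" "M \<noteq> 0"
  shows "- 1 / (4 * pi * \<tau>2\<^sup>2 * R) *
     (2 / (- (4 * pi * \<tau>2\<^sup>2 * M / D)) * (4 * pi\<^sup>2 * \<eta>)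
      + 2 * pi * (X / \<tau>2\<^sup>2 - S)
      - 2 / (4 * pi * \<tau>2\<^sup>2 * R) * (4 * pi\<^sup>2 * (\<tau>2\<^sup>2 * V + A))) =
    1 / (2 * \<tau>2\<^sup>2 * R) * (1 / \<tau>2\<^sup>2 * (D / M * \<eta> - X + A / R) + (S + V / R))"
  using assms by (simp add: field_simps power2_eq_square)

fun dslice :: "iia \<Rightarrow> iia \<Rightarrow> nspace" where
  "dslice (\<tau>2, z, q) (d\<tau>2, dz, d\<zeta>, d\<zeta>t, d\<sigma>) =
     (pair (of_real d\<tau>2) (of_real d\<tau>2 * z + of_real \<tau>2 * dz), d\<zeta>, d\<zeta>t, d\<sigma>)"

lemma slice_has_derivative: "(slice has_derivative dslice p) (at p)"
proof -
  have slice: "slice = (\<lambda>(\<tau>2, z, q). (pair (of_real \<tau>2) (of_real \<tau>2 * z), q))"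
    by (simp add: fun_eq_iff)
  have dslice: "dslice p = (\<lambda>(d\<tau>2, dz, dq).
      (pair (of_real d\<tau>2) (of_real (fst p) * dz + of_real d\<tau>2 * fst (snd p)), dq))"
    by (cases p) (simp add: fun_eq_iff add.commute)
  show ?thesis
    unfolding slice dslice case_prod_unfold by (auto intro!: derivative_eq_intros)
qed

context
  fixes chi :: nat and c_l \<tau>2 :: real and z :: complex and \<zeta> \<zeta>t :: "real^2" and \<sigma> :: real
    and p :: iia and b t R B D :: real and \<tau> g :: complex
  defines p_def: "p \<equiv> (\<tau>2, z, \<zeta>, \<zeta>t, \<sigma>)" and b_def: "b \<equiv> Re z" and t_def: "t \<equiv> Im z"
    and \<tau>_def: "\<tau> \<equiv> Complex (\<zeta> $ 0) \<tau>2"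
  defines R_def: "R \<equiv> R1 chi t \<tau>" and B_def: "B \<equiv> fibre_radius chi t \<tau>"
    and D_def: "D \<equiv> schur_complement chi t \<tau>" and g_def: "g \<equiv> instanton_coupling chi \<tau>"
  assumes c_l: "c_l = real chi / (192 * pi)" and \<tau>2_pos: "\<tau>2 > 0" and R_pos: "R > 0"
begin

lemma Im_tau: "Im \<tau> = \<tau>2" "Im \<tau> > 0"
  using \<tau>2_pos by (simp_all add: \<tau>_def)

lemma D_pos: "D > 0" and t_pos: "t > 0"
  using schur_complement_pos[OF Im_tau(2)] R1_pos_imp_pos[OF Im_tau(2)] R_pos
  by (simp_all add: R_def D_def)

lemma D_eq: "D = B + Re g" and R_eq: "R = t ^ 3 - 2 * B"
  by (simp_all add: D_def B_def g_def schur_complement_def fibre_radius_def R_def field_simps)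

lemma discriminant_pos: "B\<^sup>2 - (cmod g)\<^sup>2 > 0"
  using instanton_coupling_less_fibre_radius[OF Im_tau(2) R_pos[unfolded R_def]]
  unfolding B_def[symmetric] g_def[symmetric] by (simp add: power_strict_mono)

lemma Z_of_slice: "Z_of (slice p) $ 0 = of_real \<tau>2" "Z_of (slice p) $ 1 = of_real \<tau>2 * z"
  by (simp_all add: p_def)

lemma Z_of_slice_nonzero: "Z_of (slice p) $ 0 \<noteq> 0"
  using \<tau>2_pos by (simp add: Z_of_slice)

lemma slice_coordinates:
  "cmod (Z_of (slice p) $ 0) = \<tau>2" "modulus (slice p) = z" "axiodilaton (slice p) = \<tau>"
  using \<tau>2_pos by (simp_all add: p_def \<tau>_def axiodilaton_def)

lemma dlog_dslice: "dlog_Z0 (slice p) (dslice p X) = 0"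
  by (cases X) (simp add: dlog_Z0_def p_def)

lemma plus_form_eq:
    "plus_form p X = dual_doublet_form p X + \<i> * of_real (\<tau>2 * t\<^sup>2 / 2) * doublet_form p X"
  and minus_form_eq:
    "minus_form p X = dual_doublet_form p X - \<i> * of_real (\<tau>2 * t\<^sup>2 / 2) * doublet_form p X"
  by (simp_all add: plus_form_def minus_form_def iia_tau_def iia_t_def p_def t_def)

lemma W_tot_dslice_0:
  "W_tot (prepotential chi) chi (slice p) 0 (dslice p X) +
     of_real b * W_tot (prepotential chi) chi (slice p) 1 (dslice p X) =
   Complex (Im (minus_form p X) / \<tau>2) (- D * Re (tau_form X))"
proof -
  obtain d\<tau>2 dz d\<zeta> d\<zeta>t d\<sigma> where X_eq: "X = (d\<tau>2, dz, d\<zeta>, d\<zeta>t, d\<sigma>)" by (cases X)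
  have z_eq: "z = Complex b t" by (simp add: b_def t_def)
  note W_tot_eq = W_tot_prepotential[OF Z_of_slice_nonzero dlog_dslice, of chi X,
      unfolded slice_coordinates,
      folded b_def t_def, folded D_def]
  have Im_minus: "Im (minus_form p X) / \<tau>2 = Im (dual_doublet_form p X) / \<tau>2 -
      t\<^sup>2 / 2 * Re (doublet_form p X)"
    using \<tau>2_pos by (simp add: minus_form_eq diff_divide_distrib)
  show ?thesis
    unfolding W_tot_eq Im_minus unfolding X_eq using \<tau>2_pos
    by (simp add: complex_eq_iff p_def z_eq Re_power2 Im_power2 Re_power3 Im_power3)
      (simp add: field_simps power2_eq_square power3_eq_cube)
qed

lemma W_tot_dslice_1:
  "W_tot (prepotential chi) chi (slice p) 1 (dslice p X) =
     Complex (Re (singlet_form p X + of_real (t\<^sup>2 / 2) * tau_form X)) (- t * Re (doublet_form p X))"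
proof -
  obtain d\<tau>2 dz d\<zeta> d\<zeta>t d\<sigma> where X_eq: "X = (d\<tau>2, dz, d\<zeta>, d\<zeta>t, d\<sigma>)" by (cases X)
  have z_eq: "z = Complex b t" by (simp add: b_def t_def)
  show ?thesis
    unfolding W_tot_prepotential(2)[OF Z_of_slice_nonzero dlog_dslice, unfolded slice_coordinates] X_eq
    by (simp add: complex_eq_iff p_def z_eq Re_power2 Im_power2) (simp add: field_simps)
qed

lemma Z_of_dslice:
  "Z_of (dslice p X) $ 0 = of_real (Im (tau_form X))"
  "Z_of (dslice p X) $ 1 - of_real b * Z_of (dslice p X) $ 0 =
     Complex (- Im (doublet_form p X)) (Im (singlet_form p X + of_real (t\<^sup>2 / 2) * tau_form X) / t)"
  using t_pos
  by (cases X, simp add: p_def complex_eq_iff b_def t_def power2_eq_square field_simps)+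

lemma invertible_T_mat_slice: "invertible (T_mat (prepotential chi) chi (slice p))"
  using invertible_T_mat_prepotential[OF Z_of_slice_nonzero] D_pos t_pos
  by (simp add: slice_coordinates D_def t_def)

lemma g_N_slice:
  assumes "Z_of X $ 0 = x0" "Z_of X $ 1 - of_real b * Z_of X $ 0 = x1"
    "W_tot (prepotential chi) chi (slice p) 0 X +
      of_real b * W_tot (prepotential chi) chi (slice p) 1 X = w0"
    "W_tot (prepotential chi) chi (slice p) 1 X = w1"
    and "Z_of Y $ 0 = y0" "Z_of Y $ 1 - of_real b * Z_of Y $ 0 = y1"
    "W_tot (prepotential chi) chi (slice p) 0 Y +
      of_real b * W_tot (prepotential chi) chi (slice p) 1 Y = v0"
    "W_tot (prepotential chi) chi (slice p) 1 Y = v1"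
  shows "g_N (prepotential chi) chi (slice p) X Y =
      2 * pi * (t * Re (x1 * cnj y1) - D * Re (x0 * cnj y0)
    + Re (w1 * cnj v1) / t - Re (w0 * cnj v0) / D)"
proof -
  have nonzero: "Im (modulus (slice p)) \<noteq> 0"
    "schur_complement chi (Im (modulus (slice p))) (axiodilaton (slice p)) \<noteq> 0"
    using D_pos t_pos by (simp_all add: slice_coordinates D_def t_def)
  have Re_of_real_mult: "Re (of_real x * w) = x * Re w" for x w by simp
  show ?thesis
    unfolding g_N_prepotential[OF Z_of_slice_nonzero nonzero]
    unfolding slice_coordinates b_def[symmetric] t_def[symmetric] D_def[symmetric]
    unfolding assms(2,3,6,7) unfolding assms(1,4,5,8)
    unfolding plus_complex.sel minus_complex.sel Re_of_real_mult by simp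
qed

lemma g_N_dslice:
  "g_N (prepotential chi) chi (slice p) (dslice p X) (dslice p Y) = 2 * pi *
     ((Re ((plus_form p X - minus_form p X) * cnj (plus_form p Y - minus_form p Y)) / t ^ 3
        - Im (minus_form p X) * Im (minus_form p Y) / D) / \<tau>2\<^sup>2
      - (D * Re (tau_form X * cnj (tau_form Y))
        - Re ((singlet_form p X + of_real (t\<^sup>2 / 2) * tau_form X) *
              cnj (singlet_form p Y + of_real (t\<^sup>2 / 2) * tau_form Y)) / t))"
proof -
  have nonzero: "t \<noteq> 0" "\<tau>2 \<noteq> 0" "D \<noteq> 0" using t_pos \<tau>2_pos D_pos by auto
  have plus_minus: "plus_form p X - minus_form p X = \<i> * of_real (\<tau>2 * t\<^sup>2) * doublet_form p X" for X
    by (simp add: plus_form_eq minus_form_eq)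
  have doublet: "Re ((plus_form p X - minus_form p X) * cnj (plus_form p Y - minus_form p Y)) / t ^ 3 =
      \<tau>2\<^sup>2 * (t * Re (doublet_form p X * cnj (doublet_form p Y)))"
    unfolding plus_minus using nonzero by (simp add: field_simps eval_nat_numeral)
  have "t * Re (Complex (- u) (s / t) * cnj (Complex (- u') (s' / t))) -
      D * Re (of_real e * cnj (of_real e'))
      + Re (Complex r (- t * v) * cnj (Complex r' (- t * v'))) / t
      - Re (Complex (m / \<tau>2) (- D * d) * cnj (Complex (m' / \<tau>2) (- D * d'))) / D =
    (\<tau>2\<^sup>2 * (t * (v * v' + u * u')) - m * m' / D) / \<tau>2\<^sup>2 - (D * (d * d' + e * e') -
      (r * r' + s * s') / t)"
    for u u' s s' e e' r r' v v' m m' d d' :: real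
    using nonzero by (simp add: field_simps power2_eq_square)
  thus ?thesis
    unfolding g_N_slice[OF Z_of_dslice W_tot_dslice_0 W_tot_dslice_1 Z_of_dslice W_tot_dslice_0
        W_tot_dslice_1]
      doublet
    unfolding Re_mult_cnj_eq by simp
qed

lemma V_field_slice:
  "Z_of (V_field (slice p)) $ 0 = 2 * \<i> * of_real \<tau>2"
  "Z_of (V_field (slice p)) $ 1 - of_real b * Z_of (V_field (slice p)) $ 0 = of_real (- 2 * \<tau>2 * t)"
  by (simp_all add: V_field_def p_def complex_eq_iff b_def t_def algebra_simps)

lemma W_tot_V_field_slice:
  "W_tot (prepotential chi) chi (slice p) 0 (V_field (slice p)) +
     of_real b * W_tot (prepotential chi) chi (slice p) 1 (V_field (slice p)) =
     of_real (- 2 * \<tau>2 * Im g)"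
  "W_tot (prepotential chi) chi (slice p) 1 (V_field (slice p)) = 0"
  by (simp_all add: W_tot_V_field[OF Z_of_slice_nonzero] slice_coordinates g_def Im_tau)

lemma g_N_V_field_dslice:
  "g_N (prepotential chi) chi (slice p) (V_field (slice p)) (dslice p X) =
     4 * pi * (\<tau>2 * t\<^sup>2 * Im (doublet_form p X) + Im g * Im (minus_form p X) / D)"
  unfolding g_N_slice[OF V_field_slice W_tot_V_field_slice Z_of_dslice W_tot_dslice_0 W_tot_dslice_1]
  using \<tau>2_pos D_pos by (simp add: field_simps power2_eq_square)

lemma g_N_V_field_V_field:
  "g_N (prepotential chi) chi (slice p) (V_field (slice p)) (V_field (slice p)) =
     8 * pi * \<tau>2\<^sup>2 * (t ^ 3 - D - (Im g)\<^sup>2 / D)"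
  unfolding g_N_slice[OF V_field_slice W_tot_V_field_slice V_field_slice W_tot_V_field_slice]
  using D_pos by (simp add: field_simps power2_eq_square power3_eq_cube)

lemma f_fun_slice: "f_fun (prepotential chi) chi c_l (slice p) = 4 * pi * \<tau>2\<^sup>2 * R"
  unfolding f_fun_prepotential[OF Z_of_slice_nonzero c_l] slice_coordinates R_def t_def by simp

lemma f3_fun_slice:
  "f3_fun (prepotential chi) chi c_l (slice p) = - (4 * pi * \<tau>2\<^sup>2 * (B\<^sup>2 - (cmod g)\<^sup>2) / D)"
proof -
  have discriminant: "B\<^sup>2 - (cmod g)\<^sup>2 = (2 * B - D) * D - (Im g)\<^sup>2"
    unfolding cmod_power2 D_eq by (simp add: algebra_simps power2_eq_square)
  show ?thesis
    unfolding f3_fun_def f_fun_slice g_N_V_field_V_field R_eq discriminant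
    using D_pos by (simp add: field_simps power2_eq_square)
qed

lemma qmap_metric_defined_slice: "qmap_metric_defined (prepotential chi) chi c_l p"
  unfolding qmap_metric_defined_def f_fun_slice f3_fun_slice
  using invertible_T_mat_slice R_pos \<tau>2_pos D_pos discriminant_pos by simp

lemma theta3_slice:
  "theta3 (prepotential chi) chi (slice p) (dslice p X) = - 2 * pi * Re (plus_form p X)"
proof -
  obtain d\<tau>2 dz d\<zeta> d\<zeta>t d\<sigma> where X_eq: "X = (d\<tau>2, dz, d\<zeta>, d\<zeta>t, d\<sigma>)" by (cases X)
  have inst_eta: "inst_eta q (slice p) (dslice p X) = 0" for q by (simp add: inst_eta_def dlog_dslice)
  define h where "h = \<i> *s Z_of (dslice p X)"
  have h_eq: "(h $ 1 - z * h $ 0) / of_real \<tau>2 = \<i> * dz" "Re (cnj (of_real \<tau>2) * h $ 0) = 0"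
    using \<tau>2_pos by (simp_all add: h_def X_eq p_def field_simps)
  have "frechet_derivative (r_squared (prepotential chi)) (at (Z_of (slice p))) h =
      2 * \<tau>2\<^sup>2 * t\<^sup>2 * Re dz"
    unfolding frechet_derivativeI[OF r_squared_has_derivative[OF Z_of_slice_nonzero]] slice_coordinates
    unfolding Z_of_slice h_eq by (simp add: t_def)
  hence "d_c (r_squared (prepotential chi)) (Z_of (slice p)) (Z_of (dslice p X)) =
      - 2 * \<tau>2\<^sup>2 * t\<^sup>2 * Re dz"
    unfolding d_c_def del_def delbar_def h_def[symmetric] by simp
  thus ?thesis
    unfolding theta3_def inst_eta sum_UNIV_2 plus_form_eq unfolding X_eq p_def
    by (simp add: field_simps power2_eq_square)
qed

lemma eta_form_slice:
  "eta_form (prepotential chi) chi (slice p) (dslice p X) =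
     - 2 * pi * (Re (minus_form p X) + Im g * Im (minus_form p X) / D)"
  unfolding eta_form_def theta3_slice g_N_V_field_dslice plus_form_eq minus_form_eq
  using D_pos by (simp add: field_simps)

lemma omega12_slice:
  "omega12 (prepotential chi) chi (slice p) (V_field (slice p)) (dslice p X) =
     4 * pi * Complex (- \<tau>2 * Re (base_vector t R g (singlet_form p X) (tau_form X)))
     (Im (plus_form p X))"
proof -
  let ?W = "\<lambda>i. W_tot (prepotential chi) chi (slice p) i (dslice p X)"
  have "z = of_real b + \<i> * of_real t" by (simp add: complex_eq_iff b_def t_def)
  hence "omega12 (prepotential chi) chi (slice p) (V_field (slice p)) (dslice p X) =
     2 * of_real pi * (2 * \<i> * of_real \<tau>2 * ((?W 0 + of_real b * ?W 1) + \<i> * of_real t * ?W 1)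
       + of_real (Im (tau_form X)) * of_real (2 * \<tau>2 * Im g))"
    using W_tot_V_field_slice
    unfolding omega12_def sum_UNIV_2 Z_of_dslice
    by (simp add: V_field_def Z_of_slice algebra_simps)
  also have "\<dots> = 4 * pi *
      Complex (- \<tau>2 * Re (base_vector t R g (singlet_form p X) (tau_form X))) (Im (plus_form p X))"
    unfolding W_tot_dslice_0
    unfolding W_tot_dslice_1 base_vector_def D_eq R_eq plus_form_eq minus_form_eq
    using \<tau>2_pos by (simp add: complex_eq_iff field_simps power2_eq_square power3_eq_cube)
  finally show ?thesis .
qed

lemma theta1_slice:
    "theta1 (prepotential chi) chi (slice p) (dslice p X) = 2 * pi * Im (plus_form p X)"
  and theta2_slice:
    "theta2 (prepotential chi) chi (slice p) (dslice p X) =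
      2 * pi * \<tau>2 * Re (base_vector t R g (singlet_form p X) (tau_form X))"
  unfolding theta1_def theta2_def omega12_slice by simp_all

lemma theta0_slice:
  "theta0 (prepotential chi) chi c_l (slice p) (dslice p X) =
     - 2 * pi * \<tau>2 * Im (base_vector t R g (singlet_form p X) (tau_form X))"
proof -
  obtain d\<tau>2 dz d\<zeta> d\<zeta>t d\<sigma> where X_eq: "X = (d\<tau>2, dz, d\<zeta>, d\<zeta>t, d\<sigma>)" by (cases X)
  have tangent: "(Z_of (dslice p X) $ 1 - z * Z_of (dslice p X) $ 0) / of_real \<tau>2 = dz"
    "Re (cnj (of_real \<tau>2) * Z_of (dslice p X) $ 0) / \<tau>2 = d\<tau>2"
    "Complex (zeta_of (dslice p X) $ 0) d\<tau>2 = tau_form X"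
    using \<tau>2_pos by (simp_all add: X_eq p_def)
  have "theta0 (prepotential chi) chi c_l (slice p) (dslice p X) =
      - 1 / 2 * (4 * pi * (\<tau>2\<^sup>2 * (t\<^sup>2 * Im dz +
        (3 / 2 * (t ^ 3 / 3 - R) * Im (tau_form X) - Im (cnj g * tau_form X)) / \<tau>2) +
      2 * (\<tau>2 * d\<tau>2) * R))"
    unfolding theta0_def frechet_derivativeI[OF f_fun_has_derivative[OF Z_of_slice_nonzero c_l]]
      slice_coordinates R_def g_def t_def
    unfolding Z_of_slice tangent Im_tau ..
  also have "\<dots> = - 2 * pi * \<tau>2 * Im (base_vector t R g (singlet_form p X) (tau_form X))"
    unfolding base_vector_def X_eq p_def using \<tau>2_pos
    by (simp add: t_def[symmetric] field_simps power2_eq_square power3_eq_cube)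
  finally show ?thesis .
qed

theorem qmap_metric_eq_coframe_metric:
  "qmap_metric (prepotential chi) chi c_l p X Y =
     coframe_metric \<tau>2 t R g (coframe p X) (coframe p Y)"
proof -
  let ?a = "plus_form p" and ?c = "minus_form p" and ?M = "B\<^sup>2 - (cmod g)\<^sup>2"
  let ?v = "\<lambda>X. base_vector t R g (singlet_form p X) (tau_form X)"
  let ?\<eta> = "\<lambda>X. Re (?c X) + Im g * Im (?c X) / D"
  have nonzero: "\<tau>2 \<noteq> 0" "t \<noteq> 0" "R \<noteq> 0" "D \<noteq> 0" "?M \<noteq> 0"
    using \<tau>2_pos t_pos R_pos D_pos discriminant_pos by auto
  have B_eq: "(t ^ 3 - R) / 2 = B" unfolding R_eq by simp
  let ?X = "Re ((?a X - ?c X) * cnj (?a Y - ?c Y)) / t ^ 3 - Im (?c X) * Im (?c Y) / D"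
  let ?S = "D * Re (tau_form X * cnj (tau_form Y)) -
    Re ((singlet_form p X + of_real (t\<^sup>2 / 2) * tau_form X) *
        cnj (singlet_form p Y + of_real (t\<^sup>2 / 2) * tau_form Y)) / t"
  have "qmap_metric (prepotential chi) chi c_l p X Y = - 1 / (4 * pi * \<tau>2\<^sup>2 * R) *
     (2 / (- (4 * pi * \<tau>2\<^sup>2 * ?M / D)) * (4 * pi\<^sup>2 * (?\<eta> X * ?\<eta> Y)) + 2 * pi * (?X / \<tau>2\<^sup>2 - ?S)
      - 2 / (4 * pi * \<tau>2\<^sup>2 * R) * (4 * pi\<^sup>2 *
          (\<tau>2\<^sup>2 * Re (?v X * cnj (?v Y)) + Re (?a X * cnj (?a Y)))))"
    unfolding qmap_metric_def frechet_derivativeI[OF slice_has_derivative] qk_form_def f_fun_slice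
        f3_fun_slice
      eta_form_slice g_N_dslice theta0_slice theta1_slice theta2_slice theta3_slice Re_mult_cnj_eq
    by (simp add: power2_eq_square algebra_simps)
  also have "\<dots> = 1 / (2 * \<tau>2\<^sup>2 * R) *
      (1 / \<tau>2\<^sup>2 * (D / ?M * (?\<eta> X * ?\<eta> Y) - ?X + Re (?a X * cnj (?a Y)) / R) +
      (?S + Re (?v X * cnj (?v Y)) / R))"
    by (rule qk_form_blocks[OF nonzero(1,3-5)])
  also have "?S + Re (?v X * cnj (?v Y)) / R =
      base_form t R g (singlet_form p X, tau_form X) (singlet_form p Y, tau_form Y)"
    using base_form_complete_square[OF nonzero(2,3), where g = g] unfolding B_eq D_eq[symmetric] .
  also have "D / ?M * (?\<eta> X * ?\<eta> Y) - ?X + Re (?a X * cnj (?a Y)) / R =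
      fibre_form t R g (?a X, ?c X) (?a Y, ?c Y)"
    using fibre_form_complete_square[OF nonzero(4,5)[unfolded D_eq], of "?c X" "?c Y"]
    unfolding fibre_form.simps Let_def B_eq D_eq[symmetric] by (simp only:)
  finally show ?thesis unfolding coframe_def coframe_metric.simps .
qed

end

section \<open>Positivity\<close>

lemma bilinear_symmetricI:
  assumes "\<And>x y. f x y = f y x" "\<And>y. linear (\<lambda>x. f x y)"
  shows "bilinear f"
proof -
  have "f x = (\<lambda>y. f y x)" for x by (intro ext assms(1))
  hence "linear (f x)" for x using assms(2) by metis
  thus ?thesis using assms(2) by (auto simp only: bilinear_def)
qed

lemma fibre_form_symmetric: "fibre_form t R g x y = fibre_form t R g y x"
  by (cases x; cases y) (simp add: Let_def algebra_simps)

lemma base_form_symmetric: "base_form t R g x y = base_form t R g y x"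
  by (cases x; cases y) (simp add: Let_def algebra_simps)

lemma linear_fibre_form: "linear (\<lambda>x. fibre_form t R g x y)"
proof (rule linearI)
  show "fibre_form t R g (x + x') y = fibre_form t R g x y + fibre_form t R g x' y" for x x'
    by (cases x; cases x'; cases y)
      (simp add: Let_def algebra_simps add_divide_distrib diff_divide_distrib)
  show "fibre_form t R g (r *\<^sub>R x) y = r *\<^sub>R fibre_form t R g x y" for r x
    by (cases x; cases y)
      (simp add: Let_def scaleR_prod_def algebra_simps add_divide_distrib diff_divide_distrib)
qed

lemma linear_base_form: "linear (\<lambda>x. base_form t R g x y)"
proof (rule linearI)
  show "base_form t R g (x + x') y = base_form t R g x y + base_form t R g x' y" for x x'
    by (cases x; cases x'; cases y)
      (simp add: Let_def algebra_simps add_divide_distrib diff_divide_distrib)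
  show "base_form t R g (r *\<^sub>R x) y = r *\<^sub>R base_form t R g x y" for r x
    by (cases x; cases y)
      (simp add: Let_def scaleR_prod_def algebra_simps add_divide_distrib diff_divide_distrib)
qed

lemma coframe_metric_symmetric: "coframe_metric \<tau>2 t R g x y = coframe_metric \<tau>2 t R g y x"
  by (metis coframe_metric.simps fibre_form_symmetric base_form_symmetric prod.exhaust)

lemma bilinear_coframe_metric: "bilinear (coframe_metric \<tau>2 t R g)"
proof (rule bilinear_symmetricI[OF coframe_metric_symmetric])
  fix y
  have "coframe_metric \<tau>2 t R g = (\<lambda>x y. 1 / (2 * \<tau>2\<^sup>2 * R) *
      (1 / \<tau>2\<^sup>2 * fibre_form t R g (fst x) (fst y) + base_form t R g (snd x) (snd y)))"
    by (auto simp: fun_eq_iff)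
  moreover have "linear (\<lambda>x. fibre_form t R g (fst x) (fst y))"
      "linear (\<lambda>x. base_form t R g (snd x) (snd y))"
    using linear_compose[OF linear_fst linear_fibre_form] linear_compose[OF linear_snd linear_base_form]
    by (simp_all only: o_def)
  ultimately show "linear (\<lambda>x. coframe_metric \<tau>2 t R g x y)"
    by (simp only:) (auto intro!: linear_compose_add linear_compose_scale_right simp flip:
        real_scaleR_def)
qed

lemma Re_mult_cnj_self: "Re (x * cnj x) = (cmod x)\<^sup>2"
  by (simp only: complex_norm_square[symmetric] Re_complex_of_real)

lemma square_add_le_weighted:
  fixes x y r s :: real
  assumes "r > 0" "s > 0"
  shows "(x + y)\<^sup>2 \<le> (r + s) * (x\<^sup>2 / r + y\<^sup>2 / s)"
proof -
  have "(r + s) * (x\<^sup>2 / r + y\<^sup>2 / s) - (x + y)\<^sup>2 = (s * x - r * y)\<^sup>2 / (r * s)"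
    using assms by (simp add: field_simps power2_eq_square)
  moreover have "\<dots> \<ge> 0" using assms by simp
  ultimately show ?thesis by simp
qed

lemma fibre_form_pos:
  assumes t_pos: "t > 0" and R_pos: "R > 0" and g_less: "cmod g < (t ^ 3 - R) / 2"
    and nonzero: "(a, c) \<noteq> 0"
  shows "fibre_form t R g (a, c) (a, c) > 0"
proof -
  define B s where "B = (t ^ 3 - R) / 2" and "s = B + cmod g"
  have g_less_B: "cmod g < B" and s_bounds: "s > 0" "R + s < t ^ 3"
    using g_less by (simp_all add: B_def s_def field_simps add_pos_nonneg[OF _ norm_ge_zero])
      (use norm_ge_zero[of g] in linarith)+
  let ?weighted = "(cmod a)\<^sup>2 / R + (cmod c)\<^sup>2 / s"
  have "- Re (cnj g * c * c) \<le> cmod g * (cmod c)\<^sup>2"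
    using abs_Re_le_cmod[of "cnj g * c * c"] by (simp add: norm_mult power2_eq_square)
  hence "(B - cmod g) * (cmod c)\<^sup>2 \<le> B * Re (c * cnj c) + Re (cnj g * c * c)"
    unfolding Re_mult_cnj_self by (simp add: algebra_simps)
  hence "(B - cmod g) * (cmod c)\<^sup>2 / ((B - cmod g) * s) \<le>
      (B * Re (c * cnj c) + Re (cnj g * c * c)) / ((B - cmod g) * s)"
    using g_less_B s_bounds by (intro divide_right_mono) auto
  moreover have "(B - cmod g) * s = B\<^sup>2 - (cmod g)\<^sup>2"
    by (simp add: s_def power2_eq_square algebra_simps)
  moreover have "(B - cmod g) * (cmod c)\<^sup>2 / ((B - cmod g) * s) = (cmod c)\<^sup>2 / s" using g_less_B by simp
  ultimately have "(cmod c)\<^sup>2 / s \<le> (B * Re (c * cnj c) + Re (cnj g * c * c)) / (B\<^sup>2 - (cmod g)\<^sup>2)"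
    by (simp only:)
  moreover have "(cmod (a - c))\<^sup>2 / t ^ 3 \<le> (R + s) / t ^ 3 * ?weighted"
  proof -
    have "(cmod (a - c))\<^sup>2 \<le> (cmod a + cmod c)\<^sup>2" by (intro power_mono norm_triangle_ineq4) auto
    also have "\<dots> \<le> (R + s) * ?weighted" by (rule square_add_le_weighted[OF R_pos s_bounds(1)])
    finally show ?thesis using t_pos by (simp add: divide_right_mono)
  qed
  ultimately have "fibre_form t R g (a, c) (a, c) \<ge> (1 - (R + s) / t ^ 3) * ?weighted"
    unfolding fibre_form.simps Let_def B_def[symmetric] Re_mult_cnj_self by (simp add: algebra_simps)
  moreover have "?weighted > 0"
    using nonzero R_pos s_bounds
    by (cases "a = 0") (auto simp: zero_prod_def add_pos_nonneg add_nonneg_pos)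
  moreover have "1 - (R + s) / t ^ 3 > 0" using t_pos s_bounds by simp
  ultimately show ?thesis by (meson less_le_trans mult_pos_pos)
qed

lemma quadratic_form_pos:
  fixes \<alpha> \<beta> \<gamma> x y :: real
  assumes "\<alpha> > 0" "\<beta>\<^sup>2 < \<alpha> * \<gamma>" "x \<noteq> 0 \<or> y \<noteq> 0"
  shows "\<alpha> * x\<^sup>2 - 2 * \<beta> * (x * y) + \<gamma> * y\<^sup>2 > 0"
proof -
  have "\<alpha> * (\<alpha> * x\<^sup>2 - 2 * \<beta> * (x * y) + \<gamma> * y\<^sup>2) = (\<alpha> * x - \<beta> * y)\<^sup>2 + (\<alpha> * \<gamma> - \<beta>\<^sup>2) * y\<^sup>2"
    by (simp add: power2_eq_square algebra_simps)
  also have "\<dots> > 0"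
    using assms by (cases "y = 0") (auto intro!: add_nonneg_pos)
  finally show ?thesis using assms(1) by (simp add: zero_less_mult_iff)
qed

lemma base_form_pos:
  assumes t_pos: "t > 0" and R_pos: "R > 0" and g_less: "cmod g < (t ^ 3 - R) / 2"
    and nonzero: "(p, d) \<noteq> 0"
  shows "base_form t R g (p, d) (p, d) > 0"
proof -
  define B r where "B = (t ^ 3 - R) / 2" and "r = Re (cnj g * cnj p * d)"
  define \<alpha> \<beta> \<gamma> where "\<alpha> = 2 * B / (t * R)" and "\<beta> = t / R * cmod g" and "\<gamma> = B / 2 + (cmod g)\<^sup>2 / R"
  have g_less_B: "cmod g < B" "B > 0" using g_less norm_ge_zero[of g] unfolding B_def by linarith+
  have "\<alpha> * \<gamma> - \<beta>\<^sup>2 = (B\<^sup>2 - (cmod g)\<^sup>2) / (t * R)"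
    unfolding \<alpha>_def \<beta>_def \<gamma>_def B_def using t_pos R_pos
    by (simp add: field_simps power2_eq_square power3_eq_cube)
  moreover have "B\<^sup>2 - (cmod g)\<^sup>2 > 0" using g_less_B by (simp add: power_strict_mono)
  ultimately have "\<beta>\<^sup>2 < \<alpha> * \<gamma>" using t_pos R_pos
    by (metis diff_gt_0_iff_gt divide_pos_pos mult_pos_pos)
  moreover have "\<alpha> > 0" using g_less_B t_pos R_pos by (simp add: \<alpha>_def)
  moreover have "cmod p \<noteq> 0 \<or> cmod d \<noteq> 0" using nonzero by (auto simp: zero_prod_def)
  ultimately have "\<alpha> * (cmod p)\<^sup>2 - 2 * \<beta> * (cmod p * cmod d) + \<gamma> * (cmod d)\<^sup>2 > 0"
    by (intro quadratic_form_pos)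
  moreover have "t / R * r \<le> \<beta> * (cmod p * cmod d)"
  proof -
    have "r \<le> cmod g * (cmod p * cmod d)"
      using complex_Re_le_cmod[of "cnj g * cnj p * d"] by (simp add: r_def norm_mult)
    thus ?thesis unfolding \<beta>_def mult.assoc using t_pos R_pos
      by (simp add: mult_left_mono divide_right_mono)
  qed
  ultimately show ?thesis
    unfolding base_form.simps Let_def B_def[symmetric] r_def[symmetric]
      \<alpha>_def[symmetric] \<gamma>_def[symmetric] Re_mult_cnj_self distrib_left
    by linarith
qed

lemma coframe_metric_pos:
  assumes "\<tau>2 > 0" "t > 0" "R > 0" "cmod g < (t ^ 3 - R) / 2" "w \<noteq> 0"
  shows "coframe_metric \<tau>2 t R g w w > 0"
proof -
  obtain x u where w_eq: "w = (x, u)" by (cases w)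
  have fibre: "fibre_form t R g x x > 0" if "x \<noteq> 0"
    using fibre_form_pos[OF assms(2-4)] that by (cases x) blast
  have base: "base_form t R g u u > 0" if "u \<noteq> 0"
    using base_form_pos[OF assms(2-4)] that by (cases u) blast
  have "fibre_form t R g x x \<ge> 0" "base_form t R g u u \<ge> 0"
    using fibre base linear_0[OF linear_fibre_form] linear_0[OF linear_base_form]
    by (metis less_imp_le order_refl)+
  hence "1 / \<tau>2\<^sup>2 * fibre_form t R g x x + base_form t R g u u > 0"
    using fibre base assms(1,5)
    by (cases "x = 0") (auto simp: w_eq zero_prod_def add_pos_nonneg add_nonneg_pos)
  thus ?thesis unfolding w_eq coframe_metric.simps using assms(1,3) by simp
qed

lemma linear_coframe: "linear (coframe p)"
proof (rule linearI)
  show "coframe p (X + Y) = coframe p X + coframe p Y" for X Y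
    by (cases p; cases X; cases Y)
      (simp add: coframe_def plus_form_def minus_form_def complex_eq_iff algebra_simps
        add_divide_distrib diff_divide_distrib)
  show "coframe p (r *\<^sub>R X) = r *\<^sub>R coframe p X" for r X
    by (cases p; cases X)
      (simp add: coframe_def plus_form_def minus_form_def complex_eq_iff scaleR_prod_def algebra_simps
        add_divide_distrib diff_divide_distrib)
qed

lemma coframe_eq_0_imp:
  assumes pos: "Im (iia_tau p) > 0" "iia_t p > 0" and zero: "coframe p X = 0"
  shows "X = 0"
proof -
  obtain \<tau>2 z \<zeta> \<zeta>t \<sigma> where p_eq: "p = (\<tau>2, z, \<zeta>, \<zeta>t, \<sigma>)" by (cases p)
  obtain d\<tau>2 dz d\<zeta> d\<zeta>t d\<sigma> where X_eq: "X = (d\<tau>2, dz, d\<zeta>, d\<zeta>t, d\<sigma>)" by (cases X)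
  have p_pos: "\<tau>2 > 0" "Im z > 0" using pos by (simp_all add: p_eq iia_tau_def iia_t_def)
  have forms: "plus_form p X = 0" "minus_form p X = 0" "singlet_form p X = 0" "tau_form X = 0"
    using zero by (simp_all add: coframe_def zero_prod_def)
  have "plus_form p X - minus_form p X = \<i> * of_real (Im (iia_tau p) * (iia_t p)\<^sup>2) * doublet_form p X"
    by (simp add: plus_form_def minus_form_def)
  hence doublet: "doublet_form p X = 0" unfolding forms using pos by simp
  hence dual_doublet: "dual_doublet_form p X = 0" using forms(1) by (simp add: plus_form_def)
  have "d\<zeta> $ 0 = 0" "d\<tau>2 = 0" using forms(4) by (simp_all add: X_eq complex_eq_iff)
  moreover from this have "d\<zeta> $ 1 = 0" "Re dz = 0"
    using doublet p_pos by (simp_all add: p_eq X_eq complex_eq_iff)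
  moreover from calculation have "d\<zeta>t $ 1 = 0" "Im dz = 0"
    using forms(3) p_pos by (simp_all add: p_eq X_eq complex_eq_iff)
  moreover from calculation have "d\<zeta>t $ 0 = 0" "d\<sigma> = 0"
    using dual_doublet p_pos by (auto simp: p_eq X_eq complex_eq_iff)
  ultimately show ?thesis by (simp add: X_eq zero_prod_def vec2_eq_iff complex_eq_iff)
qed

lemma N_tilde_iff:
  "p \<in> N_tilde chi \<longleftrightarrow> Im (iia_tau p) > 0 \<and> iia_t p > 0 \<and>
     R1 chi (iia_t p) (iia_tau p) > 0 \<and> R2 chi (iia_t p) (iia_tau p) > 0"
  by (cases p) (simp add: N_tilde_def iia_tau_def iia_t_def)

lemma iia_space_iff: "p \<in> iia_space \<longleftrightarrow> Im (iia_tau p) > 0 \<and> iia_t p > 0"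
  by (cases p) (simp add: iia_space_def iia_tau_def iia_t_def)

context
  fixes chi :: nat and c_l :: real
  assumes c_l: "c_l = real chi / (192 * pi)"
begin

lemma qmap_metric_defined_N_tilde:
  assumes "p \<in> N_tilde chi"
  shows "qmap_metric_defined (prepotential chi) chi c_l p"
  using assms qmap_metric_defined_slice[OF c_l]
  by (cases p) (simp add: N_tilde_iff iia_tau_def iia_t_def)

lemma qmap_metric_N_tilde:
  assumes "p \<in> N_tilde chi"
  shows "qmap_metric (prepotential chi) chi c_l p X Y =
     coframe_metric (Im (iia_tau p)) (iia_t p) (R1 chi (iia_t p) (iia_tau p))
       (instanton_coupling chi (iia_tau p)) (coframe p X) (coframe p Y)"
  using assms qmap_metric_eq_coframe_metric[OF c_l]
  by (cases p) (simp add: N_tilde_iff iia_tau_def iia_t_def)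

theorem positive_definite_qmap_metric:
  assumes p_in: "p \<in> N_tilde chi"
  shows "positive_definite (qmap_metric (prepotential chi) chi c_l p)"
proof -
  define G where "G = coframe_metric (Im (iia_tau p)) (iia_t p) (R1 chi (iia_t p) (iia_tau p))
    (instanton_coupling chi (iia_tau p))"
  have metric: "qmap_metric (prepotential chi) chi c_l p = (\<lambda>X Y. G (coframe p X) (coframe p Y))"
    unfolding G_def by (intro ext qmap_metric_N_tilde p_in)
  have pos: "G (coframe p X) (coframe p X) > 0" if "X \<noteq> 0" for X
    unfolding G_def
    using p_in coframe_eq_0_imp[of p X] that instanton_coupling_less_fibre_radius[of "iia_tau p" chi
        "iia_t p"]
    by (intro coframe_metric_pos) (auto simp: N_tilde_iff fibre_radius_def)
  have "bilinear G" unfolding G_def by (rule bilinear_coframe_metric)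
  hence "linear (G w)" "linear (\<lambda>v. G v w)" for w
    by (simp_all add: bilinear_def del: split_paired_All)
  from this[THEN linear_compose[OF linear_coframe[of p]]]
  have "bilinear (\<lambda>X Y. G (coframe p X) (coframe p Y))"
    by (simp add: bilinear_def o_def)
  moreover have "G x y = G y x" for x y
    unfolding G_def by (rule coframe_metric_symmetric)
  ultimately show ?thesis
    unfolding metric positive_definite_def using pos by blast
qed

end


section \<open>S-duality covariance\<close>

fun scale_coframe :: "complex \<Rightarrow> (complex \<times> complex) \<times> (complex \<times> complex) \<Rightarrow>
    (complex \<times> complex) \<times> (complex \<times> complex)" where
  "scale_coframe j ((a, c), (p, d)) = ((a / j, c / j), (p, d / j\<^sup>2))"

lemma Re_divide_mult_cnj_divide: "Re (x / j * cnj (y / j)) = Re (x * cnj y) / (cmod j)\<^sup>2"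
proof -
  have "x / j * cnj (y / j) = x * cnj y / of_real ((cmod j)\<^sup>2)"
    unfolding complex_norm_square by simp
  thus ?thesis by (simp only: Re_divide_of_real)
qed

context
  fixes j g :: complex and n :: real
  assumes j_nonzero: "j \<noteq> 0"
  defines n_def: "n \<equiv> cmod j"
begin

lemma cnj_twist_divide: "cnj (of_real n ^ 3 * (cnj j / j) * g) / j\<^sup>2 = of_real n * cnj g"
proof -
  have "cnj (of_real n ^ 3 * (cnj j / j) * g) / j\<^sup>2 = of_real n ^ 3 * cnj g / (j * cnj j)"
    using j_nonzero by (simp add: power2_eq_square)
  also have "j * cnj j = of_real n ^ 2" by (simp only: n_def complex_norm_square flip: of_real_power)
  finally show ?thesis using j_nonzero by (simp add: n_def power2_eq_square power3_eq_cube)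
qed

lemma norm_twist: "cmod (of_real n ^ 3 * (cnj j / j) * g) = n ^ 3 * cmod g"
  using j_nonzero by (simp add: n_def norm_mult norm_divide norm_power)

lemma fibre_form_scale:
  "fibre_form (n * t) (n ^ 3 * R) (of_real n ^ 3 * (cnj j / j) * g) (a / j, c / j) (a' / j, c' / j) =
     fibre_form t R g (a, c) (a', c') / n ^ 5"
proof -
  have n_pos: "n > 0" using j_nonzero by (simp add: n_def)
  have "cnj (of_real n ^ 3 * (cnj j / j) * g) * (c / j) * (c' / j) =
      (cnj (of_real n ^ 3 * (cnj j / j) * g) / j\<^sup>2) * (c * c')"
    by (simp add: power2_eq_square)
  hence twist: "Re (cnj (of_real n ^ 3 * (cnj j / j) * g) * (c / j) * (c' / j)) =
      n * Re (cnj g * c * c')"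
    unfolding cnj_twist_divide by (simp add: mult.assoc)
  have "((n * t) ^ 3 - n ^ 3 * R) / 2 = n ^ 3 * ((t ^ 3 - R) / 2)"
    by (simp add: power_mult_distrib algebra_simps)
  moreover have "(n ^ 3 * B * (x / n\<^sup>2) + n * y) / ((n ^ 3 * B)\<^sup>2 - (n ^ 3 * m)\<^sup>2) =
      (B * x + y) / (B\<^sup>2 - m\<^sup>2) / n ^ 5"
    for B x y m
  proof -
    have "n ^ 3 * B * (x / n\<^sup>2) + n * y = n * (B * x + y)"
      using n_pos by (simp add: field_simps power2_eq_square power3_eq_cube)
    moreover have "(n ^ 3 * B)\<^sup>2 - (n ^ 3 * m)\<^sup>2 = n * ((B\<^sup>2 - m\<^sup>2) * n ^ 5)"
      by (simp add: algebra_simps eval_nat_numeral)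
    ultimately show ?thesis using n_pos by simp
  qed
  moreover have "x / n\<^sup>2 / (n * t) ^ 3 = x / t ^ 3 / n ^ 5" "x / n\<^sup>2 / (n ^ 3 * R) = x / R / n ^ 5"
    for x
    using n_pos by (simp_all add: field_simps eval_nat_numeral)
  ultimately show ?thesis
    unfolding fibre_form.simps Let_def norm_twist twist diff_divide_distrib[symmetric]
      Re_divide_mult_cnj_divide n_def[symmetric]
    by (simp only: add_divide_distrib diff_divide_distrib[of _ _ "n ^ 5"])
qed

lemma base_form_scale:
  "base_form (n * t) (n ^ 3 * R) (of_real n ^ 3 * (cnj j / j) * g) (p, d / j\<^sup>2) (p', d' / j\<^sup>2) =
     base_form t R g (p, d) (p', d') / n"
proof -
  have n_pos: "n > 0" using j_nonzero by (simp add: n_def)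
  have twist: "Re (cnj (of_real n ^ 3 * (cnj j / j) * g) * cnj q * (e / j\<^sup>2)) =
      n * Re (cnj g * cnj q * e)" for q e
  proof -
    have "cnj (of_real n ^ 3 * (cnj j / j) * g) * cnj q * (e / j\<^sup>2) =
        (cnj (of_real n ^ 3 * (cnj j / j) * g) / j\<^sup>2) * (cnj q * e)"
      by simp
    thus ?thesis unfolding cnj_twist_divide by (simp add: mult.assoc)
  qed
  have norm_d: "Re (d / j\<^sup>2 * cnj (d' / j\<^sup>2)) = Re (d * cnj d') / n ^ 4"
    unfolding Re_divide_mult_cnj_divide by (simp add: n_def norm_power flip: power_mult)
  have "((n * t) ^ 3 - n ^ 3 * R) / 2 = n ^ 3 * ((t ^ 3 - R) / 2)"
    by (simp add: power_mult_distrib algebra_simps)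
  moreover have "2 * (n ^ 3 * B) / (n * t * (n ^ 3 * R)) * x = 2 * B / (t * R) * x / n" for B x
    using n_pos by simp
  moreover have "n * t / (n ^ 3 * R) * (n * x) = t / R * x / n" for x
    using n_pos by (simp add: power3_eq_cube)
  moreover have "(n ^ 3 * B / 2 + (n ^ 3 * m)\<^sup>2 / (n ^ 3 * R)) * (x / n ^ 4) =
      (B / 2 + m\<^sup>2 / R) * x / n"
    for B m x
  proof -
    have "n ^ 3 * B / 2 + (n ^ 3 * m)\<^sup>2 / (n ^ 3 * R) = n ^ 3 * (B / 2 + m\<^sup>2 / R)"
      using n_pos by (simp add: distrib_left power2_eq_square)
    moreover have "n ^ 4 = n ^ 3 * n" by (simp add: eval_nat_numeral)
    ultimately show ?thesis using n_pos by simp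
  qed
  ultimately show ?thesis
    unfolding base_form.simps Let_def norm_twist twist norm_d distrib_left[of n, symmetric]
    by (simp only: add_divide_distrib[of _ _ n] diff_divide_distrib[of _ _ n])
qed

lemma coframe_metric_scale:
  "coframe_metric (\<tau>2 / n\<^sup>2) (n * t) (n ^ 3 * R) (of_real n ^ 3 * (cnj j / j) * g)
     (scale_coframe j x) (scale_coframe j y) = coframe_metric \<tau>2 t R g x y"
proof -
  have n_pos: "n > 0" using j_nonzero by (simp add: n_def)
  hence weights: "1 / (2 * (\<tau>2 / n\<^sup>2)\<^sup>2 * (n ^ 3 * R)) = n * (1 / (2 * \<tau>2\<^sup>2 * R))"
    "1 / (\<tau>2 / n\<^sup>2)\<^sup>2 = n ^ 4 * (1 / \<tau>2\<^sup>2)"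
    by (simp_all add: field_simps eval_nat_numeral)
  have "n * k * (n ^ 4 * l * (F / n ^ 5) + B / n) = k * (l * F + B)" for k l F B
    using n_pos by (simp add: field_simps eval_nat_numeral)
  hence "1 / (2 * (\<tau>2 / n\<^sup>2)\<^sup>2 * (n ^ 3 * R)) * (1 / (\<tau>2 / n\<^sup>2)\<^sup>2 * (F / n ^ 5) + B / n) =
      1 / (2 * \<tau>2\<^sup>2 * R) * (1 / \<tau>2\<^sup>2 * F + B)" for F B
    unfolding weights .
  moreover obtain a c p d a' c' p' d' where "x = ((a, c), (p, d))" "y = ((a', c'), (p', d'))"
    by (metis prod.exhaust)
  ultimately show ?thesis
    by (simp only: scale_coframe.simps coframe_metric.simps fibre_form_scale base_form_scale)
qed

end

lemma pair_eq_iff: "pair a b = x \<longleftrightarrow> a = x $ 0 \<and> b = x $ 1"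
  by (simp add: vec2_eq_iff)

fun iia_to_iib :: "iia \<Rightarrow> iib" where
  "iia_to_iib (\<tau>2, z, \<zeta>, \<zeta>t, \<sigma>) =
     (let b = Re z; cu1 = \<zeta> $ 0 * b - \<zeta> $ 1; c1 = \<zeta>t $ 1 + b * \<zeta> $ 1 / 2;
        c0 = \<zeta>t $ 0 - b\<^sup>2 * \<zeta> $ 1 / 6 in
      (Complex (\<zeta> $ 0) \<tau>2, z, cu1, c1, c0, (- \<sigma> - \<zeta> $ 0 * c0 - c1 * \<zeta> $ 1 + b * cu1 * \<zeta> $ 1 / 6) / 2))"

lemma iib_to_iia_to_iib: "iib_to_iia (iia_to_iib p) = p"
  by (cases p) (auto simp: Let_def pair_eq_iff field_simps)

lemma iia_to_iib_to_iia: "iia_to_iib (iib_to_iia q) = q"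
  by (cases q) (auto simp: Let_def complex_eq_iff field_simps power2_eq_square)

lemma S_duality_eq: "S_duality A p = iib_to_iia (S_duality_iib A (iia_to_iib p))"
proof -
  have "the_inv iib_to_iia p = iia_to_iib p"
    by (metis iia_to_iib_to_iia iib_to_iia_to_iib injI the_inv_f_f)
  thus ?thesis by (simp add: S_duality_def)
qed

lemma fst_iia_to_iib: "fst (iia_to_iib p) = iia_tau p"
  by (cases p) (simp add: iia_tau_def Let_def)

lemma S_duality_iib_conv:
  "S_duality_iib A = (\<lambda>(\<tau>, z, cu1, c1, c0, \<psi>).
     (moebius A \<tau>, Complex (of_int (A $ 1 $ 0) * cu1 + of_int (A $ 1 $ 1) * Re z)
       (cmod (automorphy A \<tau>) * Im z),
      of_int (A $ 0 $ 0) * cu1 + of_int (A $ 0 $ 1) * Re z, c1,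
      of_int (A $ 1 $ 1) * c0 - of_int (A $ 1 $ 0) * \<psi>, of_int (A $ 0 $ 0) * \<psi> - of_int (A $ 0 $ 1)
      * c0))"
  by (simp add: fun_eq_iff Let_def moebius_def automorphy_def)

lemma iia_tau_S_duality: "iia_tau (S_duality A p) = moebius A (iia_tau p)"
  and iia_t_S_duality: "iia_t (S_duality A p) = cmod (automorphy A (iia_tau p)) * iia_t p"
  unfolding S_duality_eq
  by (cases p; simp add: iia_tau_def iia_t_def Let_def moebius_def automorphy_def)+

lemma R1_moebius:
  assumes "det A = 1" "Im \<tau> > 0"
  shows "R1 chi (cmod (automorphy A \<tau>) * t) (moebius A \<tau>) = cmod (automorphy A \<tau>) ^ 3 * R1 chi t \<tau>"
  unfolding R1_def eisenstein_moebius[OF assms] by (simp add: power_mult_distrib algebra_simps)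

lemma R2_moebius:
  assumes "det A = 1" "Im \<tau> > 0"
  shows "R2 chi (cmod (automorphy A \<tau>) * t) (moebius A \<tau>) = cmod (automorphy A \<tau>) ^ 3 * R2 chi t \<tau>"
proof -
  have "(n * t) ^ 3 / 3 - x * (n ^ 3 * e) - y * (n ^ 3 * e)\<^sup>2 * inverse (n ^ 3 * r) =
      n ^ 3 * (t ^ 3 / 3 - x * e - y * e\<^sup>2 * inverse r)" if "n \<noteq> 0" for n x y e r :: real
    using that by (cases "r = 0") (simp_all add: field_simps eval_nat_numeral)
  moreover have "cmod (automorphy A \<tau>) \<noteq> 0" using automorphy_nonzero[OF assms] by simp
  ultimately show ?thesis
    unfolding R2_def R1_moebius[OF assms] eisenstein_moebius[OF assms] .
qed

lemma instanton_coupling_moebius: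
  assumes "det A = 1" "Im \<tau> > 0"
  defines "j \<equiv> automorphy A \<tau>"
  shows "instanton_coupling chi (moebius A \<tau>) = of_real (cmod j) ^ 3 * (cnj j / j) *
      instanton_coupling chi \<tau>"
  unfolding instanton_coupling_def twisted_eisenstein_moebius[OF assms(1,2)] j_def
  by (simp only: mult_ac)

lemma S_duality_iia_space:
  assumes "det A = 1" "p \<in> iia_space"
  shows "S_duality A p \<in> iia_space"
  using assms by (simp add: iia_space_iff iia_tau_S_duality iia_t_S_duality Im_moebius_pos
      automorphy_nonzero)

lemma S_duality_N_tilde:
  assumes "det A = 1" "p \<in> N_tilde chi"
  shows "S_duality A p \<in> N_tilde chi"
  using assms
  by (simp add: N_tilde_iff iia_tau_S_duality iia_t_S_duality Im_moebius_pos automorphy_nonzero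
      R1_moebius R2_moebius)

fun d_iib_to_iia :: "iib \<Rightarrow> iib \<Rightarrow> iia" where
  "d_iib_to_iia (\<tau>, z, cu1, c1, c0, \<psi>) (d\<tau>, dz, dcu1, dc1, dc0, d\<psi>) =
     (let \<tau>1 = Re \<tau>; b = Re z; db = Re dz; w = cu1 - \<tau>1 * b; dw = dcu1 - Re d\<tau> * b - \<tau>1 * db in
      (Im d\<tau>, dz, pair (Re d\<tau>) (- dw),
       pair (dc0 - 1 / 3 * b * db * w - 1 / 6 * b\<^sup>2 * dw) (dc1 + 1 / 2 * db * w + 1 / 2 * b * dw),
       - 2 * (d\<psi> + 1 / 2 * Re d\<tau> * c0 + 1 / 2 * \<tau>1 * dc0) + dc1 * w + c1 * dw
         - 1 / 6 * (db * cu1 * w + b * dcu1 * w + b * cu1 * dw)))"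

lemma iib_to_iia_conv:
  "iib_to_iia = (\<lambda>(\<tau>, z, cu1, c1, c0, \<psi>).
     (Im \<tau>, z, pair (Re \<tau>) (- (cu1 - Re \<tau> * Re z)),
      pair (c0 - 1 / 6 * (Re z)\<^sup>2 * (cu1 - Re \<tau> * Re z)) (c1 + 1 / 2 * Re z * (cu1 - Re \<tau> * Re z)),
      - 2 * (\<psi> + 1 / 2 * Re \<tau> * c0) + c1 * (cu1 - Re \<tau> * Re z)
        - 1 / 6 * Re z * cu1 * (cu1 - Re \<tau> * Re z)))"
  by (simp add: fun_eq_iff Let_def)

lemma iib_to_iia_has_derivative: "(iib_to_iia has_derivative d_iib_to_iia q) (at q)"
  unfolding iib_to_iia_conv case_prod_unfold
  by (cases q) (auto intro!: derivative_eq_intros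
      simp: fun_eq_iff Let_def pair_eq_iff field_simps power2_eq_square)

definition doublet :: "complex \<Rightarrow> real \<Rightarrow> real \<Rightarrow> complex" where
  "doublet \<tau> x y = of_real x - \<tau> * of_real y"

lemma doublet_moebius:
  fixes x y :: real
  assumes "det A = 1" "Im \<tau> > 0"
  shows "doublet (moebius A \<tau>) (of_int (A $ 0 $ 0) * x + of_int (A $ 0 $ 1) * y)
      (of_int (A $ 1 $ 0) * x + of_int (A $ 1 $ 1) * y) =
    doublet \<tau> x y / automorphy A \<tau>"
proof -
  have "of_real (of_int (A $ 0 $ 0) * x + of_int (A $ 0 $ 1) * y) * automorphy A \<tau> -
      (of_int (A $ 0 $ 0) * \<tau> + of_int (A $ 0 $ 1)) *
        of_real (of_int (A $ 1 $ 0) * x + of_int (A $ 1 $ 1) * y) =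
      of_int (det A) * doublet \<tau> x y"
    by (simp add: doublet_def automorphy_def det_matrix_2 algebra_simps)
  thus ?thesis
    using automorphy_nonzero[OF assms] assms(1) unfolding doublet_def moebius_def
    by (simp add: field_simps)
qed

text \<open>
  The pair \<open>(\<psi>, - c0)\<close> is a doublet; shifting its differential by multiples of \<open>w\<close> makes it
  invariant under the action of \<open>R_H4\<close>.
\<close>

fun iib_coframe :: "iib \<Rightarrow> iib \<Rightarrow> (complex \<times> complex) \<times> (complex \<times> complex)" where
  "iib_coframe (\<tau>, z, cu1, c1, c0, \<psi>) (d\<tau>, dz, dcu1, dc1, dc0, d\<psi>) =
     (let e = cu1 * Re dz - Re z * dcu1; w = dc1 + e / 6; k = \<i> * of_real (Im \<tau> * (Im z)\<^sup>2 / 2);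
          u = doublet \<tau> dcu1 (Re dz); s = doublet \<tau> (d\<psi> - cu1 * w) (- (dc0 + Re z * w)) in
      ((s + k * u, s - k * u), (Complex (dc1 + e / 2) (Im z * (Im \<tau> * Im dz + Im z * Im d\<tau> / 2)), d\<tau>)))"

lemma coframe_iib_to_iia: "coframe (iib_to_iia q) (d_iib_to_iia q Q) = iib_coframe q Q"
proof -
  obtain \<tau> z cu1 c1 c0 \<psi> where q_eq: "q = (\<tau>, z, cu1, c1, c0, \<psi>)" by (cases q)
  obtain d\<tau> dz dcu1 dc1 dc0 d\<psi> where Q_eq: "Q = (d\<tau>, dz, dcu1, dc1, dc0, d\<psi>)" by (cases Q)
  define w where "w = dc1 + (cu1 * Re dz - Re z * dcu1) / 6"
  have "doublet_form (iib_to_iia q) (d_iib_to_iia q Q) = doublet \<tau> dcu1 (Re dz)"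
    unfolding q_eq Q_eq by (simp add: doublet_def Let_def complex_eq_iff algebra_simps)
  moreover have "dual_doublet_form (iib_to_iia q) (d_iib_to_iia q Q) =
      doublet \<tau> (d\<psi> - cu1 * w) (- (dc0 + Re z * w))"
    unfolding q_eq Q_eq w_def
    by (simp add: doublet_def Let_def complex_eq_iff) (simp add: field_simps power2_eq_square
        power3_eq_cube)
  moreover have "singlet_form (iib_to_iia q) (d_iib_to_iia q Q) =
      Complex (dc1 + (cu1 * Re dz - Re z * dcu1) / 2) (Im z * (Im \<tau> * Im dz + Im z * Im d\<tau> / 2))"
    unfolding q_eq Q_eq by (simp add: Let_def complex_eq_iff) (simp add: field_simps power2_eq_square)
  moreover have "tau_form (d_iib_to_iia q Q) = d\<tau>" unfolding q_eq Q_eq by (simp add: Let_def)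
  moreover have "iia_tau (iib_to_iia q) = \<tau>" "iia_t (iib_to_iia q) = Im z"
    unfolding q_eq by (simp_all add: iia_tau_def iia_t_def Let_def)
  ultimately show ?thesis
    unfolding coframe_def plus_form_def minus_form_def by (simp add: q_eq Q_eq w_def Let_def)
qed

lemma moebius_has_field_derivative:
  assumes "det A = 1" "Im \<tau> > 0"
  shows "(moebius A has_field_derivative 1 / (automorphy A \<tau>)\<^sup>2) (at \<tau>)"
proof -
  have "((\<lambda>w. (of_int (A $ 0 $ 0) * w + of_int (A $ 0 $ 1)) /
      (of_int (A $ 1 $ 0) * w + of_int (A $ 1 $ 1)))
      has_field_derivative (of_int (A $ 0 $ 0) * automorphy A \<tau> -
        (of_int (A $ 0 $ 0) * \<tau> + of_int (A $ 0 $ 1)) * of_int (A $ 1 $ 0)) /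
        (automorphy A \<tau> * automorphy A \<tau>)) (at \<tau>)"
    using automorphy_nonzero[OF assms] unfolding automorphy_def by (auto intro!: derivative_eq_intros)
  moreover have "of_int (A $ 0 $ 0) * automorphy A \<tau> -
      (of_int (A $ 0 $ 0) * \<tau> + of_int (A $ 0 $ 1)) * of_int (A $ 1 $ 0) = (of_int (det A) :: complex)"
    by (simp add: automorphy_def det_matrix_2 algebra_simps)
  ultimately show ?thesis
    by (simp add: moebius_def[abs_def] automorphy_def[symmetric] assms(1) power2_eq_square)
qed

lemma norm_automorphy_has_derivative:
  assumes "automorphy A \<tau> \<noteq> 0"
  shows "((\<lambda>\<tau>. cmod (automorphy A \<tau>)) has_derivative
    (\<lambda>h. Re (cnj (automorphy A \<tau>) * (of_int (A $ 1 $ 0) * h)) / cmod (automorphy A \<tau>))) (at \<tau>)"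
proof -
  have "(automorphy A has_derivative (\<lambda>h. of_int (A $ 1 $ 0) * h)) (at \<tau>)"
    unfolding automorphy_def[abs_def] by (auto intro!: derivative_eq_intros)
  from has_derivative_compose[OF this has_derivative_norm[OF assms]] show ?thesis
    by (simp add: inner_complex_def sgn_div_norm divide_inverse algebra_simps)
qed

fun d_S_duality_iib :: "int^2^2 \<Rightarrow> iib \<Rightarrow> iib \<Rightarrow> iib" where
  "d_S_duality_iib A (\<tau>, z, cu1, c1, c0, \<psi>) (d\<tau>, dz, dcu1, dc1, dc0, d\<psi>) =
     (let j = automorphy A \<tau> in
      (d\<tau> / j\<^sup>2, Complex (of_int (A $ 1 $ 0) * dcu1 + of_int (A $ 1 $ 1) * Re dz)
         (cmod j * Im dz + Re (cnj j * (of_int (A $ 1 $ 0) * d\<tau>)) / cmod j * Im z),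
       of_int (A $ 0 $ 0) * dcu1 + of_int (A $ 0 $ 1) * Re dz, dc1,
       of_int (A $ 1 $ 1) * dc0 - of_int (A $ 1 $ 0) * d\<psi>,
       of_int (A $ 0 $ 0) * d\<psi> - of_int (A $ 0 $ 1) * dc0))"

lemma S_duality_iib_has_derivative:
  assumes det_A: "det A = 1" and Im_pos: "Im (fst q) > 0"
  shows "(S_duality_iib A has_derivative d_S_duality_iib A q) (at q)"
proof -
  have fst: "(fst has_derivative fst) (at q)"
    by (rule bounded_linear_imp_has_derivative[OF bounded_linear_fst])
  have moebius': "((\<lambda>q. moebius A (fst q)) has_derivative
      (\<lambda>Q. 1 / (automorphy A (fst q))\<^sup>2 * fst Q)) (at q)"
    using has_derivative_compose[OF fst
        moebius_has_field_derivative[OF det_A Im_pos, unfolded has_field_derivative_def]] .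
  have norm': "((\<lambda>q. cmod (automorphy A (fst q))) has_derivative (\<lambda>Q.
      Re (cnj (automorphy A (fst q)) * (of_int (A $ 1 $ 0) * fst Q)) / cmod (automorphy A (fst q))))
      (at q)"
    by (rule has_derivative_compose[OF fst
        norm_automorphy_has_derivative[OF automorphy_nonzero[OF det_A Im_pos]]])
  show ?thesis
    unfolding S_duality_iib_conv case_prod_unfold Complex_eq
    by (rule has_derivative_eq_rhs, (rule moebius' norm' derivative_intros)+)
      (cases q, auto simp: fun_eq_iff Let_def Complex_eq algebra_simps)
qed

text \<open>The imaginary part of the singlet form is the differential of the invariant \<open>Im \<tau> t\<^sup>2 / 2\<close>.\<close>

lemma Im_singlet_S_duality_iib:
  fixes q Q :: iib
  assumes det_A: "det A = 1" and Im_pos: "Im (fst q) > 0"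
  defines "dvol \<equiv> \<lambda>q Q :: iib. Im (fst (snd q)) *
      (Im (fst q) * Im (fst (snd Q)) + Im (fst (snd q)) * Im (fst Q) / 2)"
  shows "dvol (S_duality_iib A q) (d_S_duality_iib A q Q) = dvol q Q"
proof -
  define vol where "vol q = Im (fst q) * (Im (fst (snd q)))\<^sup>2 / 2" for q :: iib
  have vol: "(vol has_derivative dvol q) (at q)" for q
    unfolding vol_def[abs_def] dvol_def
    by (auto intro!: derivative_eq_intros simp: fun_eq_iff power2_eq_square field_simps)
  have "((\<lambda>q. vol (S_duality_iib A q)) has_derivative
      (\<lambda>Q. dvol (S_duality_iib A q) (d_S_duality_iib A q Q))) (at q)"
    by (rule has_derivative_compose[OF S_duality_iib_has_derivative[OF det_A Im_pos] vol])
  hence "(vol has_derivative (\<lambda>Q. dvol (S_duality_iib A q) (d_S_duality_iib A q Q))) (at q)"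
  proof (rule has_derivative_transform_within_open)
    show "open {q :: iib. Im (fst q) > 0}" by (intro open_Collect_less continuous_intros)
    show "vol (S_duality_iib A q) = vol q" if "q \<in> {q. Im (fst q) > 0}" for q
      using that det_A automorphy_nonzero[OF det_A, of "fst q"]
      by (cases q) (simp add: vol_def S_duality_iib_conv Im_moebius power_mult_distrib)
  qed (use Im_pos in simp)
  from has_derivative_unique[OF this vol] show ?thesis by (rule fun_cong)
qed

lemma iib_coframe_S_duality:
  assumes det_A: "det A = 1" and Im_pos: "Im (fst q) > 0"
  shows "iib_coframe (S_duality_iib A q) (d_S_duality_iib A q Q) =
    scale_coframe (automorphy A (fst q)) (iib_coframe q Q)"
proof -
  obtain \<tau> z cu1 c1 c0 \<psi> where q_eq: "q = (\<tau>, z, cu1, c1, c0, \<psi>)" by (cases q)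
  obtain d\<tau> dz dcu1 dc1 dc0 d\<psi> where Q_eq: "Q = (d\<tau>, dz, dcu1, dc1, dc0, d\<psi>)" by (cases Q)
  define \<alpha> \<beta> \<gamma> \<delta> :: real where "\<alpha> = of_int (A $ 0 $ 0)" and "\<beta> = of_int (A $ 0 $ 1)"
    and "\<gamma> = of_int (A $ 1 $ 0)" and "\<delta> = of_int (A $ 1 $ 1)"
  note entries = \<alpha>_def[symmetric] \<beta>_def[symmetric] \<gamma>_def[symmetric] \<delta>_def[symmetric]
  define e w where "e = cu1 * Re dz - Re z * dcu1" and "w = dc1 + e / 6"
  have pos: "Im \<tau> > 0" using Im_pos by (simp add: q_eq)
  have "\<alpha> * \<delta> - \<beta> * \<gamma> = of_int (det A)" by (simp add: \<alpha>_def \<beta>_def \<gamma>_def \<delta>_def det_matrix_2)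
  hence det: "\<alpha> * \<delta> - \<beta> * \<gamma> = 1" using det_A by simp
  have "(\<alpha> * cu1 + \<beta> * Re z) * (\<gamma> * dcu1 + \<delta> * Re dz) - (\<gamma> * cu1 + \<delta> * Re z) * (\<alpha> * dcu1 + \<beta> * Re dz) =
      (\<alpha> * \<delta> - \<beta> * \<gamma>) * e"
    by (simp add: e_def algebra_simps)
  hence symplectic: "(\<alpha> * cu1 + \<beta> * Re z) * (\<gamma> * dcu1 + \<delta> * Re dz) -
      (\<gamma> * cu1 + \<delta> * Re z) * (\<alpha> * dcu1 + \<beta> * Re dz) = e"
    unfolding det by simp
  have "doublet (moebius A \<tau>) (\<alpha> * d\<psi> - \<beta> * dc0 - (\<alpha> * cu1 + \<beta> * Re z) * w)
      (- (\<delta> * dc0 - \<gamma> * d\<psi> + (\<gamma> * cu1 + \<delta> * Re z) * w)) =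
    doublet (moebius A \<tau>) (\<alpha> * (d\<psi> - cu1 * w) + \<beta> * (- (dc0 + Re z * w)))
      (\<gamma> * (d\<psi> - cu1 * w) + \<delta> * (- (dc0 + Re z * w)))"
    by (rule arg_cong2[where f = "doublet (moebius A \<tau>)"]) (simp_all add: algebra_simps)
  note dual = this[folded doublet_moebius[OF det_A pos, unfolded entries, symmetric]]
  have prefactor: "Im (moebius A \<tau>) * (cmod (automorphy A \<tau>) * Im z)\<^sup>2 / 2 = Im \<tau> * (Im z)\<^sup>2 / 2"
    using automorphy_nonzero[OF det_A pos] by (simp add: Im_moebius[OF det_A pos] power_mult_distrib)
  note volume = Im_singlet_S_duality_iib[OF det_A Im_pos, of Q, unfolded q_eq Q_eq
      S_duality_iib_conv prod.case d_S_duality_iib.simps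
      Let_def fst_conv snd_conv complex.sel]
  show ?thesis
    unfolding q_eq Q_eq S_duality_iib_conv prod.case d_S_duality_iib.simps iib_coframe.simps Let_def
        complex.sel volume
    unfolding entries symplectic e_def[symmetric] unfolding w_def[symmetric] prefactor
      dual doublet_moebius[OF det_A pos, unfolded entries]
    by (simp add: add_divide_distrib diff_divide_distrib)
qed

lemma iia_to_iib_conv:
  "iia_to_iib = (\<lambda>(\<tau>2, z, \<zeta>, \<zeta>t, \<sigma>).
     (of_real (\<zeta> $ 0) + \<i> * of_real \<tau>2, z, \<zeta> $ 0 * Re z - \<zeta> $ 1, \<zeta>t $ 1 + Re z * \<zeta> $ 1 / 2,
      \<zeta>t $ 0 - (Re z)\<^sup>2 * \<zeta> $ 1 / 6,
      (- \<sigma> - \<zeta> $ 0 * (\<zeta>t $ 0 - (Re z)\<^sup>2 * \<zeta> $ 1 / 6) - (\<zeta>t $ 1 + Re z * \<zeta> $ 1 / 2) * \<zeta> $ 1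
        + Re z * (\<zeta> $ 0 * Re z - \<zeta> $ 1) * \<zeta> $ 1 / 6) / 2))"
  by (simp add: fun_eq_iff Let_def Complex_eq)

lemma iia_to_iib_differentiable: "iia_to_iib differentiable (at p)"
  unfolding iia_to_iib_conv case_prod_unfold differentiable_def
  by (rule exI) (rule derivative_intros has_derivative_Re has_derivative_Im | simp)+

lemma S_duality_has_derivative:
  assumes det_A: "det A = 1" and Im_pos: "Im (iia_tau p) > 0"
  obtains D where "(S_duality A has_derivative D) (at p)"
    and "\<And>X. coframe (S_duality A p) (D X) = scale_coframe (automorphy A (iia_tau p)) (coframe p X)"
proof -
  define q where "q = iia_to_iib p"
  have Im_q_pos: "Im (fst q) > 0" using Im_pos by (simp add: q_def fst_iia_to_iib)
  obtain E where E_deriv: "(iia_to_iib has_derivative E) (at p)"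
    using iia_to_iib_differentiable[of p] unfolding differentiable_def by blast
  have "((\<lambda>p. p) has_derivative (\<lambda>X. d_iib_to_iia q (E X))) (at p)"
    using has_derivative_compose[OF E_deriv iib_to_iia_has_derivative]
    by (simp add: q_def iib_to_iia_to_iib)
  from has_derivative_unique[OF this has_derivative_ident]
  have inverse: "d_iib_to_iia q (E X) = X" for X by (rule fun_cong)
  define D where "D X = d_iib_to_iia (S_duality_iib A q) (d_S_duality_iib A q (E X))" for X
  show thesis
  proof
    have "((\<lambda>p. iib_to_iia (S_duality_iib A (iia_to_iib p))) has_derivative D) (at p)"
      unfolding D_def[abs_def] q_def
      by (rule has_derivative_compose[OF has_derivative_compose[OF E_deriv
              S_duality_iib_has_derivative[OF det_A Im_q_pos[unfolded q_def]]]
              iib_to_iia_has_derivative])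
    thus "(S_duality A has_derivative D) (at p)" by (simp add: S_duality_eq[abs_def])
    fix X
    have "coframe p X = iib_coframe q (E X)"
      using coframe_iib_to_iia[of q "E X"] unfolding inverse unfolding q_def iib_to_iia_to_iib .
    moreover have "coframe (S_duality A p) (D X) =
        iib_coframe (S_duality_iib A q) (d_S_duality_iib A q (E X))"
      unfolding S_duality_eq D_def q_def[symmetric] by (rule coframe_iib_to_iia)
    ultimately show "coframe (S_duality A p) (D X) =
        scale_coframe (automorphy A (iia_tau p)) (coframe p X)"
      using iib_coframe_S_duality[OF det_A Im_q_pos, of "E X"] by (simp add: q_def fst_iia_to_iib)
  qed
qed

section \<open>Isometries\<close>

definition isometry_at ::
  "'a :: real_normed_vector set \<Rightarrow> ('a \<Rightarrow> 'a \<Rightarrow> 'a \<Rightarrow> real) \<Rightarrow> ('a \<Rightarrow> 'a) \<Rightarrow> 'a \<Rightarrow> bool" where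
  "isometry_at S g F p \<longleftrightarrow> F p \<in> S \<and>
     (\<exists>D. (F has_derivative D) (at p) \<and> (\<forall>X Y. g (F p) (D X) (D Y) = g p X Y))"

lemma isometry_at_compose:
  assumes F_isometry: "isometry_at S g F p" and G_isometry: "isometry_at S g G (F p)"
  shows "isometry_at S g (\<lambda>x. G (F x)) p"
proof -
  obtain D E where "(F has_derivative D) (at p)" "(G has_derivative E) (at (F p))"
    and "\<And>X Y. g (F p) (D X) (D Y) = g p X Y" "\<And>X Y. g (G (F p)) (E X) (E Y) = g (F p) X Y"
    using F_isometry G_isometry unfolding isometry_at_def by blast
  thus ?thesis
    using G_isometry has_derivative_compose[of F D p UNIV G E] unfolding isometry_at_def
    by (intro conjI exI[of _ "\<lambda>X. E (D X)"]) auto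
qed

lemma isometry_at_frechet_derivative:
  assumes "isometry_at S g F p"
  shows "g (F p) (frechet_derivative F (at p) X) (frechet_derivative F (at p) Y) = g p X Y"
  using assms frechet_derivativeI unfolding isometry_at_def by metis

fun d_R_act :: "real \<Rightarrow> iia \<Rightarrow> iia" where
  "d_R_act v (d\<tau>2, dz, d\<zeta>, d\<zeta>t, d\<sigma>) =
     (d\<tau>2, dz, pair (d\<zeta> $ 0) (d\<zeta> $ 1 + d\<zeta> $ 0 * v),
      pair (d\<zeta>t $ 0 + 1 / 6 * v ^ 3 * d\<zeta> $ 0 + 1 / 2 * v\<^sup>2 * d\<zeta> $ 1 - d\<zeta>t $ 1 * v)
        (d\<zeta>t $ 1 - 1 / 2 * d\<zeta> $ 0 * v\<^sup>2 - v * d\<zeta> $ 1), d\<sigma>)"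

lemma R_act_conv:
  "R_act v = (\<lambda>(\<tau>2, z, \<zeta>, \<zeta>t, \<sigma>).
     (\<tau>2, z + of_real v, pair (\<zeta> $ 0) (\<zeta> $ 1 + \<zeta> $ 0 * v),
      pair (\<zeta>t $ 0 + 1 / 6 * v ^ 3 * \<zeta> $ 0 + 1 / 2 * v\<^sup>2 * \<zeta> $ 1 - \<zeta>t $ 1 * v)
        (\<zeta>t $ 1 - 1 / 2 * \<zeta> $ 0 * v\<^sup>2 - v * \<zeta> $ 1), \<sigma>))"
  by (simp add: fun_eq_iff)

lemma R_act_has_derivative: "(R_act v has_derivative d_R_act v) (at p)"
  unfolding R_act_conv case_prod_unfold
  by (rule has_derivative_eq_rhs, (rule derivative_intros | simp)+) (auto simp: fun_eq_iff)

lemma coframe_R_act: "coframe (R_act v p) (d_R_act v X) = coframe p X"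
proof -
  obtain \<tau>2 z \<zeta> \<zeta>t \<sigma> where p_eq: "p = (\<tau>2, z, \<zeta>, \<zeta>t, \<sigma>)" by (cases p)
  obtain d\<tau>2 dz d\<zeta> d\<zeta>t d\<sigma> where X_eq: "X = (d\<tau>2, dz, d\<zeta>, d\<zeta>t, d\<sigma>)" by (cases X)
  have "doublet_form (R_act v p) (d_R_act v X) = doublet_form p X"
    unfolding p_eq X_eq by (simp add: complex_eq_iff algebra_simps)
  moreover have "dual_doublet_form (R_act v p) (d_R_act v X) = dual_doublet_form p X"
    unfolding p_eq X_eq
    by (simp add: complex_eq_iff) (simp add: field_simps power2_eq_square power3_eq_cube)
  moreover have "singlet_form (R_act v p) (d_R_act v X) = singlet_form p X"
    unfolding p_eq X_eq by (simp add: complex_eq_iff) (simp add: field_simps power2_eq_square)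
  ultimately show ?thesis
    by (simp add: coframe_def plus_form_def minus_form_def) (simp add: p_eq X_eq iia_tau_def iia_t_def)
qed

fun d_Heis5_act :: "(real^2) \<times> (real^2) \<times> real \<Rightarrow> iia \<Rightarrow> iia" where
  "d_Heis5_act (\<eta>, \<eta>t, \<kappa>) (d\<tau>2, dz, d\<zeta>, d\<zeta>t, d\<sigma>) =
     (d\<tau>2, dz, d\<zeta>, d\<zeta>t, d\<sigma> + (d\<zeta>t $ 0 * \<eta> $ 0 - d\<zeta> $ 0 * \<eta>t $ 0 + (d\<zeta>t $ 1 * \<eta> $ 1 - d\<zeta> $ 1 * \<eta>t $ 1)))"

lemma Heis5_act_conv:
  "Heis5_act (\<eta>, \<eta>t, \<kappa>) = (\<lambda>(\<tau>2, z, \<zeta>, \<zeta>t, \<sigma>). (\<tau>2, z, \<zeta> + \<eta>, \<zeta>t + \<eta>t,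
     \<sigma> + \<kappa> + (\<zeta>t $ 0 * \<eta> $ 0 - \<zeta> $ 0 * \<eta>t $ 0 + (\<zeta>t $ 1 * \<eta> $ 1 - \<zeta> $ 1 * \<eta>t $ 1))))"
  by (simp add: fun_eq_iff sum_UNIV_2)

lemma Heis5_act_has_derivative: "(Heis5_act h has_derivative d_Heis5_act h) (at p)"
proof (cases h)
  case (fields \<eta> \<eta>t \<kappa>)
  show ?thesis
    unfolding fields Heis5_act_conv case_prod_unfold
    by (rule has_derivative_eq_rhs, (rule derivative_intros | simp)+) (auto simp: fun_eq_iff)
qed

lemma coframe_Heis5_act:
  assumes "fst h $ 0 = 0"
  shows "coframe (Heis5_act h p) (d_Heis5_act h X) = coframe p X"
  using assms
  by (cases p; cases h; cases X)
    (simp add: coframe_def plus_form_def minus_form_def iia_tau_def iia_t_def complex_eq_iff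
      algebra_simps)

lemma iia_tau_R_act: "iia_tau (R_act v p) = iia_tau p" and iia_t_R_act: "iia_t (R_act v p) = iia_t p"
  by (cases p; simp add: iia_tau_def iia_t_def)+

lemma iia_tau_Heis5_act: "fst h $ 0 = 0 \<Longrightarrow> iia_tau (Heis5_act h p) = iia_tau p"
  and iia_t_Heis5_act: "iia_t (Heis5_act h p) = iia_t p"
  by (cases p; cases h; simp add: iia_tau_def iia_t_def)+

context
  fixes chi :: nat and c_l :: real and p :: iia
  assumes c_l: "c_l = real chi / (192 * pi)" and p_in: "p \<in> N_tilde chi"
begin

lemma isometry_at_S_duality:
  assumes det_A: "det A = 1"
  shows "isometry_at (N_tilde chi) (qmap_metric (prepotential chi) chi c_l) (S_duality A) p"
proof -
  have Im_pos: "Im (iia_tau p) > 0" using p_in by (simp add: N_tilde_iff)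
  define j where "j = automorphy A (iia_tau p)"
  have j_nonzero: "j \<noteq> 0" unfolding j_def by (rule automorphy_nonzero[OF det_A Im_pos])
  have S_in: "S_duality A p \<in> N_tilde chi" by (rule S_duality_N_tilde[OF det_A p_in])
  obtain D where D_deriv: "(S_duality A has_derivative D) (at p)"
    and coframe: "\<And>X. coframe (S_duality A p) (D X) = scale_coframe j (coframe p X)"
    using S_duality_has_derivative[OF det_A Im_pos] unfolding j_def by metis
  have "qmap_metric (prepotential chi) chi c_l (S_duality A p) (D X) (D Y) =
      qmap_metric (prepotential chi) chi c_l p X Y" for X Y
    unfolding qmap_metric_N_tilde[OF c_l S_in] qmap_metric_N_tilde[OF c_l p_in] coframe
    unfolding iia_tau_S_duality iia_t_S_duality R1_moebius[OF det_A Im_pos]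
        instanton_coupling_moebius[OF det_A Im_pos]
      Im_moebius[OF det_A Im_pos]
    unfolding j_def[symmetric] by (rule coframe_metric_scale[OF j_nonzero])
  thus ?thesis unfolding isometry_at_def using S_in D_deriv by blast
qed

lemma isometry_at_coframe_preserving:
  assumes "iia_tau (F p) = iia_tau p" "iia_t (F p) = iia_t p"
    and "(F has_derivative D) (at p)" "\<And>X. coframe (F p) (D X) = coframe p X"
  shows "isometry_at (N_tilde chi) (qmap_metric (prepotential chi) chi c_l) F p"
proof -
  have F_in: "F p \<in> N_tilde chi" using p_in by (simp add: N_tilde_iff assms(1,2))
  have "qmap_metric (prepotential chi) chi c_l (F p) (D X) (D Y) =
      qmap_metric (prepotential chi) chi c_l p X Y" for X Y
    unfolding qmap_metric_N_tilde[OF c_l F_in] qmap_metric_N_tilde[OF c_l p_in] assms(1,2,4) ..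
  thus ?thesis unfolding isometry_at_def using F_in assms(3) by blast
qed

lemma isometry_at_R_act:
  "isometry_at (N_tilde chi) (qmap_metric (prepotential chi) chi c_l) (R_act v) p"
  by (rule isometry_at_coframe_preserving[OF iia_tau_R_act iia_t_R_act R_act_has_derivative
      coframe_R_act])

lemma isometry_at_Heis5_act:
  assumes "fst h $ 0 = 0"
  shows "isometry_at (N_tilde chi) (qmap_metric (prepotential chi) chi c_l) (Heis5_act h) p"
  by (rule isometry_at_coframe_preserving[OF iia_tau_Heis5_act[OF assms] iia_t_Heis5_act
        Heis5_act_has_derivative coframe_Heis5_act[OF assms]])

end

section \<open>Smoothness\<close>

lemma Ck_on_const: "Ck_on k S (\<lambda>x. c)"
  by (induction k arbitrary: c) auto

lemma Ck_on_bounded_linear: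
  assumes "bounded_linear f"
  shows "Ck_on k S f"
proof (cases k)
  case 0
  thus ?thesis using assms by (simp add: linear_continuous_on)
next
  case (Suc k)
  have "frechet_derivative f (at x) = f" for x
    by (rule frechet_derivativeI[OF bounded_linear_imp_has_derivative[OF assms]])
  thus ?thesis using Suc assms by (simp add: Ck_on_const bounded_linear_imp_differentiable_on)
qed

lemma Ck_on_SucD: "Ck_on (Suc k) S f \<Longrightarrow> Ck_on k S f"
proof (induction k arbitrary: f)
  case 0
  thus ?case by (simp add: differentiable_imp_continuous_on)
next
  case (Suc k)
  have "f differentiable_on S" "Ck_on (Suc k) S (\<lambda>x. frechet_derivative f (at x) v)" for v
    using Suc.prems by (simp_all only: Ck_on.simps(2)[of "Suc k"])
  thus ?case by (subst Ck_on.simps(2)) (intro conjI allI Suc.IH)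
qed

lemma Ck_on_frechet_derivative: "Ck_on (Suc k) S f \<Longrightarrow> Ck_on k S (\<lambda>x. frechet_derivative f (at x) v)"
  by simp

context
  fixes S :: "'a :: real_normed_vector set"
  assumes open_S: "open S"
begin

lemma Ck_on_Suc_has_derivative:
  assumes "Ck_on (Suc k) S f" "x \<in> S"
  shows "(f has_derivative frechet_derivative f (at x)) (at x)"
  using assms differentiable_on_eq_differentiable_at[OF open_S] frechet_derivative_works[of f "at x"]
  by (auto simp only: Ck_on.simps)

lemma Ck_on_cong:
  assumes "\<And>x. x \<in> S \<Longrightarrow> f x = g x" "Ck_on k S f"
  shows "Ck_on k S g"
  using assms
proof (induction k arbitrary: f g)
  case 0
  thus ?case using continuous_on_cong[of S S f g] by simp
next
  case (Suc k)
  have g_deriv: "(g has_derivative frechet_derivative f (at x)) (at x)" if "x \<in> S" for x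
    by (rule has_derivative_transform_within_open[OF Ck_on_Suc_has_derivative[OF Suc.prems(2) that]
        open_S that])
      (use Suc.prems(1) in auto)
  have "g differentiable_on S"
    unfolding differentiable_on_eq_differentiable_at[OF open_S] using g_deriv
    by (auto simp: differentiable_def)
  moreover have "Ck_on k S (\<lambda>x. frechet_derivative g (at x) v)" for v
    by (rule Suc.IH[OF _ Ck_on_frechet_derivative[OF Suc.prems(2)]])
      (simp add: frechet_derivativeI[OF g_deriv])
  ultimately show ?case by simp
qed

lemma Ck_on_SucI:
  assumes "\<And>x. x \<in> S \<Longrightarrow> (f has_derivative f' x) (at x)" "\<And>v. Ck_on k S (\<lambda>x. f' x v)"
  shows "Ck_on (Suc k) S f"
proof -
  have "f differentiable_on S"
    unfolding differentiable_on_eq_differentiable_at[OF open_S] using assms(1)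
    by (auto simp: differentiable_def)
  moreover have "Ck_on k S (\<lambda>x. frechet_derivative f (at x) v)" for v
    by (rule Ck_on_cong[OF _ assms(2)[of v]]) (use frechet_derivativeI[OF assms(1)] in simp)
  ultimately show ?thesis by simp
qed

lemma Ck_on_linear_image:
  assumes h_linear: "bounded_linear h" and f_Ck: "Ck_on k S f"
  shows "Ck_on k S (\<lambda>x. h (f x))"
  using f_Ck
proof (induction k arbitrary: f)
  case 0
  thus ?case using bounded_linear.continuous_on[OF h_linear] by auto
next
  case (Suc k)
  note f_deriv = Ck_on_Suc_has_derivative[OF Suc.prems]
  show ?case
    by (rule Ck_on_SucI[OF bounded_linear.has_derivative[OF h_linear f_deriv]])
      (auto intro: Suc.IH Ck_on_frechet_derivative[OF Suc.prems])
qed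

lemma Ck_on_Pair:
  assumes "Ck_on k S f" "Ck_on k S g"
  shows "Ck_on k S (\<lambda>x. (f x, g x))"
  using assms
proof (induction k arbitrary: f g)
  case 0
  thus ?case using continuous_on_Pair[of S f g] by simp
next
  case (Suc k)
  note f_deriv = Ck_on_Suc_has_derivative[OF Suc.prems(1)]
    and g_deriv = Ck_on_Suc_has_derivative[OF Suc.prems(2)]
  show ?case
    by (rule Ck_on_SucI[OF has_derivative_Pair[OF f_deriv g_deriv]])
      (auto intro: Suc.IH Ck_on_frechet_derivative[OF Suc.prems(1)]
          Ck_on_frechet_derivative[OF Suc.prems(2)])
qed

lemma Ck_on_add:
  assumes "Ck_on k S f" "Ck_on k S g"
  shows "Ck_on k S (\<lambda>x. f x + g x)"
  using Ck_on_linear_image[OF bounded_linear_add[OF bounded_linear_fst bounded_linear_snd]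
      Ck_on_Pair[OF assms]]
  by simp

lemma Ck_on_minus: "Ck_on k S f \<Longrightarrow> Ck_on k S (\<lambda>x. - f x)"
  by (rule Ck_on_linear_image[OF bounded_linear_minus[OF bounded_linear_ident]])

lemma Ck_on_diff:
  assumes "Ck_on k S f" "Ck_on k S g"
  shows "Ck_on k S (\<lambda>x. f x - g x)"
  using Ck_on_add[OF assms(1) Ck_on_minus[OF assms(2)]] by simp

lemma Ck_on_bilinear:
  assumes h_bilinear: "bounded_bilinear h" and "Ck_on k S f" "Ck_on k S g"
  shows "Ck_on k S (\<lambda>x. h (f x) (g x))"
  using assms(2,3)
proof (induction k arbitrary: f g)
  case 0
  thus ?case using bounded_bilinear.continuous_on[OF h_bilinear] by auto
next
  case (Suc k)
  note f_deriv = Ck_on_Suc_has_derivative[OF Suc.prems(1)]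
    and g_deriv = Ck_on_Suc_has_derivative[OF Suc.prems(2)]
  show ?case
  proof (rule Ck_on_SucI[OF bounded_bilinear.FDERIV[OF h_bilinear f_deriv g_deriv]])
    fix v
    show "Ck_on k S (\<lambda>x. h (f x) (frechet_derivative g (at x) v) +
        h (frechet_derivative f (at x) v) (g x))"
      by (intro Ck_on_add Suc.IH Ck_on_SucD[OF Suc.prems(1)] Ck_on_SucD[OF Suc.prems(2)]
          Ck_on_frechet_derivative[OF Suc.prems(1)] Ck_on_frechet_derivative[OF Suc.prems(2)])
  qed
qed

lemma Ck_on_mult:
  fixes f g :: "'a \<Rightarrow> 'b :: real_normed_algebra"
  assumes "Ck_on k S f" "Ck_on k S g"
  shows "Ck_on k S (\<lambda>x. f x * g x)"
  by (rule Ck_on_bilinear[OF bounded_bilinear_mult assms])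

lemma Ck_on_power:
  fixes f :: "'a \<Rightarrow> 'b :: real_normed_field"
  assumes "Ck_on k S f"
  shows "Ck_on k S (\<lambda>x. f x ^ n)"
  by (induction n) (simp_all add: Ck_on_const Ck_on_mult assms)

lemma Ck_on_inverse:
  fixes f :: "'a \<Rightarrow> 'b :: real_normed_field"
  assumes "Ck_on k S f" "\<And>x. x \<in> S \<Longrightarrow> f x \<noteq> 0"
  shows "Ck_on k S (\<lambda>x. inverse (f x))"
  using assms
proof (induction k arbitrary: f)
  case 0
  thus ?case using continuous_on_inverse[of S f] by simp
next
  case (Suc k)
  have inverse: "Ck_on k S (\<lambda>x. inverse (f x))"
    by (rule Suc.IH[OF Ck_on_SucD[OF Suc.prems(1)] Suc.prems(2)])
  show ?case
  proof (rule Ck_on_SucI)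
    show "((\<lambda>x. inverse (f x)) has_derivative
        (\<lambda>v. - (inverse (f x) * frechet_derivative f (at x) v * inverse (f x)))) (at x)" if "x \<in> S"
      for x
      by (rule Deriv.has_derivative_inverse[OF Suc.prems(2)[OF that]
          Ck_on_Suc_has_derivative[OF Suc.prems(1) that]])
    show "Ck_on k S (\<lambda>x. - (inverse (f x) * frechet_derivative f (at x) v * inverse (f x)))" for v
      by (intro Ck_on_minus Ck_on_mult inverse Ck_on_frechet_derivative[OF Suc.prems(1)])
  qed
qed

lemma Ck_on_divide:
  fixes f g :: "'a \<Rightarrow> 'b :: real_normed_field"
  assumes "Ck_on k S f" "Ck_on k S g" "\<And>x. x \<in> S \<Longrightarrow> g x \<noteq> 0"
  shows "Ck_on k S (\<lambda>x. f x / g x)"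
  unfolding divide_inverse by (intro Ck_on_mult Ck_on_inverse assms)

lemma Ck_on_sqrt:
  assumes "Ck_on k S f" "\<And>x. x \<in> S \<Longrightarrow> f x > 0"
  shows "Ck_on k S (\<lambda>x. sqrt (f x))"
  using assms
proof (induction k arbitrary: f)
  case 0
  thus ?case using continuous_on_real_sqrt[of S f] by simp
next
  case (Suc k)
  have sqrt: "Ck_on k S (\<lambda>x. sqrt (f x))"
    by (rule Suc.IH[OF Ck_on_SucD[OF Suc.prems(1)] Suc.prems(2)])
  show ?case
  proof (rule Ck_on_SucI)
    show "((\<lambda>x. sqrt (f x)) has_derivative
        (\<lambda>v. frechet_derivative f (at x) v * (inverse (sqrt (f x)) / 2))) (at x)" if "x \<in> S" for x
      using has_derivative_real_sqrt[OF Suc.prems(2)[OF that]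
          Ck_on_Suc_has_derivative[OF Suc.prems(1) that]]
      by simp
    have "sqrt (f x) \<noteq> 0" if "x \<in> S" for x using Suc.prems(2)[OF that] by simp
    thus "Ck_on k S (\<lambda>x. frechet_derivative f (at x) v * (inverse (sqrt (f x)) / 2))" for v
      by (intro Ck_on_mult Ck_on_divide Ck_on_inverse Ck_on_const sqrt
          Ck_on_frechet_derivative[OF Suc.prems(1)])
        auto
  qed
qed

lemma Ck_on_pair:
  fixes f g :: "'a \<Rightarrow> 'b :: euclidean_space"
  assumes "Ck_on k S f" "Ck_on k S g"
  shows "Ck_on k S (\<lambda>x. pair (f x) (g x))"
  using Ck_on_linear_image[OF linear_pair[unfolded linear_conv_bounded_linear] Ck_on_Pair[OF assms]]
  by simp

lemmas Ck_on_projections =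
  Ck_on_linear_image[OF bounded_linear_fst] Ck_on_linear_image[OF bounded_linear_snd]
  Ck_on_linear_image[OF bounded_linear_vec_nth] Ck_on_linear_image[OF bounded_linear_Re]
  Ck_on_linear_image[OF bounded_linear_Im] Ck_on_linear_image[OF bounded_linear_of_real]

lemma Ck_on_cmod:
  assumes "Ck_on k S f" "\<And>x. x \<in> S \<Longrightarrow> f x \<noteq> 0"
  shows "Ck_on k S (\<lambda>x. cmod (f x))"
  unfolding cmod_def
  by (intro Ck_on_sqrt Ck_on_add Ck_on_power Ck_on_projections assms(1))
     (use assms(2) in \<open>simp add: complex_neq_0[symmetric]\<close>)

lemmas Ck_on_intros = Ck_on_const Ck_on_add Ck_on_diff Ck_on_minus Ck_on_mult Ck_on_power Ck_on_divide
  Ck_on_pair Ck_on_Pair Ck_on_projections Ck_on_cmod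

lemma Ck_on_R_act: "Ck_on k S f \<Longrightarrow> Ck_on k S (\<lambda>x. R_act v (f x))"
  unfolding R_act_conv case_prod_unfold by (intro Ck_on_intros) auto

lemma Ck_on_Heis5_act: "Ck_on k S f \<Longrightarrow> Ck_on k S (\<lambda>x. Heis5_act h (f x))"
  by (cases h) (simp only: Heis5_act_conv case_prod_unfold, intro Ck_on_intros)

lemma Ck_on_S_duality:
  assumes f_Ck: "Ck_on k S f" and det_A: "det A = 1" and pos: "\<And>x. x \<in> S \<Longrightarrow> Im (iia_tau (f x)) > 0"
  shows "Ck_on k S (\<lambda>x. S_duality A (f x))"
proof -
  have iib: "Ck_on k S (\<lambda>x. iia_to_iib (f x))"
    unfolding iia_to_iib_conv case_prod_unfold by (intro Ck_on_intros f_Ck) auto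
  have nonzero: "of_int (A $ 1 $ 0) * fst (iia_to_iib (f x)) + of_int (A $ 1 $ 1) \<noteq> 0" if "x \<in> S" for x
    using automorphy_nonzero[OF det_A pos[OF that]] by (simp add: automorphy_def fst_iia_to_iib)
  have "Ck_on k S (\<lambda>x. S_duality_iib A (iia_to_iib (f x)))"
    unfolding S_duality_iib_conv case_prod_unfold moebius_def automorphy_def Complex_eq
    by (intro Ck_on_intros iib nonzero)
  thus ?thesis
    unfolding S_duality_eq iib_to_iia_conv case_prod_unfold by (intro Ck_on_intros) auto
qed

end

lemma open_Collect_pos_on:
  fixes f :: "'a :: topological_space \<Rightarrow> real"
  assumes "open U" "continuous_on U f"
  shows "open {x \<in> U. f x > 0}"
  using continuous_open_preimage[OF assms(2,1) open_greaterThan[of 0]] by (simp add: vimage_def Int_def)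

lemma open_N_tilde: "open (N_tilde chi)"
proof -
  define U where "U = {p. Im (iia_tau p) > 0 \<and> iia_t p > 0}"
  define V where "V = {p \<in> U. R1 chi (iia_t p) (iia_tau p) > 0}"
  have t_cont: "continuous_on UNIV iia_t" unfolding iia_t_def by (intro continuous_intros)
  have \<tau>_cont: "continuous_on UNIV iia_tau" unfolding iia_tau_def Complex_eq
    by (intro continuous_intros)
  have open_U: "open U"
    unfolding U_def by (intro open_Collect_conj open_Collect_less continuous_intros t_cont \<tau>_cont)
  have "continuous_on {\<tau>. Im \<tau> > 0} eisenstein"
    by (intro continuous_at_imp_continuous_on ballI
        has_derivative_continuous[OF eisenstein_has_derivative]) auto
  hence E_cont: "continuous_on U (\<lambda>p. eisenstein (iia_tau p))"
    by (rule continuous_on_compose2[OF _ continuous_on_subset[OF \<tau>_cont]]) (auto simp: U_def)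
  have R1_cont: "continuous_on U (\<lambda>p. R1 chi (iia_t p) (iia_tau p))"
    unfolding R1_def by (intro continuous_intros E_cont continuous_on_subset[OF t_cont]) auto
  have open_V: "open V" unfolding V_def by (rule open_Collect_pos_on[OF open_U R1_cont])
  have V_subset: "V \<subseteq> U" by (auto simp: V_def)
  have "continuous_on V (\<lambda>p. R2 chi (iia_t p) (iia_tau p))"
    unfolding R2_def
    by (intro continuous_intros continuous_on_subset[OF E_cont V_subset]
        continuous_on_subset[OF R1_cont V_subset]
        continuous_on_subset[OF t_cont]) (auto simp: V_def)
  hence "open {p \<in> V. R2 chi (iia_t p) (iia_tau p) > 0}" by (rule open_Collect_pos_on[OF open_V])
  also have "{p \<in> V. R2 chi (iia_t p) (iia_tau p) > 0} = N_tilde chi"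
    by (auto simp: V_def U_def N_tilde_iff)
  finally show ?thesis .
qed

section \<open>Group actions\<close>

definition acts_on :: "('g, 'm) monoid_scheme \<Rightarrow> 'x set \<Rightarrow> ('g \<Rightarrow> 'x \<Rightarrow> 'x) \<Rightarrow> bool" where
  "acts_on G E act \<longleftrightarrow> group G \<and> (\<forall>g\<in>carrier G. \<forall>x\<in>E. act g x \<in> E) \<and> (\<forall>x\<in>E. act \<one>\<^bsub>G\<^esub> x = x) \<and>
     (\<forall>g\<in>carrier G. \<forall>h\<in>carrier G. \<forall>x\<in>E. act (g \<otimes>\<^bsub>G\<^esub> h) x = act g (act h x))"

definition acts_faithfully :: "('g, 'm) monoid_scheme \<Rightarrow> 'x set \<Rightarrow> ('g \<Rightarrow> 'x \<Rightarrow> 'x) \<Rightarrow> bool" where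
  "acts_faithfully G E act \<longleftrightarrow>
     (\<forall>g\<in>carrier G. \<forall>h\<in>carrier G. (\<forall>x\<in>E. act g x = act h x) \<longrightarrow> g = h)"

lemma acts_onD:
  assumes "acts_on G E act"
  shows "group G" "\<And>g x. g \<in> carrier G \<Longrightarrow> x \<in> E \<Longrightarrow> act g x \<in> E" "\<And>x. x \<in> E \<Longrightarrow> act \<one>\<^bsub>G\<^esub> x = x"
    "\<And>g h x. g \<in> carrier G \<Longrightarrow> h \<in> carrier G \<Longrightarrow> x \<in> E \<Longrightarrow> act (g \<otimes>\<^bsub>G\<^esub> h) x = act g (act h x)"
  using assms by (auto simp: acts_on_def)

lemma acts_on_inverse:
  assumes "acts_on G E act" "g \<in> carrier G" "x \<in> E"
  shows "act g (act (inv\<^bsub>G\<^esub> g) x) = x" "act (inv\<^bsub>G\<^esub> g) (act g x) = x"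
proof -
  interpret group G by (rule acts_onD(1)[OF assms(1)])
  show "act g (act (inv\<^bsub>G\<^esub> g) x) = x" "act (inv\<^bsub>G\<^esub> g) (act g x) = x"
    using acts_onD(3,4)[OF assms(1)] assms(2,3) by (metis inv_closed r_inv, metis inv_closed l_inv)
qed

lemma acts_on_subset:
  assumes "acts_on G E act" "F \<subseteq> E" "\<And>g x. g \<in> carrier G \<Longrightarrow> x \<in> F \<Longrightarrow> act g x \<in> F"
  shows "acts_on G F act"
  using assms unfolding acts_on_def by blast

lemma acts_faithfullyI:
  assumes act: "acts_on G E act" and kernel: "\<And>g. g \<in> carrier G \<Longrightarrow> \<forall>x\<in>E. act g x = x \<Longrightarrow> g = \<one>\<^bsub>G\<^esub>"
  shows "acts_faithfully G E act"
  unfolding acts_faithfully_def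
proof (intro ballI impI)
  interpret group G by (rule acts_onD(1)[OF act])
  fix g h assume g_h: "g \<in> carrier G" "h \<in> carrier G" "\<forall>x\<in>E. act g x = act h x"
  have "inv\<^bsub>G\<^esub> h \<otimes>\<^bsub>G\<^esub> g = \<one>\<^bsub>G\<^esub>"
    using g_h by (intro kernel ballI) (simp_all add: acts_onD(4)[OF act] acts_on_inverse[OF act])
  thus "g = h" using g_h by (metis inv_equality inv_closed inv_inv)
qed

lemma acts_on_bij_betw:
  assumes act: "acts_on G E act" and g_in: "g \<in> carrier G"
  shows "bij_betw (act g) E E"
proof -
  interpret group G by (rule acts_onD(1)[OF act])
  show ?thesis
    by (rule bij_betw_byWitness[of _ "act (inv\<^bsub>G\<^esub> g)"])
      (use g_in acts_on_inverse[OF act] acts_onD(2)[OF act] in auto)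
qed

lemma acts_on_inv_into:
  assumes act: "acts_on G E act" and g_in: "g \<in> carrier G" and x_in: "x \<in> E"
  shows "inv_into E (act g) x = act (inv\<^bsub>G\<^esub> g) x"
proof -
  interpret group G by (rule acts_onD(1)[OF act])
  show ?thesis
    using acts_on_bij_betw[OF act g_in] acts_on_inverse(1)[OF act g_in x_in] acts_onD(2)[OF act
        inv_closed[OF g_in] x_in]
    by (metis bij_betw_imp_inj_on inv_into_f_f)
qed

lemma acts_on_faithful_action:
  assumes act: "acts_on G E act" and faithful: "acts_faithfully G E act"
  shows "faithful_action G E (\<lambda>g. restrict (act g) E)"
proof -
  interpret group G by (rule acts_onD(1)[OF act])
  have Bij: "restrict (act g) E \<in> Bij E" if "g \<in> carrier G" for g
    using acts_on_bij_betw[OF act that] by (simp add: Bij_def)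
  have "group_hom G (BijGroup E) (\<lambda>g. restrict (act g) E)"
  proof (intro group_hom.intro group_hom_axioms.intro homI group_BijGroup is_group)
    fix g h assume "g \<in> carrier G" "h \<in> carrier G"
    thus "restrict (act (g \<otimes>\<^bsub>G\<^esub> h)) E = restrict (act g) E \<otimes>\<^bsub>BijGroup E\<^esub> restrict (act h) E"
      using acts_onD(2,4)[OF act] Bij by (auto simp: BijGroup_def compose_def fun_eq_iff)
  qed (use Bij in \<open>simp add: BijGroup_def\<close>)
  moreover have "inj_on (\<lambda>g. restrict (act g) E) (carrier G)"
    using faithful unfolding acts_faithfully_def inj_on_def by (metis restrict_apply')
  ultimately show ?thesis
    by (intro faithful_action.intro group_action.intro faithful_action_axioms.intro)
qed

context
  fixes G :: "('a, 'm) monoid_scheme" and H :: "('b, 'n) monoid_scheme" and E :: "'x set" and actG actH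
    and \<phi> :: "'a \<Rightarrow> 'b \<Rightarrow> 'b"
  defines \<phi>_def: "\<phi> \<equiv> conjugation E actG H actH"
  assumes G_acts: "acts_on G E actG" and H_acts: "acts_on H E actH"
    and faithful: "acts_faithfully H E actH"
    and normalises: "\<And>g h. g \<in> carrier G \<Longrightarrow> h \<in> carrier H \<Longrightarrow>
      \<exists>h'\<in>carrier H. \<forall>x\<in>E. actH h' (actG g x) = actG g (actH h x)"
begin

interpretation G: group G by (rule acts_onD(1)[OF G_acts])
interpretation H: group H by (rule acts_onD(1)[OF H_acts])

lemma eq_if_act_eq:
  "h \<in> carrier H \<Longrightarrow> h' \<in> carrier H \<Longrightarrow> (\<And>x. x \<in> E \<Longrightarrow> actH h x = actH h' x) \<Longrightarrow> h = h'"
  using faithful unfolding acts_faithfully_def by blast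

lemma conjugation_intertwines:
  assumes g_in: "g \<in> carrier G" and h_in: "h \<in> carrier H"
  shows "\<phi> g h \<in> carrier H \<and> (\<forall>x\<in>E. actH (\<phi> g h) (actG g x) = actG g (actH h x))"
  unfolding \<phi>_def conjugation_def
proof (rule theI')
  show "\<exists>!h'. h' \<in> carrier H \<and> (\<forall>x\<in>E. actH h' (actG g x) = actG g (actH h x))"
  proof (rule ex_ex1I)
    fix h' h''
    assume h'_conj: "h' \<in> carrier H \<and> (\<forall>x\<in>E. actH h' (actG g x) = actG g (actH h x))"
      and h''_conj: "h'' \<in> carrier H \<and> (\<forall>x\<in>E. actH h'' (actG g x) = actG g (actH h x))"
    show "h' = h''"
    proof (rule eq_if_act_eq)
      fix y assume y_in: "y \<in> E"
      hence "actG (inv\<^bsub>G\<^esub> g) y \<in> E" using acts_onD(2)[OF G_acts] g_in by simp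
      thus "actH h' y = actH h'' y" using h'_conj h''_conj acts_on_inverse(1)[OF G_acts g_in y_in]
        by metis
    qed (use h'_conj h''_conj in auto)
  qed (use normalises[OF g_in h_in] in blast)
qed

lemma conjugation_closed: "g \<in> carrier G \<Longrightarrow> h \<in> carrier H \<Longrightarrow> \<phi> g h \<in> carrier H"
  using conjugation_intertwines by blast

lemma act_conjugation:
  assumes "g \<in> carrier G" "h \<in> carrier H" "x \<in> E"
  shows "actH (\<phi> g h) x = actG g (actH h (actG (inv\<^bsub>G\<^esub> g) x))"
  using conjugation_intertwines[OF assms(1,2)] acts_onD(2)[OF G_acts, of "inv\<^bsub>G\<^esub> g" x]
      acts_on_inverse(1)[OF G_acts assms(1,3)] assms
  by (metis G.inv_closed)

lemmas act_simps = acts_onD(2-4)[OF G_acts] acts_onD(2-4)[OF H_acts] acts_on_inverse[OF G_acts]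
  acts_on_inverse[OF H_acts] act_conjugation conjugation_closed

lemma conjugation_one: "h \<in> carrier H \<Longrightarrow> \<phi> \<one>\<^bsub>G\<^esub> h = h"
  by (rule eq_if_act_eq) (simp_all add: act_simps)

lemma conjugation_mult:
  assumes "g \<in> carrier G" "g' \<in> carrier G" "h \<in> carrier H" "h' \<in> carrier H"
  shows "\<phi> g (h \<otimes>\<^bsub>H\<^esub> \<phi> g' h') = \<phi> g h \<otimes>\<^bsub>H\<^esub> \<phi> (g \<otimes>\<^bsub>G\<^esub> g') h'"
  by (rule eq_if_act_eq) (use assms in \<open>simp_all add: act_simps G.inv_mult_group\<close>)

lemma conjugation_inv:
  assumes "g \<in> carrier G" "h \<in> carrier H"
  shows "\<phi> g (inv\<^bsub>H\<^esub> h) \<otimes>\<^bsub>H\<^esub> \<phi> g h = \<one>\<^bsub>H\<^esub>"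
  by (rule eq_if_act_eq) (use assms in \<open>simp_all add: act_simps\<close>)

lemma group_semidirect_conjugation: "group (semidirect G H \<phi>)"
proof (rule groupI)
  fix x assume "x \<in> carrier (semidirect G H \<phi>)"
  then obtain g h where "x = (g, h)" "g \<in> carrier G" "h \<in> carrier H" by (auto simp: semidirect_def)
  thus "\<exists>y\<in>carrier (semidirect G H \<phi>). y \<otimes>\<^bsub>semidirect G H \<phi>\<^esub> x = \<one>\<^bsub>semidirect G H \<phi>\<^esub>"
    by (intro bexI[of _ "(inv\<^bsub>G\<^esub> g, \<phi> (inv\<^bsub>G\<^esub> g) (inv\<^bsub>H\<^esub> h))"])
      (simp_all add: semidirect_def conjugation_inv conjugation_closed)
qed (auto simp: semidirect_def conjugation_one conjugation_mult conjugation_closed H.m_assoc G.m_assoc)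

lemma acts_on_semidirect_conjugation: "acts_on (semidirect G H \<phi>) E (semidirect_act actG actH)"
  unfolding acts_on_def
  using group_semidirect_conjugation
  by (auto simp: semidirect_def semidirect_act_def act_simps)

end

lemma group_SL2Z: "group SL2Z"
proof (rule groupI)
  fix A assume "A \<in> carrier SL2Z"
  thus "\<exists>B\<in>carrier SL2Z. B \<otimes>\<^bsub>SL2Z\<^esub> A = \<one>\<^bsub>SL2Z\<^esub>"
    by (intro bexI[of _ "adjugate_2 A"]) (simp_all add: SL2Z_def adjugate_2_mult)
qed (auto simp: SL2Z_def det_mul matrix_mul_assoc)

lemma moebius_mult_automorphy:
  assumes "det A = 1" "Im \<tau> > 0"
  shows "moebius A \<tau> * automorphy A \<tau> = of_int (A $ 0 $ 0) * \<tau> + of_int (A $ 0 $ 1)"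
  using automorphy_nonzero[OF assms] by (simp add: moebius_def)

lemma linear_fractional_mult:
  fixes A :: "int^2^2"
  assumes "det B = 1" "Im \<tau> > 0"
  shows "of_int ((A ** B) $ i $ 0) * \<tau> + of_int ((A ** B) $ i $ 1) =
    (of_int (A $ i $ 0) * moebius B \<tau> + of_int (A $ i $ 1)) * automorphy B \<tau>"
proof -
  have "(of_int (A $ i $ 0) * moebius B \<tau> + of_int (A $ i $ 1)) * automorphy B \<tau> =
      of_int (A $ i $ 0) * (moebius B \<tau> * automorphy B \<tau>) + of_int (A $ i $ 1) * automorphy B \<tau>"
    by (simp add: algebra_simps)
  thus ?thesis
    unfolding moebius_mult_automorphy[OF assms]
    by (simp add: automorphy_def matrix_mult_2_nth algebra_simps)
qed

lemma automorphy_mult: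
  assumes "det B = 1" "Im \<tau> > 0"
  shows "automorphy (A ** B) \<tau> = automorphy A (moebius B \<tau>) * automorphy B \<tau>"
  using linear_fractional_mult[OF assms, of A 1] by (simp add: automorphy_def)

lemma moebius_mult:
  assumes "det B = 1" "Im \<tau> > 0"
  shows "moebius (A ** B) \<tau> = moebius A (moebius B \<tau>)"
  using automorphy_nonzero[OF assms]
  unfolding moebius_def[of "A ** B"] automorphy_mult[OF assms] linear_fractional_mult[OF assms, of A 0]
  by (simp add: moebius_def[of A])

lemma S_duality_iib_mult:
  assumes "det B = 1" "Im (fst q) > 0"
  shows "S_duality_iib (A ** B) q = S_duality_iib A (S_duality_iib B q)"
  using assms
  by (cases q) (simp add: S_duality_iib_conv moebius_mult automorphy_mult norm_mult matrix_mult_2_nth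
      algebra_simps del: S_duality_iib.simps)

lemma S_duality_one: "S_duality (mat 1) p = p"
proof -
  have "S_duality_iib (mat 1) q = q" for q by (cases q) (simp add: mat_def Let_def)
  thus ?thesis by (simp add: S_duality_eq iib_to_iia_to_iib)
qed

lemma acts_on_SL2Z: "acts_on SL2Z iia_space S_duality"
  unfolding acts_on_def
proof (intro conjI ballI group_SL2Z)
  fix A B :: "int^2^2" and p :: iia assume "A \<in> carrier SL2Z" "B \<in> carrier SL2Z" "p \<in> iia_space"
  thus "S_duality (A \<otimes>\<^bsub>SL2Z\<^esub> B) p = S_duality A (S_duality B p)"
    by (simp add: SL2Z_def S_duality_eq iia_to_iib_to_iia S_duality_iib_mult iia_space_iff
        fst_iia_to_iib)
qed (auto simp: SL2Z_def S_duality_one S_duality_iia_space)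

lemma pair_nth_nth: "pair (x $ 0) (x $ 1) = x"
  by (simp add: pair_eq_iff)

lemma R_act_0: "R_act 0 p = p"
  by (cases p) (simp add: pair_nth_nth)

lemma R_act_add: "R_act (v + w) p = R_act v (R_act w p)"
  by (cases p) (simp add: pair_eq_iff, simp add: field_simps power2_eq_square power3_eq_cube)

lemma acts_on_R_add: "acts_on R_add iia_space R_act"
  unfolding acts_on_def
proof (intro conjI ballI)
  show "group R_add"
    by (rule groupI) (auto simp: R_add_def intro: exI[of _ "- _"])
qed (auto simp: R_add_def R_act_0 R_act_add iia_space_iff iia_tau_R_act iia_t_R_act)

lemma group_H4: "group H4"
proof (rule groupI)
  fix h assume "h \<in> carrier H4"
  thus "\<exists>k\<in>carrier H4. k \<otimes>\<^bsub>H4\<^esub> h = \<one>\<^bsub>H4\<^esub>"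
    by (intro bexI[of _ "- h"]) (cases h, auto simp: H4_def Heis5_def sum_UNIV_2)+
qed (auto simp: H4_def Heis5_def sum_UNIV_2 algebra_simps)

lemma Heis5_act_one: "Heis5_act \<one>\<^bsub>H4\<^esub> p = p"
  by (cases p) (simp add: H4_def Heis5_def)

lemma Heis5_act_mult: "Heis5_act (h \<otimes>\<^bsub>H4\<^esub> k) p = Heis5_act h (Heis5_act k p)"
  by (cases h; cases k; cases p) (simp add: H4_def Heis5_def sum_UNIV_2, simp add: algebra_simps)

lemma acts_on_H4: "acts_on H4 iia_space Heis5_act"
  unfolding acts_on_def
  by (auto simp: group_H4 Heis5_act_one Heis5_act_mult) (auto simp: H4_def iia_space_def)

lemma one_semidirect: "\<one>\<^bsub>semidirect G H \<phi>\<^esub> = (\<one>\<^bsub>G\<^esub>, \<one>\<^bsub>H\<^esub>)"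
  and carrier_semidirect: "carrier (semidirect G H \<phi>) = carrier G \<times> carrier H"
  by (simp_all add: semidirect_def)

lemma Heis5_act_fixed_point: "Heis5_act h p = p \<Longrightarrow> h = \<one>\<^bsub>H4\<^esub>"
  by (cases h; cases p) (auto simp: H4_def Heis5_def)

lemma base_point_iia_space: "(1, \<i>, 0, 0, 0) \<in> iia_space"
  by (simp add: iia_space_def)

lemma acts_faithfully_H4: "acts_faithfully H4 iia_space Heis5_act"
  using acts_on_H4 by (rule acts_faithfullyI) (blast intro: Heis5_act_fixed_point base_point_iia_space)

lemma acts_on_R_H4: "acts_on R_H4 iia_space R_H4_act"
  unfolding R_H4_def R_H4_act_def
proof (rule acts_on_semidirect_conjugation[OF acts_on_R_add acts_on_H4 acts_faithfully_H4])
  fix v :: real and h assume "h \<in> carrier H4"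
  then obtain \<eta> \<eta>t \<kappa> where h_eq: "h = (\<eta>, \<eta>t, \<kappa>)" "\<eta> $ 0 = 0" by (cases h) (auto simp: H4_def)
  define h' where "h' = (\<eta>, pair (\<eta>t $ 0 + 1 / 2 * v\<^sup>2 * \<eta> $ 1 - \<eta>t $ 1 * v) (\<eta>t $ 1 - v * \<eta> $ 1), \<kappa>)"
  have "Heis5_act h' (R_act v p) = R_act v (Heis5_act h p)" for p
    by (cases p) (simp add: h_eq h'_def sum_UNIV_2 vec2_eq_iff, simp add: field_simps
        power2_eq_square power3_eq_cube)
  moreover have "h' \<in> carrier H4" using h_eq by (simp add: h'_def H4_def)
  ultimately show "\<exists>h'\<in>carrier H4. \<forall>p\<in>iia_space. Heis5_act h' (R_act v p) = R_act v (Heis5_act h p)"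
    by blast
qed

lemma R_H4_act_fixed_point:
  assumes "R_H4_act g p = p"
  shows "g = \<one>\<^bsub>R_H4\<^esub>"
proof -
  obtain v h where g_eq: "g = (v, h)" by (cases g)
  have fixed: "Heis5_act h (R_act v p) = p" using assms
    by (simp add: g_eq R_H4_act_def semidirect_act_def)
  hence v_eq: "v = 0" by (cases p; cases h) simp
  hence "h = \<one>\<^bsub>H4\<^esub>" using fixed by (intro Heis5_act_fixed_point[of h p]) (simp add: R_act_0)
  thus ?thesis by (simp add: g_eq v_eq R_H4_def one_semidirect R_add_def)
qed

lemma acts_faithfully_R_H4: "acts_faithfully R_H4 iia_space R_H4_act"
  using acts_on_R_H4 by (rule acts_faithfullyI) (blast intro: R_H4_act_fixed_point base_point_iia_space)

text \<open>
  In type IIB coordinates the elements of \<open>R_H4\<close> take a form in which S-duality covariance is visible: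
  \<open>(c\<^sup>1, b)\<close>, \<open>(x, v)\<close>, \<open>(\<psi>, - c\<^sub>0)\<close> and \<open>(k1, - k0)\<close> are doublets, while \<open>c\<^sub>1\<close>, \<open>e\<close> and
  \<open>v c\<^sup>1 - b x\<close> are invariant.
\<close>

fun iib_shift :: "real \<times> real \<times> real \<times> real \<times> real \<Rightarrow> iib \<Rightarrow> iib" where
  "iib_shift (x, v, e, k0, k1) (\<tau>, z, cu1, c1, c0, \<psi>) = (let b = Re z; w = v * cu1 - b * x in
     (\<tau>, z + of_real v, cu1 + x, c1 + e + w / 2, c0 + k0 - v * c1 - (b / 6 + v / 3) * w,
      \<psi> + k1 + x * c1 + (cu1 / 6 + x / 3) * w))"

fun R_H4_of_shift :: "real \<times> real \<times> real \<times> real \<times> real \<Rightarrow> real \<times> ((real^2) \<times> (real^2) \<times> real)" where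
  "R_H4_of_shift (x, v, e, k0, k1) =
     (v, pair 0 (- x), pair (k0 - v\<^sup>2 * x / 6) (e + v * x / 2),
      - 2 * (k1 - (e + v * x / 2) * x / 2 + v * x\<^sup>2 / 3))"

lemma R_H4_of_shift_carrier: "R_H4_of_shift s \<in> carrier R_H4"
  by (cases s) (simp add: R_H4_def carrier_semidirect R_add_def H4_def)

lemma R_H4_of_shift_surj:
  assumes "g \<in> carrier R_H4"
  obtains s where "g = R_H4_of_shift s"
proof -
  obtain v \<eta> \<eta>t \<kappa> where g_eq: "g = (v, \<eta>, \<eta>t, \<kappa>)" by (cases g)
  have "\<eta> $ 0 = 0" using assms by (simp add: g_eq R_H4_def carrier_semidirect H4_def)
  hence "g = R_H4_of_shift (- \<eta> $ 1, v, \<eta>t $ 1 + v * \<eta> $ 1 / 2, \<eta>t $ 0 - v\<^sup>2 * \<eta> $ 1 / 6,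
      - \<kappa> / 2 - \<eta>t $ 1 * \<eta> $ 1 / 2 - v * (\<eta> $ 1)\<^sup>2 / 3)"
    by (simp add: g_eq vec2_eq_iff)
  thus thesis by (rule that)
qed

lemma R_H4_act_iib_to_iia: "R_H4_act (R_H4_of_shift s) (iib_to_iia q) = iib_to_iia (iib_shift s q)"
  by (cases s; cases q)
    (simp add: R_H4_act_def semidirect_act_def Let_def vec2_eq_iff sum_UNIV_2,
     simp add: field_simps power2_eq_square power3_eq_cube)

fun S_duality_shift ::
  "int^2^2 \<Rightarrow> real \<times> real \<times> real \<times> real \<times> real \<Rightarrow> real \<times> real \<times> real \<times> real \<times> real" where
  "S_duality_shift A (x, v, e, k0, k1) =
     (of_int (A $ 0 $ 0) * x + of_int (A $ 0 $ 1) * v,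
      of_int (A $ 1 $ 0) * x + of_int (A $ 1 $ 1) * v, e,
      of_int (A $ 1 $ 1) * k0 - of_int (A $ 1 $ 0) * k1,
      of_int (A $ 0 $ 0) * k1 - of_int (A $ 0 $ 1) * k0)"

lemma symplectic_det_2:
  fixes A :: "int^2^2" and x y x' y' :: real
  assumes "det A = 1"
  shows "(of_int (A $ 1 $ 0) * x + of_int (A $ 1 $ 1) * y) *
      (of_int (A $ 0 $ 0) * x' + of_int (A $ 0 $ 1) * y') -
    (of_int (A $ 1 $ 0) * x' + of_int (A $ 1 $ 1) * y') *
      (of_int (A $ 0 $ 0) * x + of_int (A $ 0 $ 1) * y) =
    y * x' - y' * x"
proof -
  have "of_int (A $ 0 $ 0) * of_int (A $ 1 $ 1) - of_int (A $ 0 $ 1) * of_int (A $ 1 $ 0) =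
      real_of_int (det A)"
    by (simp add: det_matrix_2)
  hence "of_int (A $ 0 $ 0) * of_int (A $ 1 $ 1) = 1 + real_of_int (A $ 0 $ 1) * of_int (A $ 1 $ 0)"
    using assms by simp
  thus ?thesis by algebra
qed

lemma S_duality_iib_shift:
  assumes det_A: "det A = 1"
  shows "S_duality_iib A (iib_shift s q) = iib_shift (S_duality_shift A s) (S_duality_iib A q)"
  by (cases s; cases q)
    (simp add: S_duality_iib_conv Let_def symplectic_det_2[OF det_A] del: S_duality_iib.simps,
     simp add: complex_eq_iff algebra_simps add_divide_distrib diff_divide_distrib)

lemma acts_on_SL2Z_R_H4: "acts_on SL2Z_R_H4 iia_space SL2Z_R_H4_act"
  unfolding SL2Z_R_H4_def SL2Z_R_H4_act_def
proof (rule acts_on_semidirect_conjugation[OF acts_on_SL2Z acts_on_R_H4 acts_faithfully_R_H4])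
  fix A g assume A_in: "A \<in> carrier SL2Z" and "g \<in> carrier R_H4"
  then obtain s where g_eq: "g = R_H4_of_shift s" using R_H4_of_shift_surj by blast
  have "R_H4_act (R_H4_of_shift (S_duality_shift A s)) (S_duality A p) = S_duality A (R_H4_act g p)"
    for p
  proof -
    obtain q where p_eq: "p = iib_to_iia q" using iib_to_iia_to_iib by metis
    show ?thesis using A_in unfolding p_eq g_eq
      by (simp add: S_duality_eq R_H4_act_iib_to_iia iia_to_iib_to_iia S_duality_iib_shift SL2Z_def)
  qed
  thus "\<exists>h\<in>carrier R_H4. \<forall>p\<in>iia_space. R_H4_act h (S_duality A p) = S_duality A (R_H4_act g p)"
    using R_H4_of_shift_carrier by blast
qed

lemma SL2Z_R_H4_cases:
  assumes "g \<in> carrier SL2Z_R_H4"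
  obtains A v h where "g = (A, v, h)" "det A = 1" "fst h $ 0 = 0"
    "SL2Z_R_H4_act g = (\<lambda>p. Heis5_act h (R_act v (S_duality A p)))"
proof -
  obtain A v h where g_eq: "g = (A, v, h)" by (cases g) auto
  have "det A = 1" "fst h $ 0 = 0"
    using assms by (auto simp: g_eq SL2Z_R_H4_def R_H4_def carrier_semidirect SL2Z_def H4_def)
  thus ?thesis
    using that[OF g_eq]
    by (auto simp: g_eq SL2Z_R_H4_act_def R_H4_act_def semidirect_act_def fun_eq_iff)
qed

lemma R_act_N_tilde: "R_act v p \<in> N_tilde chi \<longleftrightarrow> p \<in> N_tilde chi"
  by (simp add: N_tilde_iff iia_tau_R_act iia_t_R_act)

lemma Heis5_act_N_tilde: "fst h $ 0 = 0 \<Longrightarrow> Heis5_act h p \<in> N_tilde chi \<longleftrightarrow> p \<in> N_tilde chi"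
  by (simp add: N_tilde_iff iia_tau_Heis5_act iia_t_Heis5_act)

lemma acts_on_N_tilde: "acts_on SL2Z_R_H4 (N_tilde chi) SL2Z_R_H4_act"
proof (rule acts_on_subset[OF acts_on_SL2Z_R_H4])
  show "N_tilde chi \<subseteq> iia_space" by (auto simp: N_tilde_iff iia_space_iff)
  fix g p assume g_in: "g \<in> carrier SL2Z_R_H4" and p_in: "p \<in> N_tilde chi"
  from g_in show "SL2Z_R_H4_act g p \<in> N_tilde chi"
    by (rule SL2Z_R_H4_cases)
      (use p_in in \<open>simp add: Heis5_act_N_tilde R_act_N_tilde S_duality_N_tilde\<close>)
qed

lemma ex_R1_R2_pos: "\<exists>t>0. R1 chi t \<tau> > 0 \<and> R2 chi t \<tau> > 0"
proof -
  define a b c where "a = real chi / (4 * (2 * pi) ^ 3) * eisenstein \<tau>"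
    and "b = 3 * real chi / (4 * (2 * pi) ^ 3) * eisenstein \<tau>"
    and "c = (3 * real chi)\<^sup>2 / (4 * pi) ^ 6 * (eisenstein \<tau>)\<^sup>2"
  define M where "M = 1 + \<bar>a\<bar> + \<bar>b\<bar> + c"
  have c_nonneg: "c \<ge> 0" by (simp add: c_def)
  define t where "t = root 3 (3 * M)"
  have t_cube: "t > 0" "t ^ 3 / 3 = M" using c_nonneg by (simp_all add: t_def M_def)
  have R1_ge_1: "R1 chi t \<tau> \<ge> 1" unfolding R1_def t_cube(2) a_def[symmetric] M_def using c_nonneg
    by linarith
  hence "c * inverse (R1 chi t \<tau>) \<le> c * 1" using c_nonneg
    by (intro mult_left_mono) (auto simp: inverse_le_1_iff)
  hence "R2 chi t \<tau> \<ge> 1" unfolding R2_def t_cube(2) b_def[symmetric] c_def[symmetric] M_def by linarith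
  thus ?thesis using t_cube(1) R1_ge_1 by (intro exI[of _ t]) simp
qed

lemma N_tilde_point:
  assumes "y > 0"
  obtains t where "(y, Complex b t, 0, 0, 0) \<in> N_tilde chi"
  using ex_R1_R2_pos[of chi "Complex 0 y"] assms by (auto simp: N_tilde_iff iia_tau_def iia_t_def)

lemma moebius_fixes_imaginary_axis:
  assumes det_A: "det A = 1" and axis: "\<And>y. y > 0 \<Longrightarrow> moebius A (Complex 0 y) = Complex 0 y"
  shows "A $ 0 $ 1 = 0" "A $ 1 $ 0 = 0" "A $ 0 $ 0 = A $ 1 $ 1"
proof -
  have entries: "A $ 0 $ 0 = A $ 1 $ 1 \<and> real_of_int (A $ 0 $ 1) = - y\<^sup>2 * of_int (A $ 1 $ 0)"
    if "y > 0" for y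
    using moebius_mult_automorphy[OF det_A, of "Complex 0 y"] that axis[OF that]
    by (auto simp: automorphy_def complex_eq_iff power2_eq_square mult_ac)
  have "real_of_int (A $ 0 $ 1) = - of_int (A $ 1 $ 0)"
      "real_of_int (A $ 0 $ 1) = - 4 * of_int (A $ 1 $ 0)"
    using entries[of 1] entries[of 2] by simp_all
  thus "A $ 0 $ 1 = 0" "A $ 1 $ 0 = 0" by linarith+
  show "A $ 0 $ 0 = A $ 1 $ 1" using entries[of 1] by simp
qed

lemma acts_faithfully_SL2Z_R_H4: "acts_faithfully SL2Z_R_H4 (N_tilde chi) SL2Z_R_H4_act"
proof (rule acts_faithfullyI[OF acts_on_N_tilde])
  fix g assume g_in: "g \<in> carrier SL2Z_R_H4" and trivial: "\<forall>p\<in>N_tilde chi. SL2Z_R_H4_act g p = p"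
  from g_in obtain A v h where tuple: "g = (A, v, h)" and det_A: "det A = 1" and h_eta: "fst h $ 0 = 0"
    and "SL2Z_R_H4_act g = (\<lambda>p. Heis5_act h (R_act v (S_duality A p)))" by (rule SL2Z_R_H4_cases)
  hence fixed: "Heis5_act h (R_act v (S_duality A p)) = p" if "p \<in> N_tilde chi" for p
    using trivial that by metis
  have "moebius A (Complex 0 y) = Complex 0 y" if y_pos: "y > 0" for y
  proof -
    obtain t where base_point: "(y, Complex 0 t, 0, 0, 0) \<in> N_tilde chi"
      using N_tilde_point[OF y_pos] by blast
    show ?thesis
      using arg_cong[OF fixed[OF base_point], of iia_tau]
      by (simp add: iia_tau_Heis5_act h_eta iia_tau_R_act iia_tau_S_duality) (simp add: iia_tau_def)
  qed
  note A_entries = moebius_fixes_imaginary_axis[OF det_A this]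
  have "of_int (A $ 1 $ 1) * b + v = b" for b
  proof -
    obtain t where base_point: "(1, Complex b t, 0, 0, 0) \<in> N_tilde chi" using N_tilde_point[of 1]
      by auto
    have translation: "Re (fst (snd (Heis5_act h (R_act v p)))) = Re (fst (snd p)) + v" for p
      by (cases p; cases h) simp
    show ?thesis
      using arg_cong[OF fixed[OF base_point], of "\<lambda>p. Re (fst (snd p))"]
      unfolding translation by (simp add: S_duality_eq Let_def A_entries)
  qed
  from this[of 0] this[of 1] have v_eq: "v = 0" and "A $ 1 $ 1 = 1" by simp_all
  hence mat_1: "A = mat 1" using A_entries by (simp add: vec2_eq_iff mat_def)
  obtain t where "(1, Complex 0 t, 0, 0, 0) \<in> N_tilde chi" using N_tilde_point[of 1] by auto
  from fixed[OF this] have "h = \<one>\<^bsub>H4\<^esub>"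
    unfolding v_eq mat_1 R_act_0 S_duality_one by (rule Heis5_act_fixed_point)
  thus "g = \<one>\<^bsub>SL2Z_R_H4\<^esub>"
    by (simp add: tuple v_eq mat_1 SL2Z_R_H4_def R_H4_def one_semidirect SL2Z_def R_add_def)
qed

lemma smooth_on_SL2Z_R_H4_act:
  assumes "g \<in> carrier SL2Z_R_H4"
  shows "smooth_on (N_tilde chi) (SL2Z_R_H4_act g)"
proof -
  from assms obtain A v h where det_A: "det A = 1"
    and act: "SL2Z_R_H4_act g = (\<lambda>p. Heis5_act h (R_act v (S_duality A p)))" by (rule SL2Z_R_H4_cases)
  show ?thesis
    unfolding smooth_on_def act
    by (intro allI Ck_on_Heis5_act Ck_on_R_act Ck_on_S_duality open_N_tilde det_A Ck_on_bounded_linear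
        bounded_linear_ident) (simp add: N_tilde_iff)
qed

lemma smooth_on_inv_into_SL2Z_R_H4_act:
  assumes g_in: "g \<in> carrier SL2Z_R_H4"
  shows "smooth_on (N_tilde chi) (inv_into (N_tilde chi) (SL2Z_R_H4_act g))"
proof -
  interpret group SL2Z_R_H4 by (rule acts_onD(1)[OF acts_on_SL2Z_R_H4])
  show ?thesis
    using smooth_on_SL2Z_R_H4_act[OF inv_closed[OF g_in]] acts_on_inv_into[OF acts_on_N_tilde g_in]
    unfolding smooth_on_def by (metis Ck_on_cong[OF open_N_tilde])
qed

lemma isometry_at_SL2Z_R_H4_act:
  assumes c_l: "c_l = real chi / (192 * pi)" and g_in: "g \<in> carrier SL2Z_R_H4"
    and p_in: "p \<in> N_tilde chi"
  shows "isometry_at (N_tilde chi) (qmap_metric (prepotential chi) chi c_l) (SL2Z_R_H4_act g) p"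
proof -
  from g_in obtain A v h where det_A: "det A = 1" and h_eta: "fst h $ 0 = 0"
    and act: "SL2Z_R_H4_act g = (\<lambda>p. Heis5_act h (R_act v (S_duality A p)))" by (rule SL2Z_R_H4_cases)
  have S_in: "S_duality A p \<in> N_tilde chi" by (rule S_duality_N_tilde[OF det_A p_in])
  hence R_in: "R_act v (S_duality A p) \<in> N_tilde chi" by (simp add: R_act_N_tilde)
  have "isometry_at (N_tilde chi) (qmap_metric (prepotential chi) chi c_l)
      (\<lambda>p. R_act v (S_duality A p)) p"
    by (rule isometry_at_compose[OF isometry_at_S_duality[OF c_l p_in det_A]
        isometry_at_R_act[OF c_l S_in]])
  from isometry_at_compose[OF this isometry_at_Heis5_act[OF c_l R_in h_eta]] show ?thesis
    unfolding act .
qed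

theorem corollary5p5:
  fixes chi :: nat and c_l :: real
  assumes "chi > 0" and "c_l = real chi / (192 * pi)"
  shows "(\<forall>p\<in>N_tilde chi. qmap_metric_defined (prepotential chi) chi c_l p \<and>
            positive_definite (qmap_metric (prepotential chi) chi c_l p)) \<and>
         faithful_action SL2Z_R_H4 (N_tilde chi)
           (\<lambda>x. restrict (SL2Z_R_H4_act x) (N_tilde chi)) \<and>
         (\<forall>x\<in>carrier SL2Z_R_H4.
            isometry_on (N_tilde chi) (qmap_metric (prepotential chi) chi c_l) (SL2Z_R_H4_act x))"
proof (intro conjI ballI)
  fix p assume p_in: "p \<in> N_tilde chi"
  show "qmap_metric_defined (prepotential chi) chi c_l p"
    by (rule qmap_metric_defined_N_tilde[OF assms(2) p_in])
  show "positive_definite (qmap_metric (prepotential chi) chi c_l p)"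
    by (rule positive_definite_qmap_metric[OF assms(2) p_in])
next
  show "faithful_action SL2Z_R_H4 (N_tilde chi) (\<lambda>x. restrict (SL2Z_R_H4_act x) (N_tilde chi))"
    by (rule acts_on_faithful_action[OF acts_on_N_tilde acts_faithfully_SL2Z_R_H4])
next
  fix g assume g_in: "g \<in> carrier SL2Z_R_H4"
  show "isometry_on (N_tilde chi) (qmap_metric (prepotential chi) chi c_l) (SL2Z_R_H4_act g)"
    unfolding isometry_on_def
    using acts_on_bij_betw[OF acts_on_N_tilde g_in] smooth_on_SL2Z_R_H4_act[OF g_in]
      smooth_on_inv_into_SL2Z_R_H4_act[OF g_in]
      isometry_at_frechet_derivative[OF isometry_at_SL2Z_R_H4_act[OF assms(2) g_in]]
    by blast
qed

end
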